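(* Let $X_1:\Omega_1\to\mathrm{DCS}(0,1)$ and $X_2:\Omega_2\to\mathrm{DCS}(0,1)$ be two random dense countable subsets of $(0,1)$ (defined on possibly different standard probability spaces), each of which is stationary and satisfies the independence condition. Then $X_1$ and $X_2$ are identically distributed.
   Context: All probability spaces are standard (Lebesgue–Rokhlin). $\mathrm{DCS}(0,1)$ is the set of all dense countable subsets of $(0,1)$, viewed as the quotient $B/E$, where $B=(0,1)^\infty_{\neq}$ is the standard Borel space of all sequences of pairwise different points of $(0,1)$ (only sequences whose set of values is dense matter), and $E$ identifies two sequences differing by a permutation of $\{1,2,\dots\}$. A random dense countable subset of $(0,1)$ is a map $X:\Omega\to\mathrm{DCS}(0,1)$ on a probability space $\Omega$ which is measurable in the sense that it admits a measurable lifting $Y=(Y_1,Y_2,\dots):\Omega\to B$ (a measurable enumeration): the $Y_k$ are random variables, pairwise different, and $X(\omega)=\{Y_1(\omega),Y_2(\omega),\dots\}$ for almost all $\omega$. (Maps are considered up to almost sure equality.) The same definition applies to any other open interval in place of $(0,1)$. Two random dense countable sets $X_1:\Omega_1\to\mathrm{DCS}(0,1)$, $X_2:\Omega_2\to\mathrm{DCS}(0,1)$ are identically distributed if there is a joining $J$ of $\Omega_1,\Omega_2$ (a probability measure on $\Omega_1\times\Omega_2$ whose marginals are the given probability measures) such that $X_1(\omega_1)=X_2(\omega_2)$ for $J$-almost all $(\omega_1,\omega_2)$. Finitely many random dense countable sets defined on the same probability space are independent if they admit independent measurable liftings (enumerations) on that probability space. Independence condition: $X$ satisfies $\mathbb{P}(t\in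 X)=0$ for each $t\in(0,1)$, and for all $n=1,2,\dots$ and all $0=t_0<t_1<\dots<t_n=1$ the random dense countable subsets $X_k=X\cap(t_{k-1},t_k)$ of $(t_{k-1},t_k)$, $k=1,\dots,n$, are independent. Stationarity: for $s\in(0,1)$ the cyclic shift $T_s$ of $(0,1)$ is $T_s(t)=t+s$ for $t\in(0,1-s)$ and $T_s(t)=t+s-1$ for $t\in(1-s,1)$ ($T_s$ is undefined at $1-s$). A random dense countable subset $X:\Omega\to\mathrm{DCS}(0,1)$ is stationary if $\mathbb{P}(t\in X)=0$ for each $t\in(0,1)$, and $X$ is identically distributed with the random dense countable set $Y:\Omega\times(0,1)\to\mathrm{DCS}(0,1)$, $Y(\omega,s)=T_s(X(\omega))=\{T_s(t):t\in X(\omega)\}$, where $(0,1)$ carries Lebesgue measure and $\Omega\times(0,1)$ the product measure. *)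

theory Defs
  imports "HOL-Probability.Probability"
begin

text \<open>
  Isomorphism modulo 0: after discarding null sets there is a bijection, measurable in both
  directions and measure preserving (so that its inverse preserves measure as well).
\<close>

definition isomorphic_mod0 :: "'a measure \<Rightarrow> 'b measure \<Rightarrow> bool" where
  "isomorphic_mod0 M N \<longleftrightarrow>
     (\<exists>A\<in>null_sets M. \<exists>B\<in>null_sets N. \<exists>f.
        let M' = restrict_space M (space M - A); N' = restrict_space N (space N - B) in
          bij_betw f (space M') (space N') \<and>
          f \<in> M' \<rightarrow>\<^sub>M N' \<and>
          the_inv_into (space M') f \<in> N' \<rightarrow>\<^sub>M M' \<and>
          distr M' N' f = N')"

text \<open>
  Lebesgue--Rokhlin spaces: complete probability spaces that are, modulo 0, the disjoint union
  of an interval with Lebesgue measure and an at most countable set \<open>C\<close> of atoms. Both parts may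
  be absent (\<open>l = 0\<close>, respectively \<open>C = {}\<close>); necessarily \<open>l\<close> is the total mass of the
  complement of \<open>C\<close>.
\<close>

definition standard_prob_space :: "'a measure \<Rightarrow> bool" where
  "standard_prob_space M \<longleftrightarrow>
     prob_space M \<and> complete_measure M \<and>
     (\<exists>C l. countable C \<and> C \<subseteq> space M \<and> (\<forall>c\<in>C. {c} \<in> sets M \<and> emeasure M {c} > 0) \<and>
        0 \<le> l \<and> isomorphic_mod0 (restrict_space M (space M - C)) (lebesgue_on {0..<l::real}))"

definition DCS :: "real \<Rightarrow> real \<Rightarrow> real set set" where
  "DCS a b = {S. S \<subseteq> {a<..<b} \<and> countable S \<and> {a<..<b} \<subseteq> closure S}"

text \<open>
  The standard Borel space of sequences of pairwise different points of the interval from \<open>a\<close>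
  to \<open>b\<close>. Sequences are indexed from 0. Two of them differ by a permutation of the indices iff
  they have the same range, so a point of the quotient is represented by that range.
\<close>

definition enum_space :: "real \<Rightarrow> real \<Rightarrow> (nat \<Rightarrow> real) measure" where
  "enum_space a b =
     restrict_space (\<Pi>\<^sub>M i\<in>UNIV. borel) {y. inj y \<and> range y \<subseteq> {a<..<b}}"

definition measurable_lifting ::
  "'a measure \<Rightarrow> real \<Rightarrow> real \<Rightarrow> ('a \<Rightarrow> real set) \<Rightarrow> ('a \<Rightarrow> nat \<Rightarrow> real) \<Rightarrow> bool" where
  "measurable_lifting M a b X Y \<longleftrightarrow>
     Y \<in> M \<rightarrow>\<^sub>M enum_space a b \<and> (AE \<omega> in M. X \<omega> = range (Y \<omega>))"

definition random_dcs :: "'a measure \<Rightarrow> real \<Rightarrow> real \<Rightarrow> ('a \<Rightarrow> real set) \<Rightarrow> bool" where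
  "random_dcs M a b X \<longleftrightarrow> X \<in> space M \<rightarrow> DCS a b \<and> (\<exists>Y. measurable_lifting M a b X Y)"

definition joining :: "'a measure \<Rightarrow> 'b measure \<Rightarrow> ('a \<times> 'b) measure \<Rightarrow> bool" where
  "joining M N J \<longleftrightarrow>
     prob_space J \<and> sets J = sets (M \<Otimes>\<^sub>M N) \<and> distr J M fst = M \<and> distr J N snd = N"

definition identically_distributed ::
  "'a measure \<Rightarrow> ('a \<Rightarrow> real set) \<Rightarrow> 'b measure \<Rightarrow> ('b \<Rightarrow> real set) \<Rightarrow> bool" where
  "identically_distributed M X N Y \<longleftrightarrow>
     (\<exists>J. joining M N J \<and> (AE p in J. X (fst p) = Y (snd p)))"

text \<open>
  Independence of random dense countable subsets \<open>X i\<close> of the intervals from \<open>a i\<close> to \<open>b i\<close>,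
  for \<open>i\<close> in a finite index set \<open>I\<close>.
\<close>

definition independent_dcs ::
  "'a measure \<Rightarrow> 'i set \<Rightarrow> ('i \<Rightarrow> real) \<Rightarrow> ('i \<Rightarrow> real) \<Rightarrow> ('i \<Rightarrow> 'a \<Rightarrow> real set) \<Rightarrow> bool" where
  "independent_dcs M I a b X \<longleftrightarrow>
     (\<forall>i\<in>I. random_dcs M (a i) (b i) (X i)) \<and>
     (\<exists>Y. (\<forall>i\<in>I. measurable_lifting M (a i) (b i) (X i) (Y i)) \<and>
          prob_space.indep_vars M (\<lambda>i. enum_space (a i) (b i)) Y I)"

text \<open>
  \<open>AE\<close> rather than a vanishing \<open>measure\<close>, since the latter is also 0 on nonmeasurable sets.
\<close>

definition misses_points :: "'a measure \<Rightarrow> ('a \<Rightarrow> real set) \<Rightarrow> bool" where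
  "misses_points M X \<longleftrightarrow> (\<forall>t\<in>{0<..<1}. AE \<omega> in M. t \<notin> X \<omega>)"

definition independence_condition :: "'a measure \<Rightarrow> ('a \<Rightarrow> real set) \<Rightarrow> bool" where
  "independence_condition M X \<longleftrightarrow>
     misses_points M X \<and>
     (\<forall>n\<ge>1. \<forall>t :: nat \<Rightarrow> real. t 0 = 0 \<and> t n = 1 \<and> (\<forall>k\<in>{1..n}. t (k - 1) < t k) \<longrightarrow>
        independent_dcs M {1..n} (\<lambda>k. t (k - 1)) t (\<lambda>k \<omega>. X \<omega> \<inter> {t (k - 1)<..<t k}))"

text \<open>The cyclic shift is undefined at \<open>1 - s\<close>, so this point is dropped before taking images.\<close>

definition cyclic_shift :: "real \<Rightarrow> real \<Rightarrow> real" where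
  "cyclic_shift s t = (if t < 1 - s then t + s else t + s - 1)"

definition shift_set :: "real \<Rightarrow> real set \<Rightarrow> real set" where
  "shift_set s A = cyclic_shift s ` (A - {1 - s})"

text \<open>
  Products of probability spaces are completed, as usual for Lebesgue--Rokhlin spaces.
\<close>

definition stationary :: "'a measure \<Rightarrow> ('a \<Rightarrow> real set) \<Rightarrow> bool" where
  "stationary M X \<longleftrightarrow>
     misses_points M X \<and>
     identically_distributed M X
       (completion (M \<Otimes>\<^sub>M lebesgue_on {0<..<1::real})) (\<lambda>(\<omega>, s). shift_set s (X \<omega>))"

end

theory Submission
  imports Defs
begin

text \<open>
  Why the theorem holds. A random dense countable set is accessible only through its measurable
  enumerations. If both sets have enumerations, possibly depending on extra independent randomness,
  with one and the same law on sequences, then the two probability spaces can be joined along that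
  common sequence, and under the joining both sets are the range of the same sequence, hence equal.
  So everything rests on producing two randomised enumerations with equal laws.

  Stationarity reduces statements about a random set and a fixed Borel set to statements about a
  fixed dense countable set and a random shift. It gives that a null set is almost surely missed
  and, by a Steinhaus argument, that a set of positive measure is almost surely hit
  (\<open>stationary_avoids_null\<close>, \<open>stationary_hits_positive\<close>). Independence
  upgrades this to sets that depend on finitely many points of the random set itself: freeze these
  points and look at a small window away from them, on which the random set is independent of them.
  The outcome is that every measurable enumeration is \<open>generic\<close>: given finitely many of
  its points, a further point has an absolutely continuous law, and every non-null set contains a
  further point (\<open>generic_enumeration\<close>).

  For generic enumerations a back and forth argument works. Suppose that \<open>n\<close> points have been chosen
  on either side, with equal laws. One side reveals the point with the least unused index; its
  conditional law given the earlier choices has a density. The other side has to choose, at random,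
  one of its own points with exactly this conditional law. This is possible by going greedily
  through its points and accepting each one with the largest probability that does not exceed what
  remains of the target density (\<open>greedy_selection\<close>): if some mass were never accepted, then part of the
  density would be left over on a set of positive measure, and that set would contain a point of the
  enumeration, at which the leftover would have been used. Since the two sides take turns in
  revealing, both sets are exhausted in the limit (\<open>common_law\<close>).

  The final gluing needs the conditional law of a point of the second space given the common
  sequence. As that space is Lebesgue--Rokhlin, its points are encoded by a real number, and a
  conditional quantile function of this number, fed with an independent uniform variable, serves
  as the conditional law (\<open>noise_outsourcing\<close>, \<open>glue_along_sequences\<close>).
\<close>

section \<open>A dense set meets a set of positive measure after almost every shift\<close>

lemma translation_lborel:
  fixes K :: "real set"
  assumes [measurable]: "K \<in> sets borel"
  shows "(+) h ` K \<in> sets borel" "emeasure lborel ((+) h ` K) = emeasure lborel K"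
proof -
  have im: "(+) h ` K = (\<lambda>x. - h + x) -` K \<inter> space borel" by (force simp: image_iff)
  show m: "(+) h ` K \<in> sets borel" unfolding im by measurable
  have "emeasure lborel ((+) h ` K) = emeasure (distr lborel borel ((+) h)) ((+) h ` K)"
    by (simp add: lborel_distr_plus)
  also have "\<dots> = emeasure lborel ((+) h -` ((+) h ` K) \<inter> space lborel)"
    by (rule emeasure_distr) (use m in auto)
  also have "(+) h -` ((+) h ` K) \<inter> space lborel = K" by auto
  finally show "emeasure lborel ((+) h ` K) = emeasure lborel K" .
qed

text \<open>
  A compact \<open>K \<subseteq> C\<close> lies in an open \<open>U\<close> whose measure is less than twice that of \<open>K\<close>. A small
  translate of \<open>K\<close> still lies in \<open>U\<close>, where it has no room to be disjoint from \<open>K\<close>.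
\<close>

lemma steinhaus:
  fixes C :: "real set"
  assumes C: "C \<in> sets borel" and pos: "0 < emeasure lborel C"
  shows "\<exists>\<delta>>0. \<forall>h. \<bar>h\<bar> < \<delta> \<longrightarrow> (\<exists>s\<in>C. s + h \<in> C)"
proof -
  obtain K where K: "compact K" "K \<subseteq> C" "0 < emeasure lborel K"
  proof -
    obtain n :: nat where n: "emeasure lborel (C \<inter> cball 0 n) \<noteq> 0"
    proof (rule ccontr)
      assume no: "\<not> thesis"
      then have z: "emeasure lborel (C \<inter> cball 0 (real n)) = 0" for n using that by blast
      have "emeasure lborel (\<Union>n::nat. C \<inter> cball 0 n) = 0"
        by (rule emeasure_UN_eq_0[OF z]) (use C in auto)
      moreover have "(\<Union>n::nat. C \<inter> cball 0 n) = C"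
      proof (intro equalityI subsetI)
        fix x assume "x \<in> C"
        moreover obtain m :: nat where "\<bar>x\<bar> \<le> m" using real_arch_simple by blast
        ultimately show "x \<in> (\<Union>n::nat. C \<inter> cball 0 n)" by (auto simp: dist_real_def)
      qed auto
      ultimately show False using pos by simp
    qed
    define C' where "C' = C \<inter> cball 0 n"
    have C'm: "C' \<in> sets borel" using C by (auto simp: C'_def)
    have fin: "emeasure lborel C' < \<infinity>"
      by (rule emeasure_bounded_finite) (auto simp: C'_def)
    define e where "e = measure lborel C'"
    have e: "emeasure lborel C' = ennreal e" "0 < e"
      using n fin unfolding e_def C'_def[symmetric] by (simp_all add: emeasure_eq_ennreal_measure zero_less_measure_iff)
    obtain T where T: "closed T" "T \<subseteq> C'" "emeasure lebesgue (C' - T) < ennreal e"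
    proof (rule sets_lebesgue_inner_closed[of C' e])
      show "C' \<in> sets lebesgue" using C'm by simp
    qed (use e in auto)
    have Tm: "T \<in> sets borel" using T(1) by simp
    have "emeasure lborel T \<noteq> 0"
    proof
      assume z: "emeasure lborel T = 0"
      have "emeasure lborel C' \<le> emeasure lborel (C' - T) + emeasure lborel T"
        using emeasure_subadditive[of "C' - T" lborel T] T(2) C'm Tm by (simp add: Un_absorb2)
      also have "\<dots> = emeasure lebesgue (C' - T)" unfolding z add_0_right using C'm Tm by simp
      also have "\<dots> < emeasure lborel C'" unfolding e by (rule T(3))
      finally show False by simp
    qed
    moreover have "compact T"
      using T(1,2) bounded_subset[of "cball 0 (real n)" T] by (auto simp: compact_eq_bounded_closed C'_def)
    ultimately show ?thesis using that[of T] T(2) by (auto simp: C'_def zero_less_iff_neq_zero)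
  qed
  have Km: "K \<in> sets borel" using K(1) by (simp add: compact_imp_closed borel_closed)
  have Kfin: "emeasure lborel K < \<infinity>" by (rule emeasure_compact_finite) (rule K(1))
  define c where "c = measure lborel K"
  have c: "emeasure lborel K = ennreal c" "0 < c"
    using K(3) Kfin unfolding c_def by (simp_all add: emeasure_eq_ennreal_measure zero_less_measure_iff)
  obtain U where U: "open U" "K \<subseteq> U" "emeasure lborel (U - K) < ennreal c"
    using outer_regular_lborel[OF Km c(2)] by blast
  obtain \<delta> where \<delta>: "\<delta> > 0" "(\<Union>x\<in>K. ball x \<delta>) \<subseteq> U"
    using compact_subset_open_imp_ball_epsilon_subset[OF K(1) U(1,2)] by blast
  have "\<exists>s\<in>C. s + h \<in> C" if h: "\<bar>h\<bar> < \<delta>" for h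
  proof (rule ccontr)
    assume *: "\<not> (\<exists>s\<in>C. s + h \<in> C)"
    have disj: "(+) h ` K \<inter> K = {}" using * K(2) by (auto simp: add.commute)
    moreover have "(+) h ` K \<subseteq> U" using \<delta>(2) h by (force simp: dist_real_def)
    ultimately have "(+) h ` K \<subseteq> U - K" by auto
    then have "emeasure lborel ((+) h ` K) \<le> emeasure lborel (U - K)"
      by (rule emeasure_mono) (use U(1) Km in auto)
    then show False using U(3) c translation_lborel(2)[OF Km, of h] by simp
  qed
  then show ?thesis using \<delta>(1) by blast
qed

text \<open>
  Let \<open>B\<close> be the set of bad shifts and suppose it is not null. By Fubini some point \<open>t0\<close>, not
  necessarily in \<open>D\<close>, is moved into \<open>A\<close> by a non-null set \<open>C\<close> of bad shifts, and \<open>C\<close> can be taken on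
  one side of the jump of the cyclic shift. If \<open>d \<in> D\<close> is close to \<open>t0\<close>, then by Steinhaus
  some \<open>s \<in> C\<close> has \<open>s + (d - t0) \<in> C\<close>, and shifting \<open>d\<close> by the bad \<open>s\<close> is the same as shifting \<open>t0\<close>
  by \<open>s + (d - t0)\<close>, so it ends in \<open>A\<close>.
\<close>

lemma dense_set_shift_hits:
  assumes D: "D \<in> DCS 0 1" and A[measurable]: "A \<in> sets borel" and pos: "0 < emeasure lborel (A \<inter> {0<..<1})"
  shows "AE s in lborel. s \<in> {0<..<1} \<longrightarrow> (\<exists>d\<in>D. d \<noteq> 1 - s \<and> cyclic_shift s d \<in> A)"
proof (rule ccontr)
  assume nAE: "\<not> ?thesis"
  have Dc: "countable D" and D01: "D \<subseteq> {0<..<1}" and Dd: "{0<..<1} \<subseteq> closure D" using D by (auto simp: DCS_def)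
  define B where "B = {s\<in>{0<..<1}. \<forall>d\<in>D. d \<noteq> 1 - s \<longrightarrow> cyclic_shift s d \<notin> A}"
  have Bm[measurable]: "B \<in> sets borel"
  proof -
    have "B = {0<..<1} - (\<Union>d\<in>D. {s. d \<noteq> 1 - s \<and> cyclic_shift s d \<in> A})" by (auto simp: B_def)
    moreover have "{s. d \<noteq> 1 - s \<and> cyclic_shift s d \<in> A} \<in> sets borel" for d
    proof -
      have [measurable]: "(\<lambda>s. cyclic_shift s d) \<in> borel_measurable borel" unfolding cyclic_shift_def by measurable
      have "{s \<in> space borel. d \<noteq> 1 - s \<and> cyclic_shift s d \<in> A} \<in> sets borel" by measurable
      then show ?thesis by simp
    qed
    ultimately show ?thesis using Dc by (auto intro!: sets.Diff sets.countable_UN')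
  qed
  have Bpos: "0 < emeasure lborel B"
  proof (rule ccontr)
    assume "\<not> 0 < emeasure lborel B"
    then have "B \<in> null_sets lborel" by (auto intro!: null_setsI)
    then have "AE s in lborel. s \<notin> B" by (rule AE_not_in)
    then have "AE s in lborel. s \<in> {0<..<1} \<longrightarrow> (\<exists>d\<in>D. d \<noteq> 1 - s \<and> cyclic_shift s d \<in> A)"
      by eventually_elim (auto simp: B_def)
    then show False using nAE by contradiction
  qed
  define G where "G = {z. fst z \<in> B \<and> snd z \<in> {0<..<1} \<and> snd z \<noteq> 1 - fst z \<and> cyclic_shift (fst z) (snd z) \<in> A}"
  have Gm[measurable]: "G \<in> sets (borel \<Otimes>\<^sub>M borel)"
  proof -
    have "G = {z\<in>space (borel \<Otimes>\<^sub>M borel). fst z \<in> B \<and> snd z \<in> {0<..<1} \<and> snd z \<noteq> 1 - fst z \<and> cyclic_shift (fst z) (snd z) \<in> A}"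
      by (auto simp: G_def space_pair_measure)
    also have "\<dots> \<in> sets (borel \<Otimes>\<^sub>M borel)" unfolding cyclic_shift_def by measurable
    finally show ?thesis .
  qed
  have G_sec: "0 < emeasure lborel (Pair s -` G)" if "s \<in> B" for s
  proof -
    have s: "0 < s" "s < 1" using that by (auto simp: B_def)
    let ?A1 = "A \<inter> {s<..<1}" and ?A2 = "A \<inter> {0<..<s}"
    have m: "Pair s -` G \<in> sets lborel" using sets_Pair1[OF Gm] by simp
    have sub1: "(\<lambda>x. - s + x) ` ?A1 \<subseteq> Pair s -` G" and sub2: "(\<lambda>x. (1 - s) + x) ` ?A2 \<subseteq> Pair s -` G"
      using s that by (auto simp: G_def cyclic_shift_def)
    have "emeasure lborel ?A1 \<noteq> 0 \<or> emeasure lborel ?A2 \<noteq> 0"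
    proof (rule ccontr)
      assume "\<not> ?thesis"
      then have "emeasure lborel ((?A1 \<union> ?A2) \<union> {s}) \<le> 0"
        using emeasure_subadditive[of "?A1 \<union> ?A2" lborel "{s}"] emeasure_subadditive[of ?A1 lborel ?A2] by simp
      moreover have "emeasure lborel (A \<inter> {0<..<1}) \<le> emeasure lborel ((?A1 \<union> ?A2) \<union> {s})"
        by (rule emeasure_mono) auto
      ultimately show False using pos by simp
    qed
    then show ?thesis
    proof
      assume "emeasure lborel ?A1 \<noteq> 0"
      then have "0 < emeasure lborel ((+) (- s) ` ?A1)" by (subst translation_lborel) (auto simp: zero_less_iff_neq_zero)
      also have "\<dots> \<le> emeasure lborel (Pair s -` G)" by (rule emeasure_mono[OF sub1 m])
      finally show ?thesis .
    next
      assume "emeasure lborel ?A2 \<noteq> 0"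
      then have "0 < emeasure lborel ((+) (1 - s) ` ?A2)" by (subst translation_lborel) (auto simp: zero_less_iff_neq_zero)
      also have "\<dots> \<le> emeasure lborel (Pair s -` G)" by (rule emeasure_mono[OF sub2 m])
      finally show ?thesis .
    qed
  qed
  have P: "pair_sigma_finite (lborel :: real measure) (lborel :: real measure)" ..
  have GL: "G \<in> sets (lborel \<Otimes>\<^sub>M lborel)"
    using Gm by (simp cong: sets_pair_measure_cong)
  obtain t0 where t0: "0 < emeasure lborel ((\<lambda>s. (s, t0)) -` G)"
  proof (rule ccontr)
    assume "\<not> thesis"
    then have z: "emeasure lborel ((\<lambda>s. (s, t)) -` G) = 0" for t using that by (auto simp: zero_less_iff_neq_zero)
    have "(\<integral>\<^sup>+t. emeasure lborel ((\<lambda>s. (s, t)) -` G) \<partial>lborel) = (\<integral>\<^sup>+s. emeasure lborel (Pair s -` G) \<partial>lborel)"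
      using pair_sigma_finite.emeasure_pair_measure_alt2[OF P GL] lborel.emeasure_pair_measure_alt[OF GL] by simp
    then have "(\<integral>\<^sup>+s. emeasure lborel (Pair s -` G) \<partial>lborel) = 0" by (simp add: z)
    then have "AE s in lborel. emeasure lborel (Pair s -` G) = 0"
      by (subst (asm) nn_integral_0_iff_AE) (use lborel.measurable_emeasure_Pair[OF GL] in auto)
    then have "AE s in lborel. s \<notin> B" by eventually_elim (use G_sec in fastforce)
    then have "emeasure lborel B = 0" by (subst (asm) AE_iff_measurable[of B]) auto
    then show False using Bpos by simp
  qed
  let ?S = "(\<lambda>s. (s, t0)) -` G"
  have Sm: "?S \<in> sets lborel" using sets_Pair2[OF Gm] by simp
  have "\<exists>C\<in>sets borel. 0 < emeasure lborel C \<and> C \<subseteq> ?S \<and> (C \<subseteq> {s. t0 < 1 - s} \<or> C \<subseteq> {s. t0 > 1 - s})"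
  proof (rule ccontr)
    assume no: "\<not> ?thesis"
    have "emeasure lborel (?S \<inter> {..<1-t0}) = 0" "emeasure lborel (?S \<inter> {1-t0<..}) = 0"
      using no Sm by (auto simp: zero_less_iff_neq_zero)
    moreover have "?S = (?S \<inter> {..<1-t0}) \<union> (?S \<inter> {1-t0<..})" by (auto simp: G_def)
    ultimately have "emeasure lborel ?S \<le> 0 + 0"
      using emeasure_subadditive[of "?S \<inter> {..<1-t0}" lborel "?S \<inter> {1-t0<..}"] Sm by auto
    then show False using t0 by simp
  qed
  then obtain C where C: "C \<in> sets borel" "0 < emeasure lborel C" "C \<subseteq> ?S"
    and side: "C \<subseteq> {s. t0 < 1 - s} \<or> C \<subseteq> {s. t0 > 1 - s}" by blast
  obtain \<delta> where \<delta>: "\<delta> > 0" "\<And>h. \<bar>h\<bar> < \<delta> \<Longrightarrow> \<exists>s\<in>C. s + h \<in> C" using steinhaus[OF C(1,2)] by blast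
  have "C \<noteq> {}" using C(2) by auto
  then have "t0 \<in> {0<..<1}" using C(3) by (auto simp: G_def)
  then have "t0 \<in> closure D" using Dd by blast
  then obtain d where d: "d \<in> D" "\<bar>d - t0\<bar> < \<delta>"
    using \<delta>(1) unfolding closure_approachable by (auto simp: dist_real_def)
  obtain s where s: "s \<in> C" "s + (d - t0) \<in> C" using \<delta>(2)[OF d(2)] by blast
  have "s \<in> B" using s(1) C(3) by (auto simp: G_def)
  moreover have "d \<noteq> 1 - s \<and> cyclic_shift s d = cyclic_shift (s + (d - t0)) t0"
    using side s by (auto simp: cyclic_shift_def)
  moreover have "cyclic_shift (s + (d - t0)) t0 \<in> A" using s(2) C(3) by (auto simp: G_def)
  ultimately show False using d(1) by (auto simp: B_def)
qed

section \<open>Consequences of stationarity\<close>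

abbreviation seqs :: "(nat \<Rightarrow> real) measure" where
  "seqs \<equiv> \<Pi>\<^sub>M i\<in>UNIV. borel"

abbreviation unif01 :: "real measure" where
  "unif01 \<equiv> uniform_measure lborel {0<..<1}"

lemma prob_space_unif01: "prob_space unif01"
  by (rule prob_space_uniform_measure) auto

lemma emeasure_unif01: "A \<in> sets borel \<Longrightarrow> emeasure unif01 A = emeasure lborel (A \<inter> {0<..<1})"
  by (subst emeasure_uniform_measure) (auto simp: Int_commute divide_ennreal_def)

lemma AE_unif01: "AE u in unif01. 0 < u \<and> u < 1"
  by (rule AE_uniform_measureI) auto

lemma AE_pair_unif01:
  assumes M: "prob_space M"
  shows "AE z in M \<Otimes>\<^sub>M unif01. 0 < snd z \<and> snd z < 1"
proof (rule pair_sigma_finite.AE_pair_measure)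
  show "pair_sigma_finite M unif01"
    by (intro pair_sigma_finite.intro prob_space_imp_sigma_finite M prob_space_unif01)
  have [measurable]: "(\<lambda>z. snd z) \<in> borel_measurable (M \<Otimes>\<^sub>M unif01)"
    by (rule measurable_compose[OF measurable_snd measurable_ident_sets]) simp
  show "{z \<in> space (M \<Otimes>\<^sub>M unif01). 0 < snd z \<and> snd z < 1} \<in> sets (M \<Otimes>\<^sub>M unif01)" by measurable
  show "AE w in M. AE u in unif01. 0 < snd (w, u) \<and> snd (w, u) < 1" using AE_unif01 by simp
qed

lemma enum_space_to_seqs[measurable]: "(\<lambda>y. y) \<in> enum_space a b \<rightarrow>\<^sub>M seqs"
  unfolding enum_space_def by (rule measurable_restrict_space1) measurable

lemma measurable_liftingD:
  assumes "measurable_lifting M a b X Y"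
  shows "Y \<in> M \<rightarrow>\<^sub>M seqs" "AE \<omega> in M. X \<omega> = range (Y \<omega>)"
    "\<omega> \<in> space M \<Longrightarrow> inj (Y \<omega>)" "\<omega> \<in> space M \<Longrightarrow> range (Y \<omega>) \<subseteq> {a<..<b}"
proof -
  have Y: "Y \<in> M \<rightarrow>\<^sub>M enum_space a b" using assms by (simp add: measurable_lifting_def)
  show "Y \<in> M \<rightarrow>\<^sub>M seqs" using measurable_compose[OF Y enum_space_to_seqs] by simp
  show "AE \<omega> in M. X \<omega> = range (Y \<omega>)" using assms by (simp add: measurable_lifting_def)
  show "inj (Y \<omega>)" "range (Y \<omega>) \<subseteq> {a<..<b}" if "\<omega> \<in> space M"
    using measurable_space[OF Y that] by (auto simp: enum_space_def space_restrict_space)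
qed

lemma AE_shift_notin_null:
  assumes N: "N \<in> null_sets (lborel :: real measure)"
  shows "AE s in lborel. cyclic_shift s d \<notin> N"
proof -
  have Nm: "N \<in> sets borel" using N by auto
  have tr: "AE s in lborel. s + c \<notin> N" for c
  proof -
    have "emeasure lborel ((+) (- c) ` N) = 0" unfolding translation_lborel(2)[OF Nm] using N by blast
    then have "(+) (- c) ` N \<in> null_sets lborel"
      by (rule null_setsI) (unfold sets_lborel, rule translation_lborel(1)[OF Nm])
    then have "AE s in lborel. s \<notin> (+) (- c) ` N" by (rule AE_not_in)
    then show ?thesis
    proof eventually_elim
      case (elim s)
      have "s = - c + (s + c)" by simp
      then show ?case using elim by blast
    qed
  qed
  show ?thesis using tr[of d] tr[of "d - 1"]
    by eventually_elim (auto simp: cyclic_shift_def algebra_simps)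
qed

text \<open>
  The joining in the definition of stationarity identifies \<open>X\<close> with a randomly shifted copy, for
  which the statement follows from Fubini. Hitting \<open>A\<close> is a measurable event only in terms of an
  enumeration, which is why the proof goes back and forth between \<open>X\<close> and the range of a lifting.
\<close>

lemma stationary_hits_iff:
  assumes M: "prob_space M" and X: "random_dcs M 0 1 X" and st: "stationary M X"
    and A[measurable]: "A \<in> sets borel"
    and shift: "\<And>D. D \<in> DCS 0 1 \<Longrightarrow> AE s in lborel. s \<in> {0<..<1} \<longrightarrow> (shift_set s D \<inter> A \<noteq> {} \<longleftrightarrow> b)"
  shows "AE \<omega> in M. X \<omega> \<inter> A \<noteq> {} \<longleftrightarrow> b"
proof -
  interpret M: prob_space M by fact
  define L where "L = lebesgue_on {0<..<1::real}"
  have L: "prob_space L"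
    by (rule prob_spaceI) (simp add: L_def emeasure_restrict_space)
  interpret L: prob_space L by (rule L)
  obtain Y where Y: "measurable_lifting M 0 1 X Y" using X by (auto simp: random_dcs_def)
  note [measurable] = measurable_liftingD(1)[OF Y]
  have Xdcs: "X \<omega> \<in> DCS 0 1" if "\<omega> \<in> space M" for \<omega> using X that by (auto simp: random_dcs_def)
  obtain J where J: "joining M (completion (M \<Otimes>\<^sub>M L)) J"
    and JX: "AE p in J. X (fst p) = (\<lambda>(\<omega>, s). shift_set s (X \<omega>)) (snd p)"
    using st by (auto simp: stationary_def identically_distributed_def L_def)
  have sJ[measurable_cong]: "sets J = sets (M \<Otimes>\<^sub>M completion (M \<Otimes>\<^sub>M L))"
    and J1: "distr J M fst = M" and J2: "distr J (completion (M \<Otimes>\<^sub>M L)) snd = completion (M \<Otimes>\<^sub>M L)"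
    using J by (auto simp: joining_def)
  have fstJ: "fst \<in> J \<rightarrow>\<^sub>M M" and sndJ: "snd \<in> J \<rightarrow>\<^sub>M completion (M \<Otimes>\<^sub>M L)"
    unfolding measurable_cong_sets[OF sJ refl] by simp_all
  have Lb[measurable]: "(\<lambda>s. s) \<in> L \<rightarrow>\<^sub>M borel"
    unfolding L_def by (rule measurable_restrict_space1) (simp add: measurable_completion)
  have [measurable]: "(\<lambda>z. snd z) \<in> borel_measurable (M \<Otimes>\<^sub>M L)" by (rule measurable_compose[OF measurable_snd Lb])
  have "AE z in M \<Otimes>\<^sub>M L. (\<exists>i. Y (fst z) i \<noteq> 1 - snd z \<and> cyclic_shift (snd z) (Y (fst z) i) \<in> A) \<longleftrightarrow> b"
  proof (rule pair_sigma_finite.AE_pair_measure)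
    show "pair_sigma_finite M L" by unfold_locales
    show "{z \<in> space (M \<Otimes>\<^sub>M L). (\<exists>i. Y (fst z) i \<noteq> 1 - snd z \<and> cyclic_shift (snd z) (Y (fst z) i) \<in> A) \<longleftrightarrow> b} \<in> sets (M \<Otimes>\<^sub>M L)"
      unfolding cyclic_shift_def by measurable
    show "AE \<omega> in M. AE s in L. (\<exists>i. Y (fst (\<omega>, s)) i \<noteq> 1 - snd (\<omega>, s) \<and> cyclic_shift (snd (\<omega>, s)) (Y (fst (\<omega>, s)) i) \<in> A) \<longleftrightarrow> b"
      using measurable_liftingD(2)[OF Y] AE_space
    proof eventually_elim
      case (elim \<omega>)
      have "AE s in lebesgue. s \<in> {0<..<1} \<longrightarrow> (shift_set s (X \<omega>) \<inter> A \<noteq> {} \<longleftrightarrow> b)"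
        by (rule AE_completion[OF shift[OF Xdcs[OF elim(2)]]])
      then have "AE s in L. shift_set s (X \<omega>) \<inter> A \<noteq> {} \<longleftrightarrow> b"
        unfolding L_def by (subst AE_restrict_space_iff) auto
      then show ?case
        by eventually_elim (auto simp: shift_set_def elim(1))
    qed
  qed
  then have "AE z in completion (M \<Otimes>\<^sub>M L). (\<exists>i. Y (fst z) i \<noteq> 1 - snd z \<and> cyclic_shift (snd z) (Y (fst z) i) \<in> A) \<longleftrightarrow> b"
    by (rule AE_completion)
  then have 1: "AE p in J. (\<exists>i. Y (fst (snd p)) i \<noteq> 1 - snd (snd p) \<and> cyclic_shift (snd (snd p)) (Y (fst (snd p)) i) \<in> A) \<longleftrightarrow> b"
    by (intro AE_distrD[OF sndJ]) (simp only: J2)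
  have "AE z in M \<Otimes>\<^sub>M L. X (fst z) = range (Y (fst z))"
    by (rule AE_distrD[OF measurable_fst]) (unfold L.distr_pair_fst, rule measurable_liftingD(2)[OF Y])
  then have "AE z in completion (M \<Otimes>\<^sub>M L). X (fst z) = range (Y (fst z))" by (rule AE_completion)
  then have 2: "AE p in J. X (fst (snd p)) = range (Y (fst (snd p)))"
    by (intro AE_distrD[OF sndJ]) (simp only: J2)
  have 3: "AE p in J. X (fst p) = range (Y (fst p))"
    by (rule AE_distrD[OF fstJ]) (use measurable_liftingD(2)[OF Y] in \<open>simp only: J1\<close>)
  have "AE p in J. (\<exists>i. Y (fst p) i \<in> A) \<longleftrightarrow> b"
    using 1 2 3 JX
  proof eventually_elim
    case (elim p)
    have "(\<exists>i. Y (fst p) i \<in> A) \<longleftrightarrow> shift_set (snd (snd p)) (range (Y (fst (snd p)))) \<inter> A \<noteq> {}"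
    proof -
      have "shift_set (snd (snd p)) (range (Y (fst (snd p)))) = range (Y (fst p))"
        using elim(2-4) by (simp add: case_prod_beta)
      then show ?thesis by (simp only:) auto
    qed
    also have "\<dots> \<longleftrightarrow> b" using elim(1) by (auto simp: shift_set_def)
    finally show ?case .
  qed
  then have "AE \<omega> in distr J M fst. (\<exists>i. Y \<omega> i \<in> A) \<longleftrightarrow> b"
    by (subst AE_distr_iff[OF fstJ]) simp_all
  then have "AE \<omega> in M. (\<exists>i. Y \<omega> i \<in> A) \<longleftrightarrow> b" by (simp only: J1)
  then show ?thesis using measurable_liftingD(2)[OF Y] by eventually_elim auto
qed

lemma stationary_avoids_null:
  assumes "prob_space M" "random_dcs M 0 1 X" "stationary M X" and N: "N \<in> null_sets lborel"
  shows "AE \<omega> in M. X \<omega> \<inter> N = {}"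
proof -
  have "AE \<omega> in M. X \<omega> \<inter> N \<noteq> {} \<longleftrightarrow> False"
  proof (rule stationary_hits_iff[OF assms(1-3)])
    show "N \<in> sets borel" using N by auto
    fix D assume "D \<in> DCS 0 1"
    then have "countable D" by (simp add: DCS_def)
    then have "AE s in lborel. \<forall>d\<in>D. cyclic_shift s d \<notin> N"
      using AE_shift_notin_null[OF N] by (simp add: AE_ball_countable)
    then show "AE s in lborel. s \<in> {0<..<1} \<longrightarrow> (shift_set s D \<inter> N \<noteq> {} \<longleftrightarrow> False)"
      by eventually_elim (auto simp: shift_set_def)
  qed
  then show ?thesis by simp
qed

lemma stationary_hits_positive:
  assumes "prob_space M" "random_dcs M 0 1 X" "stationary M X"
    and A: "A \<in> sets borel" "0 < emeasure lborel (A \<inter> {0<..<1})"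
  shows "AE \<omega> in M. X \<omega> \<inter> A \<noteq> {}"
proof -
  have "AE \<omega> in M. X \<omega> \<inter> A \<noteq> {} \<longleftrightarrow> True"
  proof (rule stationary_hits_iff[OF assms(1-3) A(1)])
    fix D :: "real set" assume "D \<in> DCS 0 1"
    from dense_set_shift_hits[OF this A]
    show "AE s in lborel. s \<in> {0<..<1} \<longrightarrow> (shift_set s D \<inter> A \<noteq> {} \<longleftrightarrow> True)"
      by eventually_elim (auto simp: shift_set_def)
  qed
  then show ?thesis by simp
qed

section \<open>Fresh points of an enumeration are absolutely continuous and unavoidable\<close>

text \<open>
  Finite vectors of points are padded with zeros, so that vectors of all lengths live in one
  measurable space and appending a point is a function update.
\<close>

definition prefix_seq :: "(nat \<Rightarrow> real) \<Rightarrow> nat list \<Rightarrow> nat \<Rightarrow> real" where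
  "prefix_seq y ks = (\<lambda>i. if i < length ks then y (ks ! i) else 0)"

lemma measurable_prefix_seq[measurable]: "(\<lambda>y. prefix_seq y ks) \<in> seqs \<rightarrow>\<^sub>M seqs"
  unfolding prefix_seq_def[abs_def] by (rule measurable_PiM_single') auto

text \<open>
  What the coupling uses about an enumeration. A measurable set \<open>D\<close> stands for the family of its
  sections, subsets of the interval that depend on the points with indices in \<open>ks\<close>. A null section
  contains no further point; a non-null section contains one.
\<close>

definition generic :: "'a measure \<Rightarrow> ('a \<Rightarrow> nat \<Rightarrow> real) \<Rightarrow> bool" where
  "generic M Y \<longleftrightarrow> Y \<in> M \<rightarrow>\<^sub>M seqs \<and>
     (\<forall>D\<in>sets (seqs \<Otimes>\<^sub>M borel). \<forall>ks.
       (\<forall>k. k \<notin> set ks \<longrightarrow> (AE \<omega> in M. emeasure unif01 (Pair (prefix_seq (Y \<omega>) ks) -` D) = 0 \<longrightarrow> (prefix_seq (Y \<omega>) ks, Y \<omega> k) \<notin> D)) \<and>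
       (AE \<omega> in M. 0 < emeasure unif01 (Pair (prefix_seq (Y \<omega>) ks) -` D) \<longrightarrow> (\<exists>k. k \<notin> set ks \<and> (prefix_seq (Y \<omega>) ks, Y \<omega> k) \<in> D)))"

text \<open>
  The points outside a window belong to two enumerations, one on either side of it; a pair in the
  list names the side and the index.
\<close>

definition pick_outside :: "(bool \<times> nat) list \<Rightarrow> (nat \<Rightarrow> real) \<Rightarrow> (nat \<Rightarrow> real) \<Rightarrow> nat \<Rightarrow> real" where
  "pick_outside c x z = (\<lambda>i. if i < length c then (if fst (c ! i) then x (snd (c ! i)) else z (snd (c ! i))) else 0)"

lemma measurable_pick_outside: "(\<lambda>w. pick_outside c (fst w) (snd w)) \<in> seqs \<Otimes>\<^sub>M seqs \<rightarrow>\<^sub>M seqs"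
  unfolding pick_outside_def[abs_def] by (rule measurable_PiM_single') auto

text \<open>
  Cutting at \<open>a\<close> and \<open>b\<close> makes the enumeration \<open>V2\<close> inside the window independent of the ones outside.
  Hence finitely many outside points may be treated as constants when an exceptional event is
  shown to be null.
\<close>

lemma independence_separates:
  assumes M: "prob_space M" and ind: "independence_condition M X" and ab: "0 < a" "a < b" "b < 1"
  shows "\<exists>V1 V2 V3. V1 \<in> M \<rightarrow>\<^sub>M seqs \<and> V2 \<in> M \<rightarrow>\<^sub>M seqs \<and> V3 \<in> M \<rightarrow>\<^sub>M seqs \<and>
    (AE \<omega> in M. X \<omega> \<inter> {0<..<a} = range (V1 \<omega>)) \<and>
    (AE \<omega> in M. X \<omega> \<inter> {a<..<b} = range (V2 \<omega>)) \<and>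
    (AE \<omega> in M. X \<omega> \<inter> {b<..<1} = range (V3 \<omega>)) \<and>
    (\<forall>E\<in>sets (seqs \<Otimes>\<^sub>M seqs). \<forall>c. (\<forall>v. AE \<omega> in M. (v, V2 \<omega>) \<notin> E) \<longrightarrow>
       (AE \<omega> in M. (pick_outside c (V1 \<omega>) (V3 \<omega>), V2 \<omega>) \<notin> E))"
proof -
  interpret prob_space M by fact
  define t :: "nat \<Rightarrow> real" where "t k = (if k = 0 then 0 else if k = 1 then a else if k = 2 then b else 1)" for k
  have "\<forall>k\<in>{1..3}. t (k - 1) < t k" using ab by (auto simp: t_def)
  moreover have "t 0 = 0 \<and> t 3 = 1" by (simp add: t_def)
  moreover have "(1::nat) \<le> 3" by simp
  ultimately have "independent_dcs M {1..3} (\<lambda>k. t (k - 1)) t (\<lambda>k \<omega>. X \<omega> \<inter> {t (k - 1)<..<t k})"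
    using ind unfolding independence_condition_def by blast
  then obtain Y where Y: "\<And>k. k \<in> {1..3} \<Longrightarrow> measurable_lifting M (t (k - 1)) (t k) (\<lambda>\<omega>. X \<omega> \<inter> {t (k - 1)<..<t k}) (Y k)"
    and iv: "indep_vars (\<lambda>i. enum_space (t (i - 1)) (t i)) Y {1..3}"
    unfolding independent_dcs_def by blast
  note Ym = measurable_liftingD(1)[OF Y]
  have iv': "indep_vars (\<lambda>_. seqs) Y {1..3}"
    using indep_vars_compose2[OF iv, of "\<lambda>_ y. y" "\<lambda>_. seqs"] enum_space_to_seqs by blast
  show ?thesis
  proof (rule exI[of _ "Y 1"], rule exI[of _ "Y 2"], rule exI[of _ "Y 3"], intro conjI ballI allI impI)
    show "Y 1 \<in> M \<rightarrow>\<^sub>M seqs" "Y 2 \<in> M \<rightarrow>\<^sub>M seqs" "Y 3 \<in> M \<rightarrow>\<^sub>M seqs" by (auto intro!: Ym)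
    show "AE \<omega> in M. X \<omega> \<inter> {0<..<a} = range (Y 1 \<omega>)"
      using measurable_liftingD(2)[OF Y[of 1]] by (simp add: t_def)
    show "AE \<omega> in M. X \<omega> \<inter> {a<..<b} = range (Y 2 \<omega>)"
      using measurable_liftingD(2)[OF Y[of 2]] by (simp add: t_def)
    show "AE \<omega> in M. X \<omega> \<inter> {b<..<1} = range (Y 3 \<omega>)"
      using measurable_liftingD(2)[OF Y[of 3]] by (simp add: t_def)
    fix E and c :: "(bool \<times> nat) list" assume E: "E \<in> sets (seqs \<Otimes>\<^sub>M seqs)" and AE: "\<forall>v. AE \<omega> in M. (v, Y 2 \<omega>) \<notin> E"
    have "indep_var (\<Pi>\<^sub>M i\<in>{1,3}. seqs) (\<lambda>\<omega>. restrict (\<lambda>i. Y i \<omega>) {1,3}) (\<Pi>\<^sub>M i\<in>{2}. seqs) (\<lambda>\<omega>. restrict (\<lambda>i. Y i \<omega>) {2})"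
      by (rule indep_var_restrict[OF iv']) auto
    then have "indep_var seqs ((\<lambda>g. pick_outside c (g 1) (g 3)) \<circ> (\<lambda>\<omega>. restrict (\<lambda>i. Y i \<omega>) {1,3})) seqs ((\<lambda>g. g 2) \<circ> (\<lambda>\<omega>. restrict (\<lambda>i. Y i \<omega>) {2}))"
    proof (rule indep_var_compose)
      have m: "(\<lambda>g. (g 1, g 3)) \<in> (\<Pi>\<^sub>M i\<in>{1,3::nat}. seqs) \<rightarrow>\<^sub>M seqs \<Otimes>\<^sub>M seqs"
        by (intro measurable_Pair measurable_component_singleton) auto
      show "(\<lambda>g. pick_outside c (g 1) (g 3)) \<in> (\<Pi>\<^sub>M i\<in>{1,3::nat}. seqs) \<rightarrow>\<^sub>M seqs"
        using measurable_compose[OF m measurable_pick_outside] by simp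
      show "(\<lambda>g. g 2) \<in> (\<Pi>\<^sub>M i\<in>{2::nat}. seqs) \<rightarrow>\<^sub>M seqs"
        by (rule measurable_component_singleton) simp
    qed
    then have iv2: "indep_var seqs (\<lambda>\<omega>. pick_outside c (Y 1 \<omega>) (Y 3 \<omega>)) seqs (Y 2)"
      by (simp add: comp_def)
    define A B where "A = distr M seqs (\<lambda>\<omega>. pick_outside c (Y 1 \<omega>) (Y 3 \<omega>))" and "B = distr M seqs (Y 2)"
    have rv: "(\<lambda>\<omega>. pick_outside c (Y 1 \<omega>) (Y 3 \<omega>)) \<in> M \<rightarrow>\<^sub>M seqs" "Y 2 \<in> M \<rightarrow>\<^sub>M seqs"
      and AB: "A \<Otimes>\<^sub>M B = distr M (seqs \<Otimes>\<^sub>M seqs) (\<lambda>\<omega>. (pick_outside c (Y 1 \<omega>) (Y 3 \<omega>), Y 2 \<omega>))"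
      using iv2 unfolding indep_var_distribution_eq A_def B_def by blast+
    interpret A: prob_space A unfolding A_def by (rule prob_space_distr) (rule rv)
    interpret B: prob_space B unfolding B_def by (rule prob_space_distr) (rule rv)
    have sAB: "sets (A \<Otimes>\<^sub>M B) = sets (seqs \<Otimes>\<^sub>M seqs)"
      by (rule sets_pair_measure_cong) (simp_all add: A_def B_def)
    have "AE z in A \<Otimes>\<^sub>M B. z \<notin> E"
    proof (rule pair_sigma_finite.AE_pair_measure)
      show "pair_sigma_finite A B" by unfold_locales
      have "{z \<in> space (A \<Otimes>\<^sub>M B). z \<notin> E} = space (A \<Otimes>\<^sub>M B) - E" by auto
      then show "{z \<in> space (A \<Otimes>\<^sub>M B). z \<notin> E} \<in> sets (A \<Otimes>\<^sub>M B)"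
        unfolding sAB[symmetric] by (simp only:) (rule sets.compl_sets, unfold sAB, rule E)
      have "AE y in B. (v, y) \<notin> E" for v
        unfolding B_def
      proof (subst AE_distr_iff[OF rv(2)])
        have "Pair v -` E \<in> sets seqs" by (rule sets_Pair1[OF E])
        moreover have "{y \<in> space seqs. (v, y) \<notin> E} = space seqs - Pair v -` E" by auto
        ultimately show "{y \<in> space seqs. (v, y) \<notin> E} \<in> sets seqs" by (simp add: sets.compl_sets)
      qed (rule AE[rule_format])
      then show "AE v in A. AE y in B. (v, y) \<notin> E" by simp
    qed
    then show "AE \<omega> in M. (pick_outside c (Y 1 \<omega>) (Y 3 \<omega>), Y 2 \<omega>) \<notin> E"
      unfolding AB by (rule AE_distrD[rotated]) (intro measurable_Pair rv)
  qed
qed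

text \<open>
  Inside a fixed window and relative to points outside of it, genericity follows from the
  statements on fixed null and non-null sets, the outside points being frozen. All lists of indices are
  covered at once: there are only countably many ways to pick outside points.
\<close>

lemma window_generic:
  assumes M: "prob_space M" and X: "random_dcs M 0 1 X" and st: "stationary M X" and ind: "independence_condition M X"
    and Y: "measurable_lifting M 0 1 X Y" and ab: "0 < a" "a < b" "b < 1"
    and D: "D \<in> sets (seqs \<Otimes>\<^sub>M borel)"
  shows "AE \<omega> in M. \<forall>ks. (\<forall>k\<in>set ks. Y \<omega> k \<notin> {a..b}) \<longrightarrow>
    (emeasure lborel (Pair (prefix_seq (Y \<omega>) ks) -` D \<inter> {0<..<1}) = 0 \<longrightarrow> (\<forall>k. Y \<omega> k \<in> {a<..<b} \<longrightarrow> (prefix_seq (Y \<omega>) ks, Y \<omega> k) \<notin> D)) \<and>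
    (0 < emeasure lborel (Pair (prefix_seq (Y \<omega>) ks) -` D \<inter> {a<..<b}) \<longrightarrow> (\<exists>k. Y \<omega> k \<in> {a<..<b} \<and> (prefix_seq (Y \<omega>) ks, Y \<omega> k) \<in> D))"
proof -
  obtain V1 V2 V3 where V: "V1 \<in> M \<rightarrow>\<^sub>M seqs" "V2 \<in> M \<rightarrow>\<^sub>M seqs" "V3 \<in> M \<rightarrow>\<^sub>M seqs"
    and V1: "AE \<omega> in M. X \<omega> \<inter> {0<..<a} = range (V1 \<omega>)"
    and V2: "AE \<omega> in M. X \<omega> \<inter> {a<..<b} = range (V2 \<omega>)"
    and V3: "AE \<omega> in M. X \<omega> \<inter> {b<..<1} = range (V3 \<omega>)"
    and sep': "\<forall>E\<in>sets (seqs \<Otimes>\<^sub>M seqs). \<forall>c. (\<forall>v. AE \<omega> in M. (v, V2 \<omega>) \<notin> E) \<longrightarrow>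
       (AE \<omega> in M. (pick_outside c (V1 \<omega>) (V3 \<omega>), V2 \<omega>) \<notin> E)"
    using independence_separates[OF M ind ab] by (elim exE conjE) (rule that)
  have sep: "AE \<omega> in M. (pick_outside c (V1 \<omega>) (V3 \<omega>), V2 \<omega>) \<notin> E"
    if "E \<in> sets (seqs \<Otimes>\<^sub>M seqs)" "\<And>v. AE \<omega> in M. (v, V2 \<omega>) \<notin> E" for E c
    by (rule sep'[THEN bspec, THEN spec, THEN mp, OF that(1)]) (rule allI, rule that(2))
  have sec: "Pair v -` D \<in> sets borel" for v by (rule sets_Pair1[OF D])
  have Dint: "D \<inter> space seqs \<times> I \<in> sets (seqs \<Otimes>\<^sub>M lborel)" if "I \<in> sets borel" for I
  proof -
    have "sets (seqs \<Otimes>\<^sub>M lborel) = sets (seqs \<Otimes>\<^sub>M (borel :: real measure))" by (rule sets_pair_measure_cong) simp_all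
    then show ?thesis using D that by (auto intro!: sets.Int pair_measureI)
  qed
  have m[measurable]: "(\<lambda>v. emeasure lborel (Pair v -` D \<inter> I)) \<in> borel_measurable seqs" if "I \<in> sets borel" for I
  proof -
    have "Pair v -` (D \<inter> space seqs \<times> I) = Pair v -` D \<inter> I" for v
      by (auto simp: space_PiM)
    then show ?thesis using lborel.measurable_emeasure_Pair[OF Dint[OF that]] by simp
  qed
  have m01[measurable]: "(\<lambda>v. emeasure lborel (Pair v -` D \<inter> {0<..<1})) \<in> borel_measurable seqs"
    and mab[measurable]: "(\<lambda>v. emeasure lborel (Pair v -` D \<inter> {a<..<b})) \<in> borel_measurable seqs" by (auto intro: m)
  note [measurable] = D
  \<comment> \<open>The two events are the failures of the two assertions.\<close>
  define E1 where "E1 = {z \<in> space (seqs \<Otimes>\<^sub>M seqs). emeasure lborel (Pair (fst z) -` D \<inter> {0<..<1}) = 0 \<and> (\<exists>k. (fst z, snd z k) \<in> D)}"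
  define E2 where "E2 = {z \<in> space (seqs \<Otimes>\<^sub>M seqs). 0 < emeasure lborel (Pair (fst z) -` D \<inter> {a<..<b}) \<and> (\<forall>k. (fst z, snd z k) \<notin> D)}"
  have E1: "E1 \<in> sets (seqs \<Otimes>\<^sub>M seqs)" unfolding E1_def by measurable
  have E2: "E2 \<in> sets (seqs \<Otimes>\<^sub>M seqs)" unfolding E2_def by measurable
  have "AE \<omega> in M. (pick_outside c (V1 \<omega>) (V3 \<omega>), V2 \<omega>) \<notin> E1" for c
  proof (rule sep[OF E1])
    fix v
    show "AE \<omega> in M. (v, V2 \<omega>) \<notin> E1"
    proof (cases "emeasure lborel (Pair v -` D \<inter> {0<..<1}) = 0")
      case True
      then have "Pair v -` D \<inter> {0<..<1} \<in> null_sets lborel" using sec by (auto intro: null_setsI)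
      from stationary_avoids_null[OF M X st this] V2
      show ?thesis
      proof eventually_elim
        case (elim \<omega>)
        have "V2 \<omega> k \<notin> Pair v -` D" for k
        proof -
          have "V2 \<omega> k \<in> X \<omega> \<inter> {a<..<b}" using elim(2) by blast
          moreover from this have "V2 \<omega> k \<in> {0<..<1}" using ab by simp
          ultimately show ?thesis using elim(1) by blast
        qed
        then show ?case by (auto simp: E1_def)
      qed
    qed (simp add: E1_def)
  qed
  then have A1: "AE \<omega> in M. \<forall>c. (pick_outside c (V1 \<omega>) (V3 \<omega>), V2 \<omega>) \<notin> E1" by (simp add: AE_all_countable)
  have "AE \<omega> in M. (pick_outside c (V1 \<omega>) (V3 \<omega>), V2 \<omega>) \<notin> E2" for c
  proof (rule sep[OF E2])
    fix v
    show "AE \<omega> in M. (v, V2 \<omega>) \<notin> E2"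
    proof (cases "0 < emeasure lborel (Pair v -` D \<inter> {a<..<b})")
      case True
      have "(Pair v -` D \<inter> {a<..<b}) \<inter> {0<..<1} = Pair v -` D \<inter> {a<..<b}" using ab by auto
      then have "AE \<omega> in M. X \<omega> \<inter> (Pair v -` D \<inter> {a<..<b}) \<noteq> {}"
        using True sec by (intro stationary_hits_positive[OF M X st]) auto
      with V2 show ?thesis
      proof eventually_elim
        case (elim \<omega>)
        from elim(2) obtain x where "x \<in> X \<omega> \<inter> (Pair v -` D \<inter> {a<..<b})"
          unfolding ex_in_conv[symmetric] ..
        then have x: "x \<in> X \<omega>" "x \<in> Pair v -` D" "x \<in> {a<..<b}" by simp_all
        have "x \<in> range (V2 \<omega>)" unfolding elim(1)[symmetric] using x by simp
        then obtain k where "x = V2 \<omega> k" by (rule rangeE)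
        then have "(v, V2 \<omega> k) \<in> D" using x(2) by simp
        then show ?case by (auto simp: E2_def)
      qed
    qed (simp add: E2_def)
  qed
  then have A2: "AE \<omega> in M. \<forall>c. (pick_outside c (V1 \<omega>) (V3 \<omega>), V2 \<omega>) \<notin> E2" by (simp add: AE_all_countable)
  show ?thesis
    using A1 A2 V1 V2 V3 measurable_liftingD(2)[OF Y] AE_space
  proof eventually_elim
    case (elim \<omega>)
    note r01 = measurable_liftingD(4)[OF Y elim(7)]
    show ?case
    proof (intro allI impI)
      fix ks assume out: "\<forall>k\<in>set ks. Y \<omega> k \<notin> {a..b}"
      let ?v = "prefix_seq (Y \<omega>) ks"
      have "\<forall>k\<in>set ks. \<exists>c. Y \<omega> k = (if fst c then V1 \<omega> (snd c) else V3 \<omega> (snd c))"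
      proof
        fix k assume that: "k \<in> set ks"
        have "Y \<omega> k \<in> {0<..<1}" using r01 by blast
        then have "Y \<omega> k \<in> X \<omega> \<inter> {0<..<a} \<or> Y \<omega> k \<in> X \<omega> \<inter> {b<..<1}"
          using out[rule_format, OF that] unfolding elim(6) by auto
        then consider i where "Y \<omega> k = V1 \<omega> i" | i where "Y \<omega> k = V3 \<omega> i" unfolding elim(3,5) by blast
        then show "\<exists>c. Y \<omega> k = (if fst c then V1 \<omega> (snd c) else V3 \<omega> (snd c))"
        proof cases
          case (1 i) then show ?thesis by (intro exI[of _ "(True, i)"]) simp
        next
          case (2 i) then show ?thesis by (intro exI[of _ "(False, i)"]) simp
        qed
      qed
      from bchoice[OF this]
      obtain f where f: "\<forall>k\<in>set ks. Y \<omega> k = (if fst (f k) then V1 \<omega> (snd (f k)) else V3 \<omega> (snd (f k)))" ..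
      have v: "?v = pick_outside (map f ks) (V1 \<omega>) (V3 \<omega>)"
        using f by (auto simp: prefix_seq_def pick_outside_def fun_eq_iff)
      have notE: "(?v, V2 \<omega>) \<notin> E1" "(?v, V2 \<omega>) \<notin> E2" unfolding v using elim(1,2) by blast+
      have sp: "(?v, V2 \<omega>) \<in> space (seqs \<Otimes>\<^sub>M seqs)" by (simp add: space_pair_measure space_PiM)
      have V2Y: "\<exists>i. V2 \<omega> i = Y \<omega> k" if "Y \<omega> k \<in> {a<..<b}" for k
      proof -
        have "Y \<omega> k \<in> X \<omega> \<inter> {a<..<b}" using that elim(6) by blast
        then show ?thesis unfolding elim(4) by auto
      qed
      have YV2: "\<exists>i. Y \<omega> i = V2 \<omega> k \<and> V2 \<omega> k \<in> {a<..<b}" for k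
      proof -
        have "V2 \<omega> k \<in> X \<omega> \<inter> {a<..<b}" unfolding elim(4) by blast
        then show ?thesis using elim(6) by auto
      qed
      show "(emeasure lborel (Pair ?v -` D \<inter> {0<..<1}) = 0 \<longrightarrow> (\<forall>k. Y \<omega> k \<in> {a<..<b} \<longrightarrow> (?v, Y \<omega> k) \<notin> D)) \<and>
        (0 < emeasure lborel (Pair ?v -` D \<inter> {a<..<b}) \<longrightarrow> (\<exists>k. Y \<omega> k \<in> {a<..<b} \<and> (?v, Y \<omega> k) \<in> D))"
      proof (intro conjI impI allI)
        fix k assume "emeasure lborel (Pair ?v -` D \<inter> {0<..<1}) = 0" and k: "Y \<omega> k \<in> {a<..<b}"
        then have notD: "(?v, V2 \<omega> i) \<notin> D" for i using notE(1) sp by (simp add: E1_def)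
        from V2Y[OF k] obtain i where "V2 \<omega> i = Y \<omega> k" ..
        then show "(?v, Y \<omega> k) \<notin> D" using notD[of i] by simp
      next
        assume "0 < emeasure lborel (Pair ?v -` D \<inter> {a<..<b})"
        then obtain k where k: "(?v, V2 \<omega> k) \<in> D" using notE(2) sp by (auto simp: E2_def)
        obtain i where "Y \<omega> i = V2 \<omega> k" "V2 \<omega> k \<in> {a<..<b}" using YV2 by blast
        then show "\<exists>k. Y \<omega> k \<in> {a<..<b} \<and> (?v, Y \<omega> k) \<in> D" using k by (intro exI[of _ i]) simp
      qed
    qed
  qed
qed

text \<open>
  Rational end points keep the number of windows countable, so that the exceptional events of all
  of them can be discarded together.
\<close>

lemma rational_window:
  fixes x :: real
  assumes F: "finite F" and x: "x \<in> {0<..<1}" "x \<notin> F"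
  shows "\<exists>a\<in>\<rat>. \<exists>b\<in>\<rat>. 0 < a \<and> a < x \<and> x < b \<and> b < 1 \<and> {a..b} \<inter> F = {}"
proof -
  have "open ({0<..<1} - F)" using F by (intro open_Diff finite_imp_closed) auto
  then obtain e where e: "e > 0" "ball x e \<subseteq> {0<..<1} - F" using x unfolding open_contains_ball by blast
  obtain a where a: "a \<in> \<rat>" "x - e < a" "a < x" using Rats_dense_in_real[of "x - e" x] e(1) by auto
  obtain b where b: "b \<in> \<rat>" "x < b" "b < x + e" using Rats_dense_in_real[of x "x + e"] e(1) by auto
  have "{a..b} \<subseteq> ball x e" using a b by (auto simp: dist_real_def)
  then have sub: "{a..b} \<subseteq> {0<..<1} - F" using e(2) by blast
  moreover have "a \<in> {a..b}" "b \<in> {a..b}" using a b by auto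
  ultimately have "a \<in> {0<..<1}" "b \<in> {0<..<1}" by blast+
  then show ?thesis using a b sub by (intro bexI[of _ a] bexI[of _ b]) auto
qed

lemma generic_enumeration:
  assumes M: "prob_space M" and X: "random_dcs M 0 1 X" and st: "stationary M X" and ind: "independence_condition M X"
    and Y: "measurable_lifting M 0 1 X Y"
  shows "generic M Y"
  unfolding generic_def
proof (intro conjI ballI allI impI)
  show "Y \<in> M \<rightarrow>\<^sub>M seqs" by (rule measurable_liftingD(1)[OF Y])
  fix D and ks :: "nat list" assume D: "D \<in> sets (seqs \<Otimes>\<^sub>M (borel :: real measure))"
  define W where "W = {(a, b). a \<in> \<rat> \<and> b \<in> \<rat> \<and> 0 < a \<and> a < b \<and> b < (1::real)}"
  have Wc: "countable W"
    by (rule countable_subset[of _ "\<rat> \<times> \<rat>"]) (auto simp: W_def countable_rat)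
  have sec: "Pair v -` D \<in> sets borel" for v by (rule sets_Pair1[OF D])
  let ?P = "\<lambda>\<omega> a b. \<forall>ks. (\<forall>k\<in>set ks. Y \<omega> k \<notin> {a..b}) \<longrightarrow>
    (emeasure lborel (Pair (prefix_seq (Y \<omega>) ks) -` D \<inter> {0<..<1}) = 0 \<longrightarrow> (\<forall>k. Y \<omega> k \<in> {a<..<b} \<longrightarrow> (prefix_seq (Y \<omega>) ks, Y \<omega> k) \<notin> D)) \<and>
    (0 < emeasure lborel (Pair (prefix_seq (Y \<omega>) ks) -` D \<inter> {a<..<b}) \<longrightarrow> (\<exists>k. Y \<omega> k \<in> {a<..<b} \<and> (prefix_seq (Y \<omega>) ks, Y \<omega> k) \<in> D))"
  have AE: "AE \<omega> in M. \<forall>ab\<in>W. ?P \<omega> (fst ab) (snd ab)"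
    by (rule AE_ball_countable'[OF _ Wc], rule window_generic[OF M X st ind Y _ _ _ D]) (auto simp: W_def)
  {
    fix k assume k: "k \<notin> set ks"
    show "AE \<omega> in M. emeasure unif01 (Pair (prefix_seq (Y \<omega>) ks) -` D) = 0 \<longrightarrow> (prefix_seq (Y \<omega>) ks, Y \<omega> k) \<notin> D"
      using AE AE_space
    proof eventually_elim
      case (elim \<omega>)
      have "Y \<omega> k \<notin> Y \<omega> ` set ks" using measurable_liftingD(3)[OF Y elim(2)] k by (auto dest: injD)
      moreover have "Y \<omega> k \<in> {0<..<1}" using measurable_liftingD(4)[OF Y elim(2)] by blast
      ultimately obtain a b where ab: "a \<in> \<rat>" "b \<in> \<rat>" "0 < a" "a < Y \<omega> k" "Y \<omega> k < b" "b < 1" "{a..b} \<inter> Y \<omega> ` set ks = {}"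
        using rational_window[of "Y \<omega> ` set ks" "Y \<omega> k"] by blast
      then have "(a, b) \<in> W" by (auto simp: W_def)
      from bspec[OF elim(1) this] have P: "?P \<omega> a b" unfolding fst_conv snd_conv .
      have "\<forall>k\<in>set ks. Y \<omega> k \<notin> {a..b}" using ab(7) by blast
      then have "emeasure lborel (Pair (prefix_seq (Y \<omega>) ks) -` D \<inter> {0<..<1}) = 0 \<longrightarrow> (\<forall>k. Y \<omega> k \<in> {a<..<b} \<longrightarrow> (prefix_seq (Y \<omega>) ks, Y \<omega> k) \<notin> D)"
        by (rule P[THEN spec, THEN mp, THEN conjunct1])
      then show ?case using ab(4,5) by (simp add: emeasure_unif01[OF sec])
    qed
  }
  show "AE \<omega> in M. 0 < emeasure unif01 (Pair (prefix_seq (Y \<omega>) ks) -` D) \<longrightarrow> (\<exists>k. k \<notin> set ks \<and> (prefix_seq (Y \<omega>) ks, Y \<omega> k) \<in> D)"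
    using AE
  proof eventually_elim
    case (elim \<omega>)
    show ?case
    proof
      let ?F = "Y \<omega> ` set ks" and ?A = "Pair (prefix_seq (Y \<omega>) ks) -` D"
      assume "0 < emeasure unif01 ?A"
      then have pos: "0 < emeasure lborel (?A \<inter> {0<..<1})" by (simp add: emeasure_unif01[OF sec])
      define W' where "W' = {ab\<in>W. {fst ab..snd ab} \<inter> ?F = {}}"
      have "\<exists>ab\<in>W'. emeasure lborel (?A \<inter> {fst ab<..<snd ab}) \<noteq> 0"
      proof (rule ccontr)
        assume no: "\<not> ?thesis"
        have nul: "(\<Union>ab\<in>W'. ?A \<inter> {fst ab<..<snd ab}) \<in> null_sets lborel"
        proof (rule null_sets_UN')
          show "countable W'" by (rule countable_subset[OF _ Wc]) (auto simp: W'_def)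
          show "?A \<inter> {fst ab<..<snd ab} \<in> null_sets lborel" if "ab \<in> W'" for ab
            using no that sec by (intro null_setsI) auto
        qed
        have nulF: "?F \<in> null_sets lborel" by (rule finite_imp_null_set_lborel) simp
        have "?A \<inter> {0<..<1} \<subseteq> (\<Union>ab\<in>W'. ?A \<inter> {fst ab<..<snd ab}) \<union> ?F"
        proof
          fix x assume x: "x \<in> ?A \<inter> {0<..<1}"
          show "x \<in> (\<Union>ab\<in>W'. ?A \<inter> {fst ab<..<snd ab}) \<union> ?F"
          proof (cases "x \<in> ?F")
            case False
            then obtain a b where ab: "a \<in> \<rat>" "b \<in> \<rat>" "0 < a" "a < x" "x < b" "b < 1" "{a..b} \<inter> ?F = {}"
              using rational_window[of ?F x] x by blast
            then have "(a, b) \<in> W'" by (auto simp: W'_def W_def)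
            moreover have "x \<in> ?A \<inter> {fst (a, b)<..<snd (a, b)}" using x ab by simp
            ultimately show ?thesis by blast
          qed simp
        qed
        then have "emeasure lborel (?A \<inter> {0<..<1}) \<le> emeasure lborel ((\<Union>ab\<in>W'. ?A \<inter> {fst ab<..<snd ab}) \<union> ?F)"
          by (rule emeasure_mono) (use nul nulF in blast)
        also have "\<dots> = 0" using null_sets.Un[OF nul nulF] by blast
        finally show False using pos by simp
      qed
      then obtain a b where ab: "(a, b) \<in> W" "{a..b} \<inter> ?F = {}" "emeasure lborel (?A \<inter> {a<..<b}) \<noteq> 0"
        by (auto simp: W'_def)
      from bspec[OF elim ab(1)] have P: "?P \<omega> a b" unfolding fst_conv snd_conv .
      have out: "\<forall>k\<in>set ks. Y \<omega> k \<notin> {a..b}" using ab(2) by blast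
      have pos': "0 < emeasure lborel (?A \<inter> {a<..<b})" using ab(3) by (simp add: zero_less_iff_neq_zero)
      from P[THEN spec, THEN mp, OF out, THEN conjunct2, THEN mp, OF pos']
      obtain k where k: "Y \<omega> k \<in> {a<..<b}" "(prefix_seq (Y \<omega>) ks, Y \<omega> k) \<in> D" by blast
      have "k \<notin> set ks" using k(1) out by force
      then show "\<exists>k. k \<notin> set ks \<and> (prefix_seq (Y \<omega>) ks, Y \<omega> k) \<in> D" using k(2) by blast
    qed
  qed
qed

lemma genericD:
  assumes "generic M Y"
  shows "Y \<in> M \<rightarrow>\<^sub>M seqs"
    and "D \<in> sets (seqs \<Otimes>\<^sub>M borel) \<Longrightarrow> k \<notin> set ks \<Longrightarrow>
      AE \<omega> in M. emeasure unif01 (Pair (prefix_seq (Y \<omega>) ks) -` D) = 0 \<longrightarrow> (prefix_seq (Y \<omega>) ks, Y \<omega> k) \<notin> D"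
    and "D \<in> sets (seqs \<Otimes>\<^sub>M borel) \<Longrightarrow>
      AE \<omega> in M. 0 < emeasure unif01 (Pair (prefix_seq (Y \<omega>) ks) -` D) \<longrightarrow> (\<exists>k. k \<notin> set ks \<and> (prefix_seq (Y \<omega>) ks, Y \<omega> k) \<in> D)"
  using assms unfolding generic_def by simp_all

section \<open>Greedy selection of a point with a prescribed conditional law\<close>

lemma real_density_exists:
  assumes "sigma_finite_measure M" "finite_measure N" "absolutely_continuous M N" "sets N = sets M"
  shows "\<exists>f\<in>borel_measurable M. (\<forall>x. 0 \<le> f x) \<and> N = density M (\<lambda>x. ennreal (f x))"
proof -
  interpret sigma_finite_measure M by fact
  interpret N: finite_measure N by fact
  obtain D where D: "D \<in> borel_measurable M" "AE x in M. RN_deriv M N x = ennreal (D x)"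
      "AE x in N. 0 < D x" "\<And>x. 0 \<le> D x"
    using real_RN_deriv[OF N.finite_measure_axioms assms(3,4)] by metis
  have "N = density M (RN_deriv M N)"
    using density_RN_deriv[OF assms(3,4)] by simp
  also have "\<dots> = density M (\<lambda>x. ennreal (D x))"
    by (rule density_cong) (use D in auto)
  finally show ?thesis using D by blast
qed

text \<open>
  The law \<open>\<rho>\<close> is the target for the pair of the known value \<open>V\<close> and the selected point; \<open>g k\<close> is
  the conditional probability of selecting the \<open>k\<close>-th candidate.

  Candidates are offered one after the other. Let \<open>q k\<close> be the probability that nothing has been
  accepted before the \<open>k\<close>-th offer, \<open>r k\<close> the part of the density of \<open>\<rho>\<close> not used so far, and \<open>m k\<close> the
  density of the \<open>k\<close>-th offer; it exists by \<open>ac\<close>. Accepting with probability \<open>min 1 (r k / m k)\<close> uses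
  up \<open>min (r k) (m k)\<close>. The masses of \<open>q k\<close> and \<open>r k\<close> agree even conditionally on \<open>V\<close>. If the limit
  of \<open>q\<close> were not zero, then the limit of \<open>r\<close> would be positive on a non-null section over such a point, so by
  \<open>hit\<close> some candidate would fall where \<open>r\<close> stays positive. But there it was accepted with
  probability one.
\<close>

lemma greedy_selection:
  fixes P :: "'t measure" and N :: "'v measure" and L :: "'x measure"
    and R :: "nat \<Rightarrow> 't \<Rightarrow> 'x" and allowed :: "nat \<Rightarrow> 't \<Rightarrow> bool"
  assumes "prob_space P" and "prob_space L"
    and V[measurable]: "V \<in> P \<rightarrow>\<^sub>M N" and R[measurable]: "\<And>k. R k \<in> P \<rightarrow>\<^sub>M L"
    and allowed[measurable]: "\<And>k. Measurable.pred P (allowed k)"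
    and ac: "\<And>k D. D \<in> sets (N \<Otimes>\<^sub>M L) \<Longrightarrow>
      AE \<theta> in P. allowed k \<theta> \<longrightarrow> emeasure L (Pair (V \<theta>) -` D) = 0 \<longrightarrow> (V \<theta>, R k \<theta>) \<notin> D"
    and hit: "\<And>D. D \<in> sets (N \<Otimes>\<^sub>M L) \<Longrightarrow>
      AE \<theta> in P. 0 < emeasure L (Pair (V \<theta>) -` D) \<longrightarrow> (\<exists>k. allowed k \<theta> \<and> (V \<theta>, R k \<theta>) \<in> D)"
    and \<rho>: "sets \<rho> = sets (N \<Otimes>\<^sub>M L)" "distr \<rho> N fst = distr P N V"
      "absolutely_continuous (distr P N V \<Otimes>\<^sub>M L) \<rho>"
  shows "\<exists>g :: nat \<Rightarrow> 't \<Rightarrow> ennreal. (\<forall>k. g k \<in> borel_measurable P) \<and> (\<forall>\<theta>. (\<Sum>k. g k \<theta>) = 1) \<and>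
    (\<forall>F\<in>borel_measurable (N \<Otimes>\<^sub>M L).
      (\<Sum>k. \<integral>\<^sup>+\<theta>. g k \<theta> * F (V \<theta>, R k \<theta>) \<partial>P) = (\<integral>\<^sup>+z. F z \<partial>\<rho>))"
proof -
  interpret P: prob_space P by fact
  interpret L: prob_space L by fact
  define \<nu> where "\<nu> = distr P N V"
  interpret \<nu>: prob_space \<nu> unfolding \<nu>_def by (rule P.prob_space_distr) simp
  have sets_\<nu>[measurable_cong, simp]: "sets \<nu> = sets N" by (simp add: \<nu>_def)
  interpret K: pair_prob_space \<nu> L by unfold_locales
  define K where "K = \<nu> \<Otimes>\<^sub>M L"
  have sets_K[measurable_cong, simp]: "sets K = sets (N \<Otimes>\<^sub>M L)"
    unfolding K_def by (intro sets_pair_measure_cong) auto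
  have space_K[simp]: "space K = space (N \<Otimes>\<^sub>M L)" by (rule sets_eq_imp_space_eq) simp
  have sfK: "sigma_finite_measure K" unfolding K_def by unfold_locales
  note [measurable_cong] = \<rho>(1)
  have space_\<rho>[simp]: "space \<rho> = space (N \<Otimes>\<^sub>M L)" by (rule sets_eq_imp_space_eq) (fact \<rho>(1))
  have \<rho>_marg: "emeasure \<rho> (A \<times> space L) = emeasure P (V -` A \<inter> space P)" if [measurable]: "A \<in> sets N" for A
  proof -
    have "emeasure (distr \<rho> N fst) A = emeasure (distr P N V) A" by (simp add: \<rho>(2))
    moreover have "fst -` A \<inter> space \<rho> = A \<times> space L"
      using sets.sets_into_space[OF that] by (auto simp: space_pair_measure)
    ultimately show ?thesis by (simp add: emeasure_distr)
  qed
  have \<rho>1: "emeasure \<rho> (space \<rho>) = 1"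
  proof -
    have "V -` space N \<inter> space P = space P" using measurable_space[OF V] by auto
    then show ?thesis using \<rho>_marg[OF sets.top] by (simp add: space_pair_measure P.emeasure_space_1)
  qed
  interpret \<rho>: prob_space \<rho> by (rule prob_spaceI) (fact \<rho>1)
  have "\<exists>f\<in>borel_measurable K. (\<forall>x. 0 \<le> f x) \<and> \<rho> = density K (\<lambda>x. ennreal (f x))"
  proof (rule real_density_exists[OF sfK \<rho>.finite_measure_axioms])
    show "absolutely_continuous K \<rho>" using \<rho>(3) unfolding K_def \<nu>_def .
    show "sets \<rho> = sets K" unfolding sets_K by (rule \<rho>(1))
  qed
  then obtain f where fK: "f \<in> borel_measurable K" and f0: "\<And>x. 0 \<le> f x"
    and f\<rho>: "\<rho> = density K (\<lambda>x. ennreal (f x))" by blast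
  have f[measurable]: "f \<in> borel_measurable (N \<Otimes>\<^sub>M L)"
    using fK unfolding measurable_cong_sets[OF sets_K refl] .
  define acc where "acc k q = distr (density P (\<lambda>\<theta>. ennreal (q \<theta> * of_bool (allowed k \<theta>)))) (N \<Otimes>\<^sub>M L) (\<lambda>\<theta>. (V \<theta>, R k \<theta>))"
    for k and q :: "'t \<Rightarrow> real"
  have acc_ac: "absolutely_continuous K (acc k q)" if [measurable]: "q \<in> borel_measurable P" for k q
    unfolding absolutely_continuous_def
  proof
    fix D assume D: "D \<in> null_sets K"
    then have D'[measurable]: "D \<in> sets (N \<Otimes>\<^sub>M L)" by auto
    have "emeasure K D = (\<integral>\<^sup>+v. emeasure L (Pair v -` D) \<partial>\<nu>)"
      unfolding K_def by (subst L.emeasure_pair_measure_alt) (use D' sets_K in \<open>auto simp: K_def\<close>)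
    then have "(\<integral>\<^sup>+v. emeasure L (Pair v -` D) \<partial>\<nu>) = 0" using D by auto
    moreover have m[measurable]: "(\<lambda>v. emeasure L (Pair v -` D)) \<in> borel_measurable N"
      by (rule L.measurable_emeasure_Pair) fact
    ultimately have "AE v in \<nu>. emeasure L (Pair v -` D) = 0"
      by (subst (asm) nn_integral_0_iff_AE) auto
    then have "AE \<theta> in P. emeasure L (Pair (V \<theta>) -` D) = 0"
      unfolding \<nu>_def by (rule AE_distrD[OF V])
    with ac[OF D', of k] have "AE \<theta> in P. allowed k \<theta> \<longrightarrow> (V \<theta>, R k \<theta>) \<notin> D" by auto
    then have "AE \<theta> in P. ennreal (q \<theta> * of_bool (allowed k \<theta>)) * indicator ((\<lambda>\<theta>. (V \<theta>, R k \<theta>)) -` D \<inter> space P) \<theta> = 0"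
      by eventually_elim (auto simp: indicator_def)
    then have "emeasure (acc k q) D = 0"
      unfolding acc_def
      by (simp add: emeasure_distr emeasure_density nn_integral_0_iff_AE)
    then show "D \<in> null_sets (acc k q)" by (auto simp: acc_def)
  qed
  have acc_fin: "finite_measure (acc k q)"
    if [measurable]: "q \<in> borel_measurable P" and "\<And>\<theta>. q \<theta> \<in> {0..1}" for k q
  proof (rule finite_measureI)
    have "emeasure (acc k q) (space (acc k q)) = emeasure (density P (\<lambda>\<theta>. ennreal (q \<theta> * of_bool (allowed k \<theta>)))) (space P)"
      unfolding acc_def by (subst emeasure_distr) (auto intro!: arg_cong2[where f=emeasure] simp: space_pair_measure dest: measurable_space[OF V] measurable_space[OF R])
    also have "\<dots> \<le> (\<integral>\<^sup>+\<theta>. 1 \<partial>P)"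
      by (subst emeasure_density) (use that(2) in \<open>auto intro!: nn_integral_mono simp del: nn_integral_const simp: indicator_def of_bool_def\<close>)
    also have "\<dots> = 1" by (simp add: P.emeasure_space_1)
    finally show "emeasure (acc k q) (space (acc k q)) \<noteq> \<infinity>"
      by (metis ennreal_one_neq_top infinity_ennreal_def top_unique)
  qed
  define a where "a r m z = (if m z \<le> r z then 1 else r z / m z :: real)" for r m :: "'v \<times> 'x \<Rightarrow> real" and z
  define inv where "inv s \<longleftrightarrow> fst s \<in> borel_measurable P \<and> snd s \<in> borel_measurable (N \<Otimes>\<^sub>M L) \<and>
     (\<forall>\<theta>. fst s \<theta> \<in> {0..1}) \<and> (\<forall>z. 0 \<le> snd s z)" for s :: "('t \<Rightarrow> real) \<times> ('v \<times> 'x \<Rightarrow> real)"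
  define step where "step k s m s' \<longleftrightarrow> m \<in> borel_measurable (N \<Otimes>\<^sub>M L) \<and> (\<forall>z. 0 \<le> m z) \<and>
     acc k (fst s) = density K (\<lambda>z. ennreal (m z)) \<and>
     fst s' = (\<lambda>\<theta>. fst s \<theta> * (1 - of_bool (allowed k \<theta>) * a (snd s) m (V \<theta>, R k \<theta>))) \<and>
     snd s' = (\<lambda>z. snd s z - min (snd s z) (m z))"
    for k and s s' :: "('t \<Rightarrow> real) \<times> ('v \<times> 'x \<Rightarrow> real)" and m
  have a01: "a r m z \<in> {0..1}" if "0 \<le> r z" "0 \<le> m z" for r m z
    using that by (auto simp: a_def divide_simps)
  have a_meas: "a r m \<in> borel_measurable (N \<Otimes>\<^sub>M L)"
    if [measurable]: "r \<in> borel_measurable (N \<Otimes>\<^sub>M L)" "m \<in> borel_measurable (N \<Otimes>\<^sub>M L)" for r m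
    unfolding a_def[abs_def] by measurable
  have "\<exists>s. (\<forall>k. inv (s k)) \<and> (\<forall>k. (k = 0 \<longrightarrow> s k = (\<lambda>_. 1, f)) \<and> (\<exists>m. step k (s k) m (s (Suc k))))"
  proof -
    have "\<exists>s. \<forall>k. (inv (s k) \<and> (k = 0 \<longrightarrow> s k = (\<lambda>_. 1, f))) \<and> (\<exists>m. step k (s k) m (s (Suc k)))"
    proof (rule dependent_nat_choice)
      show "\<exists>s. inv s \<and> (0 = 0 \<longrightarrow> s = (\<lambda>_. 1, f))" by (auto simp: inv_def f0)
    next
      fix s and k :: nat assume "inv s \<and> (k = 0 \<longrightarrow> s = (\<lambda>_. 1, f))"
      then have s: "inv s" by simp
      then have [measurable]: "fst s \<in> borel_measurable P" "snd s \<in> borel_measurable (N \<Otimes>\<^sub>M L)"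
        and s01: "\<And>\<theta>. fst s \<theta> \<in> {0..1}" and r0: "\<And>z. 0 \<le> snd s z" by (auto simp: inv_def)
      have "\<exists>m\<in>borel_measurable K. (\<forall>x. 0 \<le> m x) \<and> acc k (fst s) = density K (\<lambda>x. ennreal (m x))"
        by (intro real_density_exists sfK acc_fin acc_ac s01) (auto simp: acc_def)
      then obtain m where mK: "m \<in> borel_measurable K" and m: "\<And>z. 0 \<le> m z"
        "acc k (fst s) = density K (\<lambda>x. ennreal (m x))" by blast
      have [measurable]: "m \<in> borel_measurable (N \<Otimes>\<^sub>M L)"
        using mK unfolding measurable_cong_sets[OF sets_K refl] .
      note [measurable] = a_meas
      let ?s = "(\<lambda>\<theta>. fst s \<theta> * (1 - of_bool (allowed k \<theta>) * a (snd s) m (V \<theta>, R k \<theta>)), \<lambda>z. snd s z - min (snd s z) (m z))"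
      have "inv ?s"
        unfolding inv_def
      proof (intro conjI allI)
        fix \<theta> show "fst ?s \<theta> \<in> {0..1}"
          using s01[of \<theta>] a01[of "snd s" "(V \<theta>, R k \<theta>)" m] r0 m(1)
          by (cases "allowed k \<theta>") (auto intro!: mult_le_one mult_nonneg_nonneg)
      qed auto
      moreover have "step k s m ?s" by (auto simp: step_def m)
      ultimately show "\<exists>y. (inv y \<and> (Suc k = 0 \<longrightarrow> y = (\<lambda>_. 1, f))) \<and> (\<exists>m. step k s m y)" by auto
    qed
    then show ?thesis by auto
  qed
  then obtain s where inv_s: "\<And>k. inv (s k)" and s0: "s 0 = (\<lambda>_. 1, f)" and "\<And>k. \<exists>m. step k (s k) m (s (Suc k))"
    by auto
  then obtain m where step: "\<And>k. step k (s k) (m k) (s (Suc k))" by metis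
  define q r where "q k = fst (s k)" and "r k = snd (s k)" for k
  have [measurable]: "q k \<in> borel_measurable P" "r k \<in> borel_measurable (N \<Otimes>\<^sub>M L)" "m k \<in> borel_measurable (N \<Otimes>\<^sub>M L)" for k
    using inv_s[of k] step[of k] by (auto simp: inv_def step_def q_def r_def)
  have q01: "q k \<theta> \<in> {0..1}" and r_ge: "0 \<le> r k z" and m_ge: "0 \<le> m k z" for k \<theta> z
    using inv_s[of k] step[of k] unfolding inv_def step_def q_def r_def by (fast, fast, fast)
  have acc_eq: "acc k (q k) = density K (\<lambda>z. ennreal (m k z))"
    and q_Suc: "q (Suc k) \<theta> = q k \<theta> * (1 - of_bool (allowed k \<theta>) * a (r k) (m k) (V \<theta>, R k \<theta>))"
    and r_Suc: "r (Suc k) z = r k z - min (r k z) (m k z)" for k \<theta> z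
    using step[of k] by (auto simp: step_def q_def r_def)
  have q_0: "q 0 \<theta> = 1" and r_0: "r 0 z = f z" for \<theta> z by (auto simp: q_def r_def s0)
  note [measurable] = a_meas
  have a01': "a (r k) (m k) z \<in> {0..1}" for k z by (intro a01 r_ge m_ge)
  define g where "g k \<theta> = q k \<theta> * of_bool (allowed k \<theta>) * a (r k) (m k) (V \<theta>, R k \<theta>)" for k \<theta>
  have [measurable]: "g k \<in> borel_measurable P" for k unfolding g_def[abs_def] by measurable
  have g_ge: "0 \<le> g k \<theta>" for k \<theta> using q01[of k \<theta>] a01'[of k] by (auto simp: g_def)
  have q_Suc': "q (Suc k) \<theta> = q k \<theta> - g k \<theta>" for k \<theta> by (simp add: q_Suc g_def algebra_simps)
  have q_sum: "q k \<theta> = 1 - (\<Sum>j<k. g j \<theta>)" for k \<theta>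
    by (induction k) (simp_all add: q_0 q_Suc')
  have g_int: "(\<integral>\<^sup>+\<theta>. ennreal (g k \<theta>) * F (V \<theta>, R k \<theta>) \<partial>P) = (\<integral>\<^sup>+z. ennreal (min (r k z) (m k z)) * F z \<partial>K)"
    if [measurable]: "F \<in> borel_measurable (N \<Otimes>\<^sub>M L)" for k F
  proof -
    have "(\<integral>\<^sup>+\<theta>. ennreal (g k \<theta>) * F (V \<theta>, R k \<theta>) \<partial>P) =
      (\<integral>\<^sup>+\<theta>. ennreal (q k \<theta> * of_bool (allowed k \<theta>)) * (ennreal (a (r k) (m k) (V \<theta>, R k \<theta>)) * F (V \<theta>, R k \<theta>)) \<partial>P)"
      using q01[of k] a01'[of k] by (intro nn_integral_cong) (simp add: g_def ennreal_mult[symmetric] mult.assoc[symmetric])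
    also have "\<dots> = (\<integral>\<^sup>+z. ennreal (a (r k) (m k) z) * F z \<partial>acc k (q k))"
      unfolding acc_def by (simp add: nn_integral_distr nn_integral_density)
    also have "\<dots> = (\<integral>\<^sup>+z. ennreal (m k z) * (ennreal (a (r k) (m k) z) * F z) \<partial>K)"
      unfolding acc_eq by (rule nn_integral_density) measurable
    also have "\<dots> = (\<integral>\<^sup>+z. ennreal (min (r k z) (m k z)) * F z \<partial>K)"
    proof (rule nn_integral_cong)
      fix z
      have "m k z * a (r k) (m k) z = min (r k z) (m k z)"
        using r_ge[of k z] m_ge[of k z] by (auto simp: a_def min_def)
      then show "ennreal (m k z) * (ennreal (a (r k) (m k) z) * F z) = ennreal (min (r k z) (m k z)) * F z"
        using a01'[of k z] m_ge[of k z] by (simp add: ennreal_mult[symmetric] mult.assoc[symmetric])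
    qed
    finally show ?thesis .
  qed
  have r_sum: "r k z + (\<Sum>j<k. min (r j z) (m j z)) = f z" for k z
    by (induction k) (auto simp: r_0 r_Suc)
  \<comment> \<open>Both sides are what is left of the mass that \<open>\<rho>\<close> and \<open>P\<close> give to the values of \<open>V\<close> in \<open>A\<close> after the same accepted masses have been removed.\<close>
  have balance: "(\<integral>\<^sup>+\<theta>. ennreal (q k \<theta>) * indicator A (V \<theta>) \<partial>P) = (\<integral>\<^sup>+z. ennreal (r k z) * indicator A (fst z) \<partial>K)"
    if [measurable]: "A \<in> sets N" for k A
  proof -
    let ?G = "\<lambda>k. (\<Sum>j<k. \<integral>\<^sup>+\<theta>. ennreal (g j \<theta>) * indicator A (V \<theta>) \<partial>P)"
    have 1: "(\<integral>\<^sup>+\<theta>. ennreal (q k \<theta>) * indicator A (V \<theta>) \<partial>P) + ?G k = emeasure P (V -` A \<inter> space P)"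
    proof -
      have "(\<integral>\<^sup>+\<theta>. ennreal (q k \<theta>) * indicator A (V \<theta>) \<partial>P) + ?G k =
        (\<integral>\<^sup>+\<theta>. ennreal (q k \<theta>) * indicator A (V \<theta>) + (\<Sum>j<k. ennreal (g j \<theta>) * indicator A (V \<theta>)) \<partial>P)"
        by (subst nn_integral_sum[symmetric], measurable, subst nn_integral_add[symmetric], measurable)
      also have "\<dots> = (\<integral>\<^sup>+\<theta>. indicator (V -` A \<inter> space P) \<theta> \<partial>P)"
      proof (rule nn_integral_cong)
        fix \<theta> assume "\<theta> \<in> space P"
        have "ennreal (q k \<theta>) + (\<Sum>j<k. ennreal (g j \<theta>)) = ennreal (q k \<theta> + (\<Sum>j<k. g j \<theta>))"
          using q01[of k \<theta>] by (simp add: sum_ennreal g_ge sum_nonneg)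
        also have "\<dots> = 1" unfolding q_sum by simp
        finally have tot: "ennreal (q k \<theta>) + (\<Sum>j<k. ennreal (g j \<theta>)) = 1" .
        show "ennreal (q k \<theta>) * indicator A (V \<theta>) + (\<Sum>j<k. ennreal (g j \<theta>) * indicator A (V \<theta>)) = indicator (V -` A \<inter> space P) \<theta>"
          unfolding sum_distrib_right[symmetric] distrib_right[symmetric] tot
          using \<open>\<theta> \<in> space P\<close> by (simp add: indicator_def)
      qed
      also have "\<dots> = emeasure P (V -` A \<inter> space P)" by (rule nn_integral_indicator) measurable
      finally show ?thesis .
    qed
    have 2: "(\<integral>\<^sup>+z. ennreal (r k z) * indicator A (fst z) \<partial>K) + ?G k = emeasure P (V -` A \<inter> space P)"
    proof -
      have "?G k = (\<Sum>j<k. \<integral>\<^sup>+z. ennreal (min (r j z) (m j z)) * indicator A (fst z) \<partial>K)"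
        using g_int[of "\<lambda>z. indicator A (fst z)"] by (intro sum.cong) auto
      also have "\<dots> = (\<integral>\<^sup>+z. (\<Sum>j<k. ennreal (min (r j z) (m j z)) * indicator A (fst z)) \<partial>K)"
        by (rule nn_integral_sum[symmetric]) measurable
      finally have "(\<integral>\<^sup>+z. ennreal (r k z) * indicator A (fst z) \<partial>K) + ?G k =
        (\<integral>\<^sup>+z. ennreal (r k z) * indicator A (fst z) + (\<Sum>j<k. ennreal (min (r j z) (m j z)) * indicator A (fst z)) \<partial>K)"
        by (simp only:, subst nn_integral_add[symmetric], measurable)
      also have "\<dots> = (\<integral>\<^sup>+z. ennreal (f z) * indicator (A \<times> space L) z \<partial>K)"
      proof (rule nn_integral_cong)
        fix z assume z: "z \<in> space K"
        have "ennreal (r k z) + (\<Sum>j<k. ennreal (min (r j z) (m j z))) = ennreal (r k z + (\<Sum>j<k. min (r j z) (m j z)))"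
          by (simp add: sum_ennreal r_ge m_ge sum_nonneg)
        also have "\<dots> = ennreal (f z)" unfolding r_sum ..
        finally have tot: "ennreal (r k z) + (\<Sum>j<k. ennreal (min (r j z) (m j z))) = ennreal (f z)" .
        show "ennreal (r k z) * indicator A (fst z) + (\<Sum>j<k. ennreal (min (r j z) (m j z)) * indicator A (fst z)) = ennreal (f z) * indicator (A \<times> space L) z"
          unfolding sum_distrib_right[symmetric] distrib_right[symmetric] tot
          using z by (cases z) (simp add: indicator_def space_pair_measure)
      qed
      also have "\<dots> = emeasure \<rho> (A \<times> space L)"
        unfolding f\<rho> by (subst emeasure_density) auto
      finally show ?thesis by (simp add: \<rho>_marg)
    qed
    have "?G k \<noteq> \<top>"
      using P.emeasure_finite[of "V -` A \<inter> space P"] unfolding 1[symmetric] by auto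
    moreover have "?G k + (\<integral>\<^sup>+\<theta>. ennreal (q k \<theta>) * indicator A (V \<theta>) \<partial>P) =
        ?G k + (\<integral>\<^sup>+z. ennreal (r k z) * indicator A (fst z) \<partial>K)"
      by (subst (1 2) add.commute) (rule 1[unfolded 2[symmetric]])
    ultimately show ?thesis unfolding ennreal_add_left_cancel by simp
  qed
  define q' r' where "q' \<theta> = (INF k. ennreal (q k \<theta>))" and "r' z = (INF k. ennreal (r k z))" for \<theta> z
  have [measurable]: "q' \<in> borel_measurable P" "r' \<in> borel_measurable (N \<Otimes>\<^sub>M L)"
    unfolding q'_def[abs_def] r'_def[abs_def] by measurable
  have q_dec: "q (Suc k) \<theta> \<le> q k \<theta>" for k \<theta> by (simp add: q_Suc' g_ge)
  have r_dec: "r (Suc k) z \<le> r k z" for k z by (simp add: r_Suc r_ge m_ge)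
  have r_total: "(\<integral>\<^sup>+z. ennreal (r 0 z) \<partial>K) = 1"
  proof -
    have "(\<integral>\<^sup>+z. ennreal (r 0 z) \<partial>K) = (\<integral>\<^sup>+z. 1 \<partial>\<rho>)"
      unfolding f\<rho> by (subst nn_integral_density) (auto simp: r_0)
    also have "\<dots> = 1" using \<rho>1 by simp
    finally show ?thesis .
  qed
  have r_int: "(\<integral>\<^sup>+z. r' z * indicator D z \<partial>K) = (INF k. \<integral>\<^sup>+z. ennreal (r k z) * indicator D z \<partial>K)"
    if [measurable]: "D \<in> sets (N \<Otimes>\<^sub>M L)" for D
  proof -
    have *: "r' z * indicator D z = (INF k. ennreal (r k z) * indicator D z)" for z
      by (auto simp: r'_def indicator_def)
    show ?thesis unfolding *
    proof (rule nn_integral_monotone_convergence_INF_decseq)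
      show "decseq (\<lambda>k z. ennreal (r k z) * indicator D z)"
        unfolding decseq_Suc_iff by (intro allI le_funI mult_right_mono ennreal_leI r_dec) simp
      have "(\<integral>\<^sup>+z. ennreal (r 0 z) * indicator D z \<partial>K) \<le> (\<integral>\<^sup>+z. ennreal (r 0 z) \<partial>K)"
        by (intro nn_integral_mono) (auto simp: indicator_def)
      then show "(\<integral>\<^sup>+z. ennreal (r 0 z) * indicator D z \<partial>K) < \<infinity>"
        unfolding r_total by (rule le_less_trans) simp
    qed measurable
  qed
  define D where "D = {z \<in> space (N \<Otimes>\<^sub>M L). 0 < r' z}"
  have D[measurable]: "D \<in> sets (N \<Otimes>\<^sub>M L)" unfolding D_def by measurable
  have emD[measurable]: "(\<lambda>v. emeasure L (Pair v -` D)) \<in> borel_measurable N"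
    by (rule L.measurable_emeasure_Pair) fact
  have 1: "AE \<theta> in P. 0 < q' \<theta> \<longrightarrow> 0 < emeasure L (Pair (V \<theta>) -` D)"
  proof -
    define A where "A = {v \<in> space N. emeasure L (Pair v -` D) = 0}"
    have A[measurable]: "A \<in> sets N" unfolding A_def by measurable
    have AL: "A \<times> space L \<in> sets (N \<Otimes>\<^sub>M L)" by measurable
    have "(\<integral>\<^sup>+z. r' z * indicator (A \<times> space L) z \<partial>K) =
      (\<integral>\<^sup>+v. \<integral>\<^sup>+x. r' (v, x) * indicator (A \<times> space L) (v, x) \<partial>L \<partial>\<nu>)"
      unfolding K_def by (subst L.nn_integral_fst[symmetric]) (use AL in \<open>auto\<close>)
    also have "\<dots> = (\<integral>\<^sup>+v. 0 \<partial>\<nu>)"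
    proof (rule nn_integral_cong)
      fix v assume v: "v \<in> space \<nu>"
      then have vN: "v \<in> space N" by (simp add: \<nu>_def)
      show "(\<integral>\<^sup>+x. r' (v, x) * indicator (A \<times> space L) (v, x) \<partial>L) = 0"
      proof (cases "v \<in> A")
        case True
        then have "Pair v -` D \<in> null_sets L" by (auto simp: A_def intro!: null_setsI)
        then have "AE x in L. (v, x) \<notin> D" by (auto dest!: AE_not_in)
        then have "AE x in L. r' (v, x) * indicator (A \<times> space L) (v, x) = 0"
          using AE_space by eventually_elim (use vN in \<open>auto simp: D_def space_pair_measure\<close>)
        then show ?thesis by (subst nn_integral_0_iff_AE) (use vN in \<open>auto\<close>)
      qed (simp add: indicator_def)
    qed
    finally have z0: "(\<integral>\<^sup>+z. r' z * indicator (A \<times> space L) z \<partial>K) = 0" by simp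
    have "(\<integral>\<^sup>+\<theta>. q' \<theta> * indicator A (V \<theta>) \<partial>P) \<le> (INF k. \<integral>\<^sup>+z. ennreal (r k z) * indicator (A \<times> space L) z \<partial>K)"
    proof (rule INF_greatest)
      fix k
      have "(\<integral>\<^sup>+\<theta>. q' \<theta> * indicator A (V \<theta>) \<partial>P) \<le> (\<integral>\<^sup>+\<theta>. ennreal (q k \<theta>) * indicator A (V \<theta>) \<partial>P)"
        by (intro nn_integral_mono mult_right_mono) (auto simp: q'_def intro: INF_lower)
      also have "\<dots> = (\<integral>\<^sup>+z. ennreal (r k z) * indicator A (fst z) \<partial>K)" by (rule balance) fact
      also have "\<dots> = (\<integral>\<^sup>+z. ennreal (r k z) * indicator (A \<times> space L) z \<partial>K)"
        by (intro nn_integral_cong) (auto simp: indicator_def space_pair_measure)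
      finally show "(\<integral>\<^sup>+\<theta>. q' \<theta> * indicator A (V \<theta>) \<partial>P) \<le> (\<integral>\<^sup>+z. ennreal (r k z) * indicator (A \<times> space L) z \<partial>K)" .
    qed
    also have "\<dots> = 0" using r_int[OF AL] z0 by simp
    finally have "AE \<theta> in P. q' \<theta> * indicator A (V \<theta>) = 0"
      by (subst (asm) le_zero_eq, subst (asm) nn_integral_0_iff_AE) auto
    then show ?thesis using AE_space
      by eventually_elim (use measurable_space[OF V] in \<open>auto simp: A_def indicator_def zero_less_iff_neq_zero split: if_splits\<close>)
  qed
  have 2: "AE \<theta> in P. \<forall>k. allowed k \<theta> \<longrightarrow> r' (V \<theta>, R k \<theta>) = 0 \<or> q' \<theta> = 0"
  proof (intro AE_all_countable[THEN iffD2] allI)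
    fix k
    show "AE \<theta> in P. allowed k \<theta> \<longrightarrow> r' (V \<theta>, R k \<theta>) = 0 \<or> q' \<theta> = 0"
    proof (intro AE_I2 impI)
      fix \<theta> assume al: "allowed k \<theta>"
      show "r' (V \<theta>, R k \<theta>) = 0 \<or> q' \<theta> = 0"
      proof (cases "m k (V \<theta>, R k \<theta>) \<le> r k (V \<theta>, R k \<theta>)")
        case True
        then have "q (Suc k) \<theta> = 0" using al by (simp add: q_Suc a_def)
        then have "q' \<theta> \<le> 0" unfolding q'_def by (intro INF_lower2[of "Suc k"]) auto
        then show ?thesis by simp
      next
        case False
        then have "r (Suc k) (V \<theta>, R k \<theta>) = 0" by (simp add: r_Suc)
        then have "r' (V \<theta>, R k \<theta>) \<le> 0" unfolding r'_def by (intro INF_lower2[of "Suc k"]) auto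
        then show ?thesis by simp
      qed
    qed
  qed
  have q'0: "AE \<theta> in P. q' \<theta> = 0"
    using 1 2 hit[OF D] by eventually_elim (auto simp: D_def zero_less_iff_neq_zero)
  have g_sum: "AE \<theta> in P. (\<Sum>k. ennreal (g k \<theta>)) = 1"
    using q'0
  proof eventually_elim
    case (elim \<theta>)
    have "(\<lambda>k. ennreal (q k \<theta>)) \<longlonglongrightarrow> (INF k. ennreal (q k \<theta>))"
      by (rule LIMSEQ_INF) (auto simp: decseq_Suc_iff q_dec ennreal_leI)
    then have "(\<lambda>k. ennreal (q k \<theta>)) \<longlonglongrightarrow> ennreal 0" using elim by (simp add: q'_def)
    then have "(\<lambda>k. q k \<theta>) \<longlonglongrightarrow> 0" using q01 by (subst (asm) tendsto_ennreal_iff) auto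
    then have "(\<lambda>k. 1 - q k \<theta>) \<longlonglongrightarrow> 1 - 0" by (intro tendsto_intros)
    then have "(\<lambda>k. g k \<theta>) sums 1" by (simp add: sums_def q_sum)
    then show ?case using suminf_ennreal_eq[OF g_ge, of "\<lambda>k. k"] by (simp add: suminf_ennreal_eq[OF g_ge])
  qed
  \<comment> \<open>The weights sum to one almost surely; on the exceptional null set the first candidate is selected.\<close>
  define g' where "g' k \<theta> = (if (\<Sum>k. ennreal (g k \<theta>)) = 1 then ennreal (g k \<theta>) else of_bool (k = 0))" for k \<theta>
  have [measurable]: "g' k \<in> borel_measurable P" for k unfolding g'_def[abs_def] by measurable
  have g'_sum: "(\<Sum>k. g' k \<theta>) = 1" for \<theta>
  proof (cases "(\<Sum>k. ennreal (g k \<theta>)) = 1")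
    case False
    have "(\<Sum>k. of_bool (k = (0::nat)) :: ennreal) = (\<Sum>k\<in>{0::nat}. of_bool (k = 0))"
      by (rule suminf_finite) auto
    then show ?thesis using False by (simp add: g'_def)
  qed (simp add: g'_def)
  have g'_AE: "AE \<theta> in P. g' k \<theta> = ennreal (g k \<theta>)" for k
    using g_sum by eventually_elim (simp add: g'_def)
  define \<sigma> where "\<sigma> = density K (\<lambda>z. \<Sum>k. ennreal (min (r k z) (m k z)))"
  have \<sigma>_int: "(\<Sum>k. \<integral>\<^sup>+\<theta>. g' k \<theta> * F (V \<theta>, R k \<theta>) \<partial>P) = (\<integral>\<^sup>+z. F z \<partial>\<sigma>)"
    if [measurable]: "F \<in> borel_measurable (N \<Otimes>\<^sub>M L)" for F
  proof -
    have "(\<integral>\<^sup>+\<theta>. g' k \<theta> * F (V \<theta>, R k \<theta>) \<partial>P) = (\<integral>\<^sup>+z. ennreal (min (r k z) (m k z)) * F z \<partial>K)" for k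
    proof -
      have "(\<integral>\<^sup>+\<theta>. g' k \<theta> * F (V \<theta>, R k \<theta>) \<partial>P) = (\<integral>\<^sup>+\<theta>. ennreal (g k \<theta>) * F (V \<theta>, R k \<theta>) \<partial>P)"
        by (rule nn_integral_cong_AE) (use g'_AE[of k] in eventually_elim, simp)
      then show ?thesis using g_int[of F k] by simp
    qed
    then have "(\<Sum>k. \<integral>\<^sup>+\<theta>. g' k \<theta> * F (V \<theta>, R k \<theta>) \<partial>P) = (\<integral>\<^sup>+z. (\<Sum>k. ennreal (min (r k z) (m k z)) * F z) \<partial>K)"
      by (simp only:) (rule nn_integral_suminf[symmetric], measurable)
    also have "\<dots> = (\<integral>\<^sup>+z. F z \<partial>\<sigma>)"
      unfolding \<sigma>_def by (simp add: nn_integral_density)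
    finally show ?thesis .
  qed
  \<comment> \<open>Domination together with equal total mass forces \<open>\<sigma> = \<rho>\<close>.\<close>
  have \<sigma>_le: "emeasure \<sigma> E \<le> emeasure \<rho> E" if [measurable]: "E \<in> sets (N \<Otimes>\<^sub>M L)" for E
  proof -
    have le: "(\<Sum>k. ennreal (min (r k z) (m k z))) \<le> ennreal (f z)" for z
    proof (rule suminf_le_const)
      fix n
      have "(\<Sum>k<n. ennreal (min (r k z) (m k z))) = ennreal (\<Sum>k<n. min (r k z) (m k z))"
        by (rule sum_ennreal) (auto simp: r_ge m_ge)
      also have "\<dots> \<le> ennreal (f z)" using r_sum[of n z] r_ge[of n z] by (intro ennreal_leI) linarith
      finally show "(\<Sum>k<n. ennreal (min (r k z) (m k z))) \<le> ennreal (f z)" .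
    qed (rule summableI)
    have "emeasure \<sigma> E = (\<integral>\<^sup>+z. (\<Sum>k. ennreal (min (r k z) (m k z))) * indicator E z \<partial>K)"
      unfolding \<sigma>_def by (rule emeasure_density) measurable
    also have "\<dots> \<le> (\<integral>\<^sup>+z. ennreal (f z) * indicator E z \<partial>K)"
      by (intro nn_integral_mono mult_right_mono le) simp
    also have "\<dots> = emeasure \<rho> E"
      unfolding f\<rho> by (rule emeasure_density[symmetric]) measurable
    finally show ?thesis .
  qed
  have space_\<sigma>: "space \<sigma> = space (N \<Otimes>\<^sub>M L)" and sets_\<sigma>: "sets \<sigma> = sets (N \<Otimes>\<^sub>M L)" by (auto simp: \<sigma>_def)
  have \<sigma>1: "emeasure \<sigma> (space \<sigma>) = 1"
  proof -
    have "emeasure \<sigma> (space \<sigma>) = (\<Sum>k. \<integral>\<^sup>+\<theta>. g' k \<theta> \<partial>P)"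
      using \<sigma>_int[of "\<lambda>_. 1"] by simp
    also have "\<dots> = (\<integral>\<^sup>+\<theta>. (\<Sum>k. g' k \<theta>) \<partial>P)" by (simp add: nn_integral_suminf)
    finally show ?thesis by (simp add: g'_sum P.emeasure_space_1)
  qed
  have ps: "prob_space \<sigma>" by (rule prob_spaceI) (fact \<sigma>1)
  note \<sigma>_em = finite_measure.emeasure_eq_measure[OF prob_space.finite_measure[OF ps]]
  have "\<sigma> = \<rho>"
  proof (rule measure_eqI)
    show "sets \<sigma> = sets \<rho>" unfolding sets_\<sigma> \<rho>(1) ..
    fix E assume "E \<in> sets \<sigma>"
    then have E: "E \<in> sets (N \<Otimes>\<^sub>M L)" and E\<rho>: "E \<in> sets \<rho>" and E\<sigma>: "E \<in> sets \<sigma>"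
      unfolding sets_\<sigma> \<rho>(1) by auto
    have "emeasure \<sigma> (space \<sigma> - E) \<le> emeasure \<rho> (space \<rho> - E)"
      using \<sigma>_le[OF sets.compl_sets[OF E]] unfolding space_\<rho> space_\<sigma> .
    then have "1 - measure \<sigma> E \<le> 1 - measure \<rho> E"
      unfolding \<sigma>_em \<rho>.emeasure_eq_measure prob_space.prob_compl[OF ps E\<sigma>] \<rho>.prob_compl[OF E\<rho>]
      by (subst (asm) ennreal_le_iff) auto
    moreover have "measure \<sigma> E \<le> measure \<rho> E"
      using \<sigma>_le[OF E] unfolding \<sigma>_em \<rho>.emeasure_eq_measure
      by (subst (asm) ennreal_le_iff) auto
    ultimately show "emeasure \<sigma> E = emeasure \<rho> E"
      unfolding \<sigma>_em \<rho>.emeasure_eq_measure by simp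
  qed
  show ?thesis
  proof (intro exI[of _ g'] conjI allI ballI)
    show "(\<Sum>k. \<integral>\<^sup>+\<theta>. g' k \<theta> * F (V \<theta>, R k \<theta>) \<partial>P) = (\<integral>\<^sup>+z. F z \<partial>\<rho>)"
      if "F \<in> borel_measurable (N \<Otimes>\<^sub>M L)" for F
      using \<sigma>_int[OF that] unfolding \<open>\<sigma> = \<rho>\<close> .
  qed (simp_all add: g'_sum)
qed

section \<open>The back and forth construction\<close>

abbreviation lvl :: "nat \<Rightarrow> nat list measure" where
  "lvl n \<equiv> count_space {ks. length ks = n}"

text \<open>
  The joint law of the sample point and of the list of the first \<open>n\<close> chosen indices, where \<open>p ks \<omega>\<close>
  is the conditional probability of the list \<open>ks\<close> given \<open>\<omega>\<close>.
\<close>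

definition history_measure :: "'a measure \<Rightarrow> (nat list \<Rightarrow> 'a \<Rightarrow> ennreal) \<Rightarrow> nat \<Rightarrow> (nat list \<times> 'a) measure" where
  "history_measure M p n = density (lvl n \<Otimes>\<^sub>M M) (\<lambda>(ks, \<omega>). p ks \<omega>)"

definition prefix_law :: "'a measure \<Rightarrow> ('a \<Rightarrow> nat \<Rightarrow> real) \<Rightarrow> (nat list \<Rightarrow> 'a \<Rightarrow> ennreal) \<Rightarrow> nat \<Rightarrow> (nat \<Rightarrow> real) measure" where
  "prefix_law M Y p n = distr (history_measure M p n) seqs (\<lambda>(ks, \<omega>). prefix_seq (Y \<omega>) ks)"

lemma nn_integral_lvl_Suc:
  "(\<integral>\<^sup>+ks. f ks \<partial>lvl (Suc n)) = (\<integral>\<^sup>+ks. (\<Sum>k. f (ks @ [k])) \<partial>lvl n)"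
proof -
  have "(\<integral>\<^sup>+ks. f ks \<partial>lvl (Suc n)) = (\<integral>\<^sup>+z. f (fst z @ [snd z]) \<partial>count_space ({ks. length ks = n} \<times> UNIV))"
  proof (rule nn_integral_bij_count_space[symmetric])
    show "bij_betw (\<lambda>z. fst z @ [snd z]) ({ks. length ks = n} \<times> UNIV) {ks :: nat list. length ks = Suc n}"
    proof (rule bij_betwI[where g = "\<lambda>ks. (butlast ks, last ks)"])
      show "(\<lambda>ks. (butlast ks, last ks)) \<in> {ks :: nat list. length ks = Suc n} \<rightarrow> {ks. length ks = n} \<times> UNIV" by auto
      show "fst (butlast ks, last ks) @ [snd (butlast ks, last ks)] = ks" if "ks \<in> {ks. length ks = Suc n}" for ks :: "nat list"
        using that by (cases ks rule: rev_cases) auto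
    qed auto
  qed
  also have "count_space ({ks :: nat list. length ks = n} \<times> UNIV) = lvl n \<Otimes>\<^sub>M count_space (UNIV :: nat set)"
    by (rule pair_measure_countable[symmetric]) auto
  also have "(\<integral>\<^sup>+z. f (fst z @ [snd z]) \<partial>(lvl n \<Otimes>\<^sub>M count_space (UNIV :: nat set))) = (\<integral>\<^sup>+ks. \<integral>\<^sup>+k. f (ks @ [k]) \<partial>count_space UNIV \<partial>lvl n)"
    by (subst sigma_finite_measure.nn_integral_fst[symmetric])
       (auto intro: sigma_finite_measure_count_space_countable simp: pair_measure_countable)
  finally show ?thesis by (simp add: nn_integral_count_space_nat)
qed

lemma measurable_lvl_pair:
  assumes "\<And>ks. length ks = n \<Longrightarrow> (\<lambda>\<omega>. f (ks, \<omega>)) \<in> M \<rightarrow>\<^sub>M N"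
  shows "f \<in> lvl n \<Otimes>\<^sub>M M \<rightarrow>\<^sub>M N"
  by (rule measurable_pair_measure_countable1) (use assms in auto)

lemma sigma_finite_lvl: "sigma_finite_measure (lvl n)"
  by (rule sigma_finite_measure_count_space_countable) simp

lemma nn_integral_history_measure:
  assumes M: "prob_space M" and p: "\<And>ks. length ks = n \<Longrightarrow> p ks \<in> borel_measurable M"
    and F: "F \<in> borel_measurable (lvl n \<Otimes>\<^sub>M M)"
  shows "(\<integral>\<^sup>+z. F z \<partial>history_measure M p n) = (\<integral>\<^sup>+ks. \<integral>\<^sup>+\<omega>. p ks \<omega> * F (ks, \<omega>) \<partial>M \<partial>lvl n)"
proof -
  interpret prob_space M by fact
  have m: "(\<lambda>(ks, \<omega>). p ks \<omega>) \<in> borel_measurable (lvl n \<Otimes>\<^sub>M M)"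
    by (rule measurable_lvl_pair) (simp add: p)
  have "(\<integral>\<^sup>+z. F z \<partial>history_measure M p n) = (\<integral>\<^sup>+z. (case z of (ks, \<omega>) \<Rightarrow> p ks \<omega>) * F z \<partial>(lvl n \<Otimes>\<^sub>M M))"
    unfolding history_measure_def by (rule nn_integral_density[OF m F])
  also have "\<dots> = (\<integral>\<^sup>+ks. \<integral>\<^sup>+\<omega>. p ks \<omega> * F (ks, \<omega>) \<partial>M \<partial>lvl n)"
    by (subst nn_integral_fst[symmetric]) (use m F in auto)
  finally show ?thesis .
qed

lemma sets_history_measure[measurable_cong, simp]: "sets (history_measure M p n) = sets (lvl n \<Otimes>\<^sub>M M)"
  by (simp add: history_measure_def)

lemma history_measure_cong:
  assumes q: "\<And>ks. length ks = n \<Longrightarrow> q ks \<in> borel_measurable M"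
    and eq: "\<And>ks. length ks = n \<Longrightarrow> p ks = q ks"
  shows "history_measure M p n = history_measure M q n"
  unfolding history_measure_def
proof (rule density_cong)
  show "(\<lambda>(ks, \<omega>). p ks \<omega>) \<in> borel_measurable (lvl n \<Otimes>\<^sub>M M)" "(\<lambda>(ks, \<omega>). q ks \<omega>) \<in> borel_measurable (lvl n \<Otimes>\<^sub>M M)"
    by (rule measurable_lvl_pair, simp add: q eq)+
  show "AE z in lvl n \<Otimes>\<^sub>M M. (case z of (ks, \<omega>) \<Rightarrow> p ks \<omega>) = (case z of (ks, \<omega>) \<Rightarrow> q ks \<omega>)"
    by (rule AE_I2) (auto simp: space_pair_measure eq)
qed

lemma AE_history_measure:
  assumes M: "prob_space M" and p: "\<And>ks. length ks = n \<Longrightarrow> p ks \<in> borel_measurable M"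
    and Q: "\<And>ks. length ks = n \<Longrightarrow> AE \<omega> in M. Q (ks, \<omega>)"
  shows "AE z in history_measure M p n. Q z"
proof -
  interpret prob_space M by fact
  have "\<forall>ks. \<exists>N. N \<in> null_sets M \<and> (length ks = n \<longrightarrow> (\<forall>\<omega>\<in>space M - N. Q (ks, \<omega>)))"
  proof
    fix ks
    show "\<exists>N. N \<in> null_sets M \<and> (length ks = n \<longrightarrow> (\<forall>\<omega>\<in>space M - N. Q (ks, \<omega>)))"
    proof (cases "length ks = n")
      case True
      from Q[OF True] show ?thesis
      proof (rule AE_E3)
        fix N assume "\<And>\<omega>. \<omega> \<in> space M - N \<Longrightarrow> Q (ks, \<omega>)" and "N \<in> null_sets M"
        then show ?thesis by (intro exI[of _ N]) simp
      qed
    next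
      case False
      then show ?thesis by (intro exI[of _ "{}"]) simp
    qed
  qed
  from choice[OF this] obtain N where
    N': "\<forall>ks. N ks \<in> null_sets M \<and> (length ks = n \<longrightarrow> (\<forall>\<omega>\<in>space M - N ks. Q (ks, \<omega>)))" ..
  have N: "N ks \<in> null_sets M" "length ks = n \<Longrightarrow> \<omega> \<in> space M - N ks \<Longrightarrow> Q (ks, \<omega>)" for ks \<omega>
    using N' by simp_all
  have m: "(\<lambda>(ks, \<omega>). p ks \<omega>) \<in> borel_measurable (lvl n \<Otimes>\<^sub>M M)"
    by (rule measurable_lvl_pair) (simp add: p)
  have "AE z in lvl n \<Otimes>\<^sub>M M. snd z \<notin> N (fst z)"
  proof (rule pair_sigma_finite.AE_pair_measure)
    show "pair_sigma_finite (lvl n) M"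
      by (intro pair_sigma_finite.intro sigma_finite_lvl) unfold_locales
    have "Measurable.pred (lvl n \<Otimes>\<^sub>M M) (\<lambda>z. snd z \<notin> N (fst z))"
    proof (rule measurable_lvl_pair)
      fix ks have [measurable]: "N ks \<in> sets M" using N by auto
      show "Measurable.pred M (\<lambda>\<omega>. snd (ks, \<omega>) \<notin> N (fst (ks, \<omega>)))" unfolding fst_conv snd_conv by measurable
    qed
    then show "{z \<in> space (lvl n \<Otimes>\<^sub>M M). snd z \<notin> N (fst z)} \<in> sets (lvl n \<Otimes>\<^sub>M M)" by (rule predE)
    show "AE ks in lvl n. AE \<omega> in M. snd (ks, \<omega>) \<notin> N (fst (ks, \<omega>))"
      unfolding fst_conv snd_conv by (intro AE_I2 AE_not_in N)
  qed
  then have "AE z in lvl n \<Otimes>\<^sub>M M. Q z"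
    using AE_space
  proof eventually_elim
    case (elim z)
    then show ?case using N(2)[of "fst z" "snd z"] by (auto simp: space_pair_measure)
  qed
  then show ?thesis unfolding history_measure_def by (subst AE_density[OF m]) auto
qed

definition fresh :: "nat list \<Rightarrow> nat" where
  "fresh ks = (LEAST k. k \<notin> set ks)"

lemma fresh_notin: "fresh ks \<notin> set ks"
  unfolding fresh_def by (rule LeastI_ex) (meson List.finite_set ex_new_if_finite infinite_UNIV_nat)

lemma fresh_le: "k \<notin> set ks \<Longrightarrow> fresh ks \<le> k"
  unfolding fresh_def by (rule Least_le)

text \<open>
  The weights of lists after a deterministic move: a list of length \<open>n\<close> passes all its weight on to
  its extension by the least unused index.
\<close>

definition follow :: "(nat list \<Rightarrow> 'a \<Rightarrow> ennreal) \<Rightarrow> nat list \<Rightarrow> 'a \<Rightarrow> ennreal" where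
  "follow p ks \<omega> = (if last ks = fresh (butlast ks) then p (butlast ks) \<omega> else 0)"

text \<open>
  The state of the back and forth construction after \<open>n\<close> moves.
\<close>

definition coupled where
  "coupled M Y M' Y' n p p' \<longleftrightarrow>
    (\<forall>ks. length ks = n \<longrightarrow> p ks \<in> borel_measurable M \<and> p' ks \<in> borel_measurable M') \<and>
    prob_space (history_measure M p n) \<and> prob_space (history_measure M' p' n) \<and> prefix_law M Y p n = prefix_law M' Y' p' n"

definition extends :: "nat \<Rightarrow> (nat list \<Rightarrow> 'a \<Rightarrow> ennreal) \<Rightarrow> (nat list \<Rightarrow> 'a \<Rightarrow> ennreal) \<Rightarrow> bool" where
  "extends n p q \<longleftrightarrow> (\<forall>ks \<omega>. length ks = n \<longrightarrow> (\<Sum>k. q (ks @ [k]) \<omega>) = p ks \<omega>)"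

lemma suminf_only_ennreal: "(\<Sum>k. if k = (a::nat) then (c::ennreal) else 0) = c"
proof -
  have "(\<Sum>k. if k = a then c else 0) = (\<Sum>k\<in>{a}. if k = a then c else 0)"
    by (rule suminf_finite) auto
  then show ?thesis by simp
qed

lemma extends_follow: "extends n p (follow p)"
proof -
  have "follow p (ks @ [k]) \<omega> = (if k = fresh ks then p ks \<omega> else 0)" for ks k \<omega>
    by (simp add: follow_def)
  then show ?thesis by (simp add: extends_def suminf_only_ennreal)
qed

lemma prefix_seq_snoc: "prefix_seq y (ks @ [k]) = (prefix_seq y ks)(length ks := y k)"
  by (auto simp: prefix_seq_def fun_eq_iff nth_append)

lemma prob_space_history_measure_Suc:
  assumes M: "prob_space M" and p: "\<And>ks. length ks = n \<Longrightarrow> p ks \<in> borel_measurable M"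
    and q: "\<And>ks. length ks = Suc n \<Longrightarrow> q ks \<in> borel_measurable M"
    and P: "prob_space (history_measure M p n)" and ext: "extends n p q"
  shows "prob_space (history_measure M q (Suc n))"
proof (rule prob_spaceI)
  have "emeasure (history_measure M q (Suc n)) (space (history_measure M q (Suc n))) = (\<integral>\<^sup>+z. 1 \<partial>history_measure M q (Suc n))" by simp
  also have "\<dots> = (\<integral>\<^sup>+ks. \<integral>\<^sup>+\<omega>. q ks \<omega> * 1 \<partial>M \<partial>lvl (Suc n))"
    by (rule nn_integral_history_measure[OF M q]) auto
  also have "\<dots> = (\<integral>\<^sup>+ks. (\<Sum>k. \<integral>\<^sup>+\<omega>. q (ks @ [k]) \<omega> * 1 \<partial>M) \<partial>lvl n)"
    by (rule nn_integral_lvl_Suc)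
  also have "\<dots> = (\<integral>\<^sup>+ks. \<integral>\<^sup>+\<omega>. p ks \<omega> * 1 \<partial>M \<partial>lvl n)"
  proof (rule nn_integral_cong)
    fix ks :: "nat list" assume ks: "ks \<in> space (lvl n)"
    have "(\<Sum>k. \<integral>\<^sup>+\<omega>. q (ks @ [k]) \<omega> * 1 \<partial>M) = (\<integral>\<^sup>+\<omega>. (\<Sum>k. q (ks @ [k]) \<omega> * 1) \<partial>M)"
      by (rule nn_integral_suminf[symmetric]) (use ks q in auto)
    also have "\<dots> = (\<integral>\<^sup>+\<omega>. p ks \<omega> * 1 \<partial>M)"
      using ext ks by (intro nn_integral_cong) (simp add: extends_def)
    finally show "(\<Sum>k. \<integral>\<^sup>+\<omega>. q (ks @ [k]) \<omega> * 1 \<partial>M) = (\<integral>\<^sup>+\<omega>. p ks \<omega> * 1 \<partial>M)" .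
  qed
  also have "\<dots> = (\<integral>\<^sup>+z. 1 \<partial>history_measure M p n)"
    by (rule nn_integral_history_measure[OF M p, symmetric]) auto
  also have "\<dots> = 1" using prob_space.emeasure_space_1[OF P] by simp
  finally show "emeasure (history_measure M q (Suc n)) (space (history_measure M q (Suc n))) = 1" .
qed

lemma measurable_history_prefix_seq:
  assumes "Y \<in> M \<rightarrow>\<^sub>M seqs"
  shows "(\<lambda>(ks, \<omega>). prefix_seq (Y \<omega>) ks) \<in> lvl n \<Otimes>\<^sub>M M \<rightarrow>\<^sub>M seqs"
proof (rule measurable_lvl_pair)
  fix ks :: "nat list"
  show "(\<lambda>\<omega>. case (ks, \<omega>) of (ks, \<omega>) \<Rightarrow> prefix_seq (Y \<omega>) ks) \<in> M \<rightarrow>\<^sub>M seqs"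
    using measurable_compose[OF assms measurable_prefix_seq] by simp
qed

lemma emeasure_prefix_law:
  assumes M: "prob_space M" and p: "\<And>ks. length ks = n \<Longrightarrow> p ks \<in> borel_measurable M"
    and Y: "Y \<in> M \<rightarrow>\<^sub>M seqs" and A: "A \<in> sets seqs"
  shows "emeasure (prefix_law M Y p n) A = (\<integral>\<^sup>+ks. \<integral>\<^sup>+\<omega>. p ks \<omega> * indicator A (prefix_seq (Y \<omega>) ks) \<partial>M \<partial>lvl n)"
proof -
  note m = measurable_history_prefix_seq[OF Y, of n]
  have "emeasure (prefix_law M Y p n) A = (\<integral>\<^sup>+v. indicator A v \<partial>prefix_law M Y p n)"
    using A by (simp add: prefix_law_def)
  also have "\<dots> = (\<integral>\<^sup>+z. indicator A (case z of (ks, \<omega>) \<Rightarrow> prefix_seq (Y \<omega>) ks) \<partial>history_measure M p n)"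
    unfolding prefix_law_def by (rule nn_integral_distr) (use m A in auto)
  also have "\<dots> = (\<integral>\<^sup>+ks. \<integral>\<^sup>+\<omega>. p ks \<omega> * indicator A (case (ks, \<omega>) of (ks, \<omega>) \<Rightarrow> prefix_seq (Y \<omega>) ks) \<partial>M \<partial>lvl n)"
    by (rule nn_integral_history_measure[OF M p]) (use m A in auto)
  finally show ?thesis by simp
qed

lemma measurable_upd: "(\<lambda>z. (fst z)(n := snd z)) \<in> seqs \<Otimes>\<^sub>M borel \<rightarrow>\<^sub>M seqs"
proof (rule measurable_PiM_single')
  fix i :: nat
  show "(\<lambda>z. ((fst z)(n := snd z)) i) \<in> seqs \<Otimes>\<^sub>M borel \<rightarrow>\<^sub>M (borel :: real measure)"
    by (cases "i = n") simp_all
qed (auto simp: space_PiM)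

text \<open>
  One side moves deterministically, the other one imitates it: the law of the revealed point
  together with its predecessors is the target of a greedy selection on the other side. Genericity of
  the first enumeration makes the target absolutely continuous; genericity of the second one provides
  the two hypotheses on the candidates.
\<close>

lemma back_and_forth_step:
  fixes M :: "'a measure" and M' :: "'b measure"
  assumes M: "prob_space M" "prob_space M'" and gen: "generic M Y" "generic M' Y'"
    and c: "coupled M Y M' Y' n p p'"
  shows "\<exists>q'. coupled M Y M' Y' (Suc n) (follow p) q' \<and> extends n p' q'"
proof -
  interpret U: prob_space unif01 by (rule prob_space_unif01)
  have p: "\<And>ks. length ks = n \<Longrightarrow> p ks \<in> borel_measurable M" and p': "\<And>ks. length ks = n \<Longrightarrow> p' ks \<in> borel_measurable M'"
    and P: "prob_space (history_measure M p n)" and P': "prob_space (history_measure M' p' n)" and law: "prefix_law M Y p n = prefix_law M' Y' p' n"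
    using c unfolding coupled_def by simp_all
  have Y: "Y \<in> M \<rightarrow>\<^sub>M seqs" and Y': "Y' \<in> M' \<rightarrow>\<^sub>M seqs" using genericD(1)[OF gen(1)] genericD(1)[OF gen(2)] .
  have Yk: "(\<lambda>\<omega>. Y \<omega> k) \<in> borel_measurable M" and Yk': "(\<lambda>\<omega>. Y' \<omega> k) \<in> borel_measurable M'" for k
    using measurable_compose[OF Y measurable_component_singleton[of k]] measurable_compose[OF Y' measurable_component_singleton[of k]] by auto
  have sSU: "sets (seqs \<Otimes>\<^sub>M unif01) = sets (seqs \<Otimes>\<^sub>M (borel :: real measure))"
    by (rule sets_pair_measure_cong) simp_all
  let ?V = "\<lambda>(ks, \<omega>). prefix_seq (Y \<omega>) ks" and ?V' = "\<lambda>(ks, \<omega>). prefix_seq (Y' \<omega>) ks"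
  let ?\<nu> = "prefix_law M Y p n"
  define \<rho> where "\<rho> = distr (history_measure M p n) (seqs \<Otimes>\<^sub>M unif01) (\<lambda>z. (?V z, Y (snd z) (fresh (fst z))))"
  have Vm: "?V \<in> history_measure M p n \<rightarrow>\<^sub>M seqs" and Vm': "?V' \<in> history_measure M' p' n \<rightarrow>\<^sub>M seqs"
    using measurable_history_prefix_seq[OF Y] measurable_history_prefix_seq[OF Y'] unfolding measurable_cong_sets[OF sets_history_measure refl] by auto
  have Rm: "(\<lambda>z. Y (snd z) (fresh (fst z))) \<in> history_measure M p n \<rightarrow>\<^sub>M unif01"
    unfolding measurable_cong_sets[OF sets_history_measure refl] by (rule measurable_lvl_pair) (use Yk in \<open>simp add: measurable_def\<close>)
  have Rm': "(\<lambda>z. Y' (snd z) k) \<in> history_measure M' p' n \<rightarrow>\<^sub>M unif01" for k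
    unfolding measurable_cong_sets[OF sets_history_measure refl] by (rule measurable_lvl_pair) (use Yk' in \<open>simp add: measurable_def\<close>)
  have VR: "(\<lambda>z. (?V z, Y (snd z) (fresh (fst z)))) \<in> history_measure M p n \<rightarrow>\<^sub>M seqs \<Otimes>\<^sub>M unif01"
    by (rule measurable_Pair[OF Vm Rm])
  have "\<exists>g :: nat \<Rightarrow> nat list \<times> 'b \<Rightarrow> ennreal. (\<forall>k. g k \<in> borel_measurable (history_measure M' p' n)) \<and> (\<forall>z. (\<Sum>k. g k z) = 1) \<and>
    (\<forall>F\<in>borel_measurable (seqs \<Otimes>\<^sub>M unif01).
      (\<Sum>k. \<integral>\<^sup>+z. g k z * F (?V' z, Y' (snd z) k) \<partial>history_measure M' p' n) = (\<integral>\<^sup>+z. F z \<partial>\<rho>))"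
  proof (rule greedy_selection[where allowed = "\<lambda>k z. k \<notin> set (fst z)", OF P' prob_space_unif01 Vm' Rm'])
    fix k
    show "Measurable.pred (history_measure M' p' n) (\<lambda>z. k \<notin> set (fst z))"
      unfolding measurable_cong_sets[OF sets_history_measure refl] by (rule measurable_lvl_pair) simp
    fix D assume "D \<in> sets (seqs \<Otimes>\<^sub>M unif01)"
    then have D: "D \<in> sets (seqs \<Otimes>\<^sub>M borel)" by (simp only: sSU)
    show "AE z in history_measure M' p' n. k \<notin> set (fst z) \<longrightarrow> emeasure unif01 (Pair (?V' z) -` D) = 0 \<longrightarrow> (?V' z, Y' (snd z) k) \<notin> D"
    proof (rule AE_history_measure[OF M(2) p'])
      fix ks
      show "AE \<omega> in M'. k \<notin> set (fst (ks, \<omega>)) \<longrightarrow> emeasure unif01 (Pair (?V' (ks, \<omega>)) -` D) = 0 \<longrightarrow> (?V' (ks, \<omega>), Y' (snd (ks, \<omega>)) k) \<notin> D"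
        unfolding fst_conv snd_conv prod.case
      proof (cases "k \<in> set ks")
        case False
        then have "AE \<omega> in M'. emeasure unif01 (Pair (prefix_seq (Y' \<omega>) ks) -` D) = 0 \<longrightarrow> (prefix_seq (Y' \<omega>) ks, Y' \<omega> k) \<notin> D"
          by (rule genericD(2)[OF gen(2) D])
        then show "AE \<omega> in M'. k \<notin> set ks \<longrightarrow> emeasure unif01 (Pair (prefix_seq (Y' \<omega>) ks) -` D) = 0 \<longrightarrow> (prefix_seq (Y' \<omega>) ks, Y' \<omega> k) \<notin> D"
          by (rule eventually_mono) blast
      qed simp
    qed
    show "AE z in history_measure M' p' n. 0 < emeasure unif01 (Pair (?V' z) -` D) \<longrightarrow> (\<exists>k. k \<notin> set (fst z) \<and> (?V' z, Y' (snd z) k) \<in> D)"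
    proof (rule AE_history_measure[OF M(2) p'])
      fix ks
      show "AE \<omega> in M'. 0 < emeasure unif01 (Pair (?V' (ks, \<omega>)) -` D) \<longrightarrow> (\<exists>k. k \<notin> set (fst (ks, \<omega>)) \<and> (?V' (ks, \<omega>), Y' (snd (ks, \<omega>)) k) \<in> D)"
        unfolding fst_conv snd_conv prod.case by (rule genericD(3)[OF gen(2) D])
    qed
  next
    show "sets \<rho> = sets (seqs \<Otimes>\<^sub>M unif01)" by (simp add: \<rho>_def)
    have "distr \<rho> seqs fst = distr (history_measure M p n) seqs (fst \<circ> (\<lambda>z. (?V z, Y (snd z) (fresh (fst z)))))"
      unfolding \<rho>_def by (rule distr_distr[OF measurable_fst VR])
    also have "\<dots> = prefix_law M Y p n" by (simp add: prefix_law_def comp_def)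
    finally show "distr \<rho> seqs fst = distr (history_measure M' p' n) seqs ?V'" unfolding law unfolding prefix_law_def .
    show "absolutely_continuous (distr (history_measure M' p' n) seqs ?V' \<Otimes>\<^sub>M unif01) \<rho>"
      unfolding absolutely_continuous_def
    proof
      fix D assume D: "D \<in> null_sets (distr (history_measure M' p' n) seqs ?V' \<Otimes>\<^sub>M unif01)"
      have "distr (history_measure M' p' n) seqs ?V' = ?\<nu>" unfolding law unfolding prefix_law_def ..
      then have D\<nu>: "D \<in> null_sets (?\<nu> \<Otimes>\<^sub>M unif01)" using D by simp
      have s\<nu>: "sets ?\<nu> = sets seqs" by (simp add: prefix_law_def)
      have sN: "sets (?\<nu> \<Otimes>\<^sub>M unif01) = sets (seqs \<Otimes>\<^sub>M unif01)" by (rule sets_pair_measure_cong[OF s\<nu> refl])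
      from D\<nu> have D2: "D \<in> sets (?\<nu> \<Otimes>\<^sub>M unif01)" by (rule null_setsD2)
      from D2 have D1: "D \<in> sets (seqs \<Otimes>\<^sub>M unif01)" unfolding sN .
      from D1 have D3: "D \<in> sets (seqs \<Otimes>\<^sub>M borel)" unfolding sSU .
      have "(\<integral>\<^sup>+v. emeasure unif01 (Pair v -` D) \<partial>?\<nu>) = 0"
        using U.emeasure_pair_measure_alt[OF D2] D\<nu> by auto
      then have "AE v in ?\<nu>. emeasure unif01 (Pair v -` D) = 0"
        by (subst (asm) nn_integral_0_iff_AE) (use U.measurable_emeasure_Pair[OF D2] in auto)
      then have 1: "AE z in history_measure M p n. emeasure unif01 (Pair (?V z) -` D) = 0"
        unfolding prefix_law_def by (rule AE_distrD[OF Vm])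
      have 2: "AE z in history_measure M p n. emeasure unif01 (Pair (?V z) -` D) = 0 \<longrightarrow> (?V z, Y (snd z) (fresh (fst z))) \<notin> D"
      proof (rule AE_history_measure[OF M(1) p])
        fix ks
        show "AE \<omega> in M. emeasure unif01 (Pair (?V (ks, \<omega>)) -` D) = 0 \<longrightarrow> (?V (ks, \<omega>), Y (snd (ks, \<omega>)) (fresh (fst (ks, \<omega>)))) \<notin> D"
          unfolding fst_conv snd_conv prod.case by (rule genericD(2)[OF gen(1) D3 fresh_notin])
      qed
      from 1 2 have "AE z in history_measure M p n. (?V z, Y (snd z) (fresh (fst z))) \<notin> D" by eventually_elim blast
      then have "AE z in \<rho>. z \<notin> D"
        unfolding \<rho>_def
      proof (subst AE_distr_iff[OF VR])
        have "{x \<in> space (seqs \<Otimes>\<^sub>M unif01). x \<notin> D} = space (seqs \<Otimes>\<^sub>M unif01) - D" by auto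
        then show "{x \<in> space (seqs \<Otimes>\<^sub>M unif01). x \<notin> D} \<in> sets (seqs \<Otimes>\<^sub>M unif01)"
          by (simp only: sets.compl_sets[OF D1])
      qed
      then show "D \<in> null_sets \<rho>"
        by (subst AE_iff_null_sets) (use D1 in \<open>auto simp: \<rho>_def\<close>)
    qed
  qed
  then obtain g :: "nat \<Rightarrow> nat list \<times> 'b \<Rightarrow> ennreal" where G: "(\<forall>k. g k \<in> borel_measurable (history_measure M' p' n)) \<and> (\<forall>z. (\<Sum>k. g k z) = 1) \<and>
    (\<forall>F\<in>borel_measurable (seqs \<Otimes>\<^sub>M unif01).
      (\<Sum>k. \<integral>\<^sup>+z. g k z * F (?V' z, Y' (snd z) k) \<partial>history_measure M' p' n) = (\<integral>\<^sup>+z. F z \<partial>\<rho>))" ..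
  have gm: "g k \<in> borel_measurable (lvl n \<Otimes>\<^sub>M M')" for k
    using G[THEN conjunct1, THEN spec, of k] unfolding measurable_cong_sets[OF sets_history_measure refl] .
  note g1 = G[THEN conjunct2, THEN conjunct1, THEN spec]
  note gF = G[THEN conjunct2, THEN conjunct2, THEN bspec]
  define q' where "q' ks \<omega> = p' (butlast ks) \<omega> * g (last ks) (butlast ks, \<omega>)" for ks \<omega>
  have gm': "(\<lambda>\<omega>. g k (ks, \<omega>)) \<in> borel_measurable M'" if "length ks = n" for k ks
    using that by (intro measurable_compose[OF measurable_Pair1' gm]) simp
  have q'm: "q' ks \<in> borel_measurable M'" if "length ks = Suc n" for ks
    unfolding q'_def[abs_def] using that by (intro borel_measurable_times_ennreal p' gm') auto
  have fm: "follow p ks \<in> borel_measurable M" if "length ks = Suc n" for ks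
    unfolding follow_def[abs_def] using that p[of "butlast ks"] by simp
  have ext': "extends n p' q'"
    by (simp add: extends_def q'_def ennreal_suminf_cmult g1)
  have lawF: "emeasure (prefix_law M' Y' q' (Suc n)) A = emeasure (prefix_law M Y (follow p) (Suc n)) A" if A: "A \<in> sets seqs" for A
  proof -
    let ?F = "\<lambda>z. indicator A ((fst z)(n := snd z)) :: ennreal"
    have "?F \<in> borel_measurable (seqs \<Otimes>\<^sub>M borel)"
      by (rule measurable_compose[OF measurable_upd]) (use A in simp)
    then have Fm: "?F \<in> borel_measurable (seqs \<Otimes>\<^sub>M unif01)" unfolding measurable_cong_sets[OF sSU refl] .
    have VRk: "(\<lambda>z. (?V' z, Y' (snd z) k)) \<in> lvl n \<Otimes>\<^sub>M M' \<rightarrow>\<^sub>M seqs \<Otimes>\<^sub>M unif01" for k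
      using measurable_Pair[OF Vm' Rm'] unfolding measurable_cong_sets[OF sets_history_measure refl] .
    have "emeasure (prefix_law M' Y' q' (Suc n)) A = (\<integral>\<^sup>+ks. \<integral>\<^sup>+\<omega>. q' ks \<omega> * indicator A (prefix_seq (Y' \<omega>) ks) \<partial>M' \<partial>lvl (Suc n))"
      by (rule emeasure_prefix_law[OF M(2) q'm Y' A])
    also have "\<dots> = (\<integral>\<^sup>+ks. (\<Sum>k. \<integral>\<^sup>+\<omega>. q' (ks @ [k]) \<omega> * indicator A (prefix_seq (Y' \<omega>) (ks @ [k])) \<partial>M') \<partial>lvl n)"
      by (rule nn_integral_lvl_Suc)
    also have "\<dots> = (\<integral>\<^sup>+ks. (\<Sum>k. \<integral>\<^sup>+\<omega>. p' ks \<omega> * (g k (ks, \<omega>) * ?F (?V' (ks, \<omega>), Y' (snd (ks, \<omega>)) k)) \<partial>M') \<partial>lvl n)"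
      by (intro nn_integral_cong) (simp add: q'_def prefix_seq_snoc mult.assoc)
    also have "\<dots> = (\<Sum>k. \<integral>\<^sup>+ks. \<integral>\<^sup>+\<omega>. p' ks \<omega> * (g k (ks, \<omega>) * ?F (?V' (ks, \<omega>), Y' (snd (ks, \<omega>)) k)) \<partial>M' \<partial>lvl n)"
      by (rule nn_integral_suminf) simp
    also have "\<dots> = (\<Sum>k. \<integral>\<^sup>+z. g k z * ?F (?V' z, Y' (snd z) k) \<partial>history_measure M' p' n)"
    proof (intro suminf_cong)
      fix k
      have "(\<lambda>z. g k z * ?F (?V' z, Y' (snd z) k)) \<in> borel_measurable (lvl n \<Otimes>\<^sub>M M')"
        by (rule borel_measurable_times_ennreal[OF gm measurable_compose[OF VRk Fm]])
      from nn_integral_history_measure[OF M(2) p' this]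
      show "(\<integral>\<^sup>+ks. \<integral>\<^sup>+\<omega>. p' ks \<omega> * (g k (ks, \<omega>) * ?F (?V' (ks, \<omega>), Y' (snd (ks, \<omega>)) k)) \<partial>M' \<partial>lvl n) =
        (\<integral>\<^sup>+z. g k z * ?F (?V' z, Y' (snd z) k) \<partial>history_measure M' p' n)" by simp
    qed
    also have "\<dots> = (\<integral>\<^sup>+z. ?F z \<partial>\<rho>)" by (rule gF[OF Fm])
    also have "\<dots> = (\<integral>\<^sup>+z. ?F (?V z, Y (snd z) (fresh (fst z))) \<partial>history_measure M p n)"
      unfolding \<rho>_def by (rule nn_integral_distr[OF VR]) (use Fm in simp)
    also have "\<dots> = (\<integral>\<^sup>+ks. \<integral>\<^sup>+\<omega>. p ks \<omega> * ?F (?V (ks, \<omega>), Y (snd (ks, \<omega>)) (fresh (fst (ks, \<omega>)))) \<partial>M \<partial>lvl n)"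
      by (rule nn_integral_history_measure[OF M(1) p]) (use measurable_compose[OF VR Fm] in \<open>simp_all add: measurable_cong_sets[OF sets_history_measure refl]\<close>)
    also have "\<dots> = (\<integral>\<^sup>+ks. (\<Sum>k. \<integral>\<^sup>+\<omega>. follow p (ks @ [k]) \<omega> * indicator A (prefix_seq (Y \<omega>) (ks @ [k])) \<partial>M) \<partial>lvl n)"
    proof (rule nn_integral_cong)
      fix ks :: "nat list" assume ks: "ks \<in> space (lvl n)"
      have "(\<integral>\<^sup>+\<omega>. follow p (ks @ [k]) \<omega> * indicator A (prefix_seq (Y \<omega>) (ks @ [k])) \<partial>M) =
        (if k = fresh ks then \<integral>\<^sup>+\<omega>. p ks \<omega> * ?F (?V (ks, \<omega>), Y (snd (ks, \<omega>)) (fresh (fst (ks, \<omega>)))) \<partial>M else 0)" for k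
        using ks by (simp add: follow_def prefix_seq_snoc)
      then show "(\<integral>\<^sup>+\<omega>. p ks \<omega> * ?F (?V (ks, \<omega>), Y (snd (ks, \<omega>)) (fresh (fst (ks, \<omega>)))) \<partial>M) =
        (\<Sum>k. \<integral>\<^sup>+\<omega>. follow p (ks @ [k]) \<omega> * indicator A (prefix_seq (Y \<omega>) (ks @ [k])) \<partial>M)"
        by (simp only: suminf_only_ennreal)
    qed
    also have "\<dots> = (\<integral>\<^sup>+ks. \<integral>\<^sup>+\<omega>. follow p ks \<omega> * indicator A (prefix_seq (Y \<omega>) ks) \<partial>M \<partial>lvl (Suc n))"
      by (rule nn_integral_lvl_Suc[symmetric])
    also have "\<dots> = emeasure (prefix_law M Y (follow p) (Suc n)) A"
      by (rule emeasure_prefix_law[OF M(1) fm Y A, symmetric])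
    finally show ?thesis .
  qed
  have "prefix_law M Y (follow p) (Suc n) = prefix_law M' Y' q' (Suc n)"
    by (rule measure_eqI) (simp_all add: prefix_law_def lawF[unfolded prefix_law_def])
  then have "coupled M Y M' Y' (Suc n) (follow p) q'"
    unfolding coupled_def using q'm fm prob_space_history_measure_Suc[OF M(1) p fm P extends_follow] prob_space_history_measure_Suc[OF M(2) p' q'm P' ext']
    by (intro conjI allI impI) assumption+
  then show ?thesis using ext' by (intro exI[of _ q'] conjI)
qed

lemma coupled_sym: "coupled M Y M' Y' n p p' \<Longrightarrow> coupled M' Y' M Y n p' p"
  by (auto simp: coupled_def)

text \<open>
  The conditional law, given a sample point, of an infinite sequence of indices, described by the
  probabilities of its finite prefixes.
\<close>

definition choice_tree :: "'a measure \<Rightarrow> (nat list \<Rightarrow> 'a \<Rightarrow> ennreal) \<Rightarrow> bool" where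
  "choice_tree M p \<longleftrightarrow> (\<forall>ks. p ks \<in> borel_measurable M) \<and> (\<forall>\<omega>. p [] \<omega> = 1) \<and> (\<forall>ks \<omega>. (\<Sum>k. p (ks @ [k]) \<omega>) = p ks \<omega>)"

lemma coupled_0:
  assumes "prob_space M" "prob_space M'" "Y \<in> M \<rightarrow>\<^sub>M seqs" "Y' \<in> M' \<rightarrow>\<^sub>M seqs"
  shows "coupled M Y M' Y' 0 (\<lambda>_ _. 1) (\<lambda>_ _. 1)"
proof -
  have P: "prob_space (history_measure N (\<lambda>_ _. 1) 0)" if N: "prob_space N" for N :: "'c measure"
  proof (rule prob_spaceI)
    have "emeasure (history_measure N (\<lambda>_ _. 1) 0) (space (history_measure N (\<lambda>_ _. 1) 0)) = (\<integral>\<^sup>+z. 1 \<partial>history_measure N (\<lambda>_ _. 1) 0)" by simp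
    also have "\<dots> = (\<integral>\<^sup>+ks. \<integral>\<^sup>+\<omega>. 1 * 1 \<partial>N \<partial>lvl 0)"
      by (rule nn_integral_history_measure[OF N]) auto
    also have "\<dots> = 1"
      using prob_space.emeasure_space_1[OF N] by (simp add: emeasure_count_space)
    finally show "emeasure (history_measure N (\<lambda>_ _. 1) 0) (space (history_measure N (\<lambda>_ _. 1) 0)) = 1" .
  qed
  have L: "emeasure (prefix_law N Z (\<lambda>_ _. 1) 0) A = indicator A (\<lambda>_. 0)"
    if N: "prob_space N" and Z: "Z \<in> N \<rightarrow>\<^sub>M seqs" and A: "A \<in> sets seqs" for N :: "'c measure" and Z A
  proof -
    have "emeasure (prefix_law N Z (\<lambda>_ _. 1) 0) A = (\<integral>\<^sup>+ks. \<integral>\<^sup>+\<omega>. 1 * indicator A (prefix_seq (Z \<omega>) ks) \<partial>N \<partial>lvl 0)"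
      by (rule emeasure_prefix_law[OF N _ Z A]) simp
    also have "\<dots> = (\<integral>\<^sup>+ks. indicator A (\<lambda>_. 0) \<partial>lvl 0)"
      by (rule nn_integral_cong) (simp add: prefix_seq_def prob_space.emeasure_space_1[OF N])
    finally show ?thesis by (simp add: emeasure_count_space)
  qed
  have "prefix_law M Y (\<lambda>_ _. 1) 0 = prefix_law M' Y' (\<lambda>_ _. 1) 0"
  proof (rule measure_eqI)
    show "sets (prefix_law M Y (\<lambda>_ _. 1) 0) = sets (prefix_law M' Y' (\<lambda>_ _. 1) 0)" by (simp add: prefix_law_def)
    fix A assume "A \<in> sets (prefix_law M Y (\<lambda>_ _. 1) 0)"
    then have A: "A \<in> sets seqs" by (simp add: prefix_law_def)
    show "emeasure (prefix_law M Y (\<lambda>_ _. 1) 0) A = emeasure (prefix_law M' Y' (\<lambda>_ _. 1) 0) A"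
      unfolding L[OF assms(1,3) A] L[OF assms(2,4) A] ..
  qed
  then show ?thesis
    unfolding coupled_def using P[OF assms(1)] P[OF assms(2)] by simp
qed

text \<open>
  The first side reveals its least unused point at even moves, the second side at odd moves.
\<close>

lemma back_and_forth:
  fixes M :: "'a measure" and M' :: "'b measure"
  assumes M: "prob_space M" "prob_space M'" and gen: "generic M Y" "generic M' Y'"
  shows "\<exists>p p'. choice_tree M p \<and> choice_tree M' p' \<and> (\<forall>n. prefix_law M Y p n = prefix_law M' Y' p' n) \<and>
    (\<forall>ks k \<omega>. even (length ks) \<longrightarrow> k \<noteq> fresh ks \<longrightarrow> p (ks @ [k]) \<omega> = 0) \<and>
    (\<forall>ks k \<omega>. odd (length ks) \<longrightarrow> k \<noteq> fresh ks \<longrightarrow> p' (ks @ [k]) \<omega> = 0)"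
proof -
  let ?Q = "\<lambda>n s s'. extends n (fst s) (fst s') \<and> extends n (snd s) (snd s') \<and>
    (even n \<longrightarrow> fst s' = follow (fst s)) \<and> (odd n \<longrightarrow> snd s' = follow (snd s))"
  have "\<exists>s. \<forall>n. (coupled M Y M' Y' n (fst (s n)) (snd (s n)) \<and> (n = 0 \<longrightarrow> s n = (\<lambda>_ _. 1, \<lambda>_ _. 1))) \<and> ?Q n (s n) (s (Suc n))"
  proof (rule dependent_nat_choice)
    have "coupled M Y M' Y' 0 (\<lambda>_ _. 1) (\<lambda>_ _. 1)"
      using gen by (intro coupled_0 M genericD(1))
    then show "\<exists>s. coupled M Y M' Y' 0 (fst s) (snd s) \<and> (0 = 0 \<longrightarrow> s = (\<lambda>_ _. 1, \<lambda>_ _. 1))"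
      by (intro exI[of _ "(\<lambda>_ _. 1, \<lambda>_ _. 1)"]) simp
  next
    fix s :: "(nat list \<Rightarrow> 'a \<Rightarrow> ennreal) \<times> (nat list \<Rightarrow> 'b \<Rightarrow> ennreal)" and n :: nat
    assume "coupled M Y M' Y' n (fst s) (snd s) \<and> (n = 0 \<longrightarrow> s = (\<lambda>_ _. 1, \<lambda>_ _. 1))"
    then have c: "coupled M Y M' Y' n (fst s) (snd s)" by simp
    show "\<exists>s'. (coupled M Y M' Y' (Suc n) (fst s') (snd s') \<and> (Suc n = 0 \<longrightarrow> s' = (\<lambda>_ _. 1, \<lambda>_ _. 1))) \<and> ?Q n s s'"
    proof (cases "even n")
      case True
      from back_and_forth_step[OF M gen c]
      obtain q' where "coupled M Y M' Y' (Suc n) (follow (fst s)) q' \<and> extends n (snd s) q'" ..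
      then show ?thesis using True extends_follow by (intro exI[of _ "(follow (fst s), q')"]) simp
    next
      case False
      from back_and_forth_step[OF M(2,1) gen(2,1) coupled_sym[OF c]]
      obtain q where q: "coupled M' Y' M Y (Suc n) (follow (snd s)) q \<and> extends n (fst s) q" ..
      from q[THEN conjunct1] have "coupled M Y M' Y' (Suc n) q (follow (snd s))" by (rule coupled_sym)
      then show ?thesis using False extends_follow q[THEN conjunct2] by (intro exI[of _ "(q, follow (snd s))"]) simp
    qed
  qed
  then obtain s where S: "\<forall>n. (coupled M Y M' Y' n (fst (s n)) (snd (s n)) \<and> (n = 0 \<longrightarrow> s n = (\<lambda>_ _. 1, \<lambda>_ _. 1))) \<and> ?Q n (s n) (s (Suc n))" ..
  note c = S[THEN spec, THEN conjunct1, THEN conjunct1]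
  note s0 = S[THEN spec, of 0, THEN conjunct1, THEN conjunct2, THEN mp, OF refl]
  note Q = S[THEN spec, THEN conjunct2]
  define p p' where "p ks = fst (s (length ks)) ks" and "p' ks = snd (s (length ks)) ks" for ks
  have pm: "p ks \<in> borel_measurable M" "p' ks \<in> borel_measurable M'" for ks
    using c[of "length ks"] unfolding coupled_def p_def p'_def by simp_all
  have ps: "(\<Sum>k. p (ks @ [k]) \<omega>) = p ks \<omega>" for ks \<omega>
    using Q[of "length ks", THEN conjunct1] by (simp add: extends_def p_def)
  have ps': "(\<Sum>k. p' (ks @ [k]) \<omega>) = p' ks \<omega>" for ks \<omega>
    using Q[of "length ks", THEN conjunct2, THEN conjunct1] by (simp add: extends_def p'_def)
  have t: "choice_tree M p" "choice_tree M' p'" unfolding choice_tree_def using pm ps ps' by (simp_all add: p_def p'_def s0)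
  have laws: "prefix_law M Y p n = prefix_law M' Y' p' n" for n
  proof -
    have "history_measure M p n = history_measure M (fst (s n)) n" "history_measure M' p' n = history_measure M' (snd (s n)) n"
      by (rule history_measure_cong, use c[of n] in \<open>simp add: coupled_def\<close>, simp add: p_def)
        (rule history_measure_cong, use c[of n] in \<open>simp add: coupled_def\<close>, simp add: p'_def)
    then have "prefix_law M Y p n = prefix_law M Y (fst (s n)) n" "prefix_law M' Y' p' n = prefix_law M' Y' (snd (s n)) n"
      by (simp_all add: prefix_law_def)
    then show ?thesis using c[of n] by (simp add: coupled_def)
  qed
  have "p (ks @ [k]) \<omega> = 0" if "even (length ks)" "k \<noteq> fresh ks" for ks k \<omega>
    using Q[of "length ks", THEN conjunct2, THEN conjunct2, THEN conjunct1] that by (simp add: p_def follow_def)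
  moreover have "p' (ks @ [k]) \<omega> = 0" if "odd (length ks)" "k \<noteq> fresh ks" for ks k \<omega>
    using Q[of "length ks", THEN conjunct2, THEN conjunct2, THEN conjunct2] that by (simp add: p'_def follow_def)
  ultimately show ?thesis using t laws by (intro exI[of _ p] exI[of _ p'] conjI allI impI) simp_all
qed

section \<open>Randomised enumerations from trees of probabilities\<close>

text \<open>
  Every list \<open>ks\<close> gets a half-open interval of length \<open>w ks\<close>, of which this is the left end point;
  the intervals of the one-step extensions of \<open>ks\<close> partition that of \<open>ks\<close> from left to right.
\<close>

definition left_end :: "(nat list \<Rightarrow> real) \<Rightarrow> nat list \<Rightarrow> real" where
  "left_end w ks = (\<Sum>i<length ks. \<Sum>j<ks ! i. w (take i ks @ [j]))"

lemma left_end_Nil: "left_end w [] = 0" by (simp add: left_end_def)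

lemma left_end_snoc: "left_end w (ks @ [k]) = left_end w ks + (\<Sum>j<k. w (ks @ [j]))"
  by (simp add: left_end_def nth_append)

text \<open>
  For \<open>u\<close> in the unit interval, the list of length \<open>n\<close> whose interval contains \<open>u\<close>; for uniform \<open>u\<close> this is a sample of the first
  \<open>n\<close> indices.
\<close>

primrec index_path :: "(nat list \<Rightarrow> real) \<Rightarrow> real \<Rightarrow> nat \<Rightarrow> nat list" where
  "index_path w u 0 = []"
| "index_path w u (Suc n) = index_path w u n @ [LEAST k. u < left_end w (index_path w u n @ [k]) + w (index_path w u n @ [k])]"

lemma length_index_path[simp]: "length (index_path w u n) = n"
  by (induction n) auto

definition splitting :: "(nat list \<Rightarrow> real) \<Rightarrow> bool" where
  "splitting w \<longleftrightarrow> (\<forall>ks. 0 \<le> w ks) \<and> w [] = 1 \<and> (\<forall>ks. (\<lambda>k. w (ks @ [k])) sums w ks)"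

lemma left_end_step:
  assumes "splitting w"
  shows "left_end w ks \<le> left_end w (ks @ [k])" "left_end w (ks @ [k]) + w (ks @ [k]) \<le> left_end w ks + w ks"
proof -
  have nn: "0 \<le> w l" for l using assms by (simp add: splitting_def)
  have s: "(\<lambda>k. w (ks @ [k])) sums w ks" using assms by (simp add: splitting_def)
  show "left_end w ks \<le> left_end w (ks @ [k])" by (simp add: left_end_snoc sum_nonneg nn)
  have "(\<Sum>j<Suc k. w (ks @ [j])) \<le> (\<Sum>j. w (ks @ [j]))"
    using s nn by (intro sum_le_suminf) (auto simp: sums_iff)
  then show "left_end w (ks @ [k]) + w (ks @ [k]) \<le> left_end w ks + w ks"
    using s by (simp add: left_end_snoc sums_iff)
qed

lemma left_end_sibling:
  assumes "splitting w" "j < k"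
  shows "left_end w (ks @ [j]) + w (ks @ [j]) \<le> left_end w (ks @ [k])"
proof -
  have nn: "0 \<le> w l" for l using assms by (auto simp: splitting_def)
  have "(\<Sum>i<Suc j. w (ks @ [i])) \<le> (\<Sum>i<k. w (ks @ [i]))"
    using assms(2) nn by (intro sum_mono2) auto
  then show ?thesis by (simp add: left_end_snoc)
qed

lemma left_end_bounds:
  assumes "splitting w"
  shows "0 \<le> left_end w ks \<and> left_end w ks + w ks \<le> 1"
proof (induction ks rule: rev_induct)
  case Nil then show ?case using assms by (simp add: left_end_Nil splitting_def)
next
  case (snoc k ks)
  then show ?case using left_end_step[OF assms, of ks k] by linarith
qed

lemma index_path_in_interval:
  assumes w: "splitting w" and u: "0 \<le> u" "u < 1"
  shows "left_end w (index_path w u n) \<le> u \<and> u < left_end w (index_path w u n) + w (index_path w u n)"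
proof (induction n)
  case 0 then show ?case using w u by (simp add: left_end_Nil splitting_def)
next
  case (Suc n)
  let ?ks = "index_path w u n"
  let ?Q = "\<lambda>k. u < left_end w (?ks @ [k]) + w (?ks @ [k])"
  define k where "k = (LEAST k. ?Q k)"
  have "(\<lambda>n. \<Sum>j<n. w (?ks @ [j])) \<longlonglongrightarrow> w ?ks" using w by (auto simp: splitting_def sums_def)
  moreover have "u - left_end w ?ks < w ?ks" using Suc by simp
  ultimately have "eventually (\<lambda>n. u - left_end w ?ks < (\<Sum>j<n. w (?ks @ [j]))) sequentially" by (rule order_tendstoD(1))
  then obtain m where m: "u - left_end w ?ks < (\<Sum>j<m. w (?ks @ [j]))" by (auto simp: eventually_sequentially)
  moreover have "0 \<le> u - left_end w ?ks" using Suc by simp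
  ultimately have "m \<noteq> 0" by (intro notI) simp
  then obtain m' where "m = Suc m'" by (cases m) auto
  then have "?Q m'" using m by (simp add: left_end_snoc)
  then have Qk: "?Q k" unfolding k_def by (rule LeastI)
  have "left_end w (?ks @ [k]) \<le> u"
  proof (cases k)
    case 0 then show ?thesis using Suc by (simp add: left_end_snoc)
  next
    case (Suc k')
    then have "\<not> ?Q k'" unfolding k_def by (intro not_less_Least) simp
    then show ?thesis using Suc by (simp add: left_end_snoc)
  qed
  then show ?case using Qk by (simp add: k_def)
qed

lemma index_path_eq_iff:
  assumes w: "splitting w" and u: "0 \<le> u" "u < 1"
  shows "index_path w u (length ks) = ks \<longleftrightarrow> left_end w ks \<le> u \<and> u < left_end w ks + w ks"
proof
  assume "index_path w u (length ks) = ks"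
  then show "left_end w ks \<le> u \<and> u < left_end w ks + w ks" using index_path_in_interval[OF w u, of "length ks"] by simp
next
  show "left_end w ks \<le> u \<and> u < left_end w ks + w ks \<Longrightarrow> index_path w u (length ks) = ks"
  proof (induction ks rule: rev_induct)
    case (snoc k ks)
    have "index_path w u (length ks) = ks" using snoc left_end_step[OF w, of ks k] by linarith
    moreover have "(LEAST k. u < left_end w (ks @ [k]) + w (ks @ [k])) = k"
    proof (rule Least_equality)
      show "u < left_end w (ks @ [k]) + w (ks @ [k])" using snoc by simp
      show "k \<le> j" if "u < left_end w (ks @ [j]) + w (ks @ [j])" for j
        using that snoc.prems left_end_sibling[OF w, of j k ks] by (cases "k \<le> j") auto
    qed
    ultimately show ?case by simp
  qed simp
qed

definition nth_index :: "(nat list \<Rightarrow> real) \<Rightarrow> real \<Rightarrow> nat \<Rightarrow> nat" where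
  "nth_index w u n = last (index_path w u (Suc n))"

lemma index_path_Suc: "index_path w u (Suc n) = index_path w u n @ [nth_index w u n]"
  by (simp add: nth_index_def)

lemma index_path_nth: "i < n \<Longrightarrow> index_path w u n ! i = nth_index w u i"
proof (induction n)
  case (Suc n)
  then show ?case unfolding index_path_Suc by (cases "i = n") (auto simp: nth_append)
qed simp

lemma set_index_path: "set (index_path w u n) = nth_index w u ` {..<n}"
  by (induction n) (auto simp del: index_path.simps simp: index_path_Suc lessThan_Suc index_path.simps(1))

text \<open>
  An index that is never used would bound the least unused index from above at all times, but
  infinitely many times the least unused index is the next one to be used, and these are distinct.
\<close>

lemma nth_index_surj:
  assumes w: "splitting w" and u: "0 \<le> u" "u < 1"
    and z: "\<And>ks k. even (length ks) = b \<Longrightarrow> k \<noteq> fresh ks \<Longrightarrow> w (ks @ [k]) = 0"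
  shows "range (nth_index w u) = UNIV"
proof -
  have fr: "nth_index w u n = fresh (index_path w u n)" if "even n = b" for n
  proof (rule ccontr)
    assume "nth_index w u n \<noteq> fresh (index_path w u n)"
    then have "w (index_path w u (Suc n)) = 0" unfolding index_path_Suc using that by (intro z) simp_all
    then show False using index_path_in_interval[OF w u, of "Suc n"] by linarith
  qed
  have "k \<in> range (nth_index w u)" for k
  proof (rule ccontr)
    assume k: "k \<notin> range (nth_index w u)"
    \<comment> \<open>The moves at which the least unused index is taken.\<close>
    define N where "N j = nth_index w u (2 * j + (if b then 0 else 1))" for j
    have N: "N j = fresh (index_path w u (2 * j + (if b then 0 else 1)))" for j unfolding N_def by (rule fr) simp
    have "N j \<le> k" for j unfolding N by (rule fresh_le) (use k in \<open>auto simp: set_index_path\<close>)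
    then have "range N \<subseteq> {..k}" by (simp add: image_subset_iff)
    then have "finite (range N)" by (rule finite_subset) simp
    moreover have "inj N"
    proof (rule linorder_injI)
      fix i j :: nat assume "i < j"
      have "N j \<notin> set (index_path w u (2 * j + (if b then 0 else 1)))" unfolding N by (rule fresh_notin)
      moreover have "N i \<in> set (index_path w u (2 * j + (if b then 0 else 1)))"
        unfolding set_index_path N_def by (rule imageI) (use \<open>i < j\<close> in auto)
      ultimately show "N i \<noteq> N j" by (intro notI) simp
    qed
    ultimately show False using finite_imageD[of N UNIV] by simp
  qed
  then show ?thesis by auto
qed

definition real_weight :: "(nat list \<Rightarrow> 'a \<Rightarrow> ennreal) \<Rightarrow> 'a \<Rightarrow> nat list \<Rightarrow> real" where
  "real_weight p \<omega> ks = enn2real (p ks \<omega>)"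

lemma choice_tree_le_1:
  assumes "choice_tree M p" shows "p ks \<omega> \<le> 1"
proof (induction ks rule: rev_induct)
  case Nil then show ?case using assms by (simp add: choice_tree_def)
next
  case (snoc k ks)
  have "p (ks @ [k]) \<omega> = (\<Sum>j\<in>{k}. p (ks @ [j]) \<omega>)" by simp
  also have "\<dots> \<le> (\<Sum>j. p (ks @ [j]) \<omega>)" by (rule sum_le_suminf) (auto intro: summableI)
  also have "\<dots> = p ks \<omega>" using assms by (simp add: choice_tree_def)
  finally show ?case using snoc by simp
qed

lemma ennreal_real_weight: "choice_tree M p \<Longrightarrow> ennreal (real_weight p \<omega> ks) = p ks \<omega>"
  unfolding real_weight_def by (rule ennreal_enn2real, rule le_less_trans[OF choice_tree_le_1]) simp_all

lemma splitting_real_weight: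
  assumes t: "choice_tree M p" shows "splitting (real_weight p \<omega>)"
  unfolding splitting_def
proof (intro conjI allI)
  show "real_weight p \<omega> [] = 1" using t by (simp add: real_weight_def choice_tree_def)
  show nn: "0 \<le> real_weight p \<omega> ks" for ks by (simp add: real_weight_def)
  fix ks
  have "(\<Sum>k. ennreal (real_weight p \<omega> (ks @ [k]))) = ennreal (real_weight p \<omega> ks)"
    unfolding ennreal_real_weight[OF t] using t by (simp add: choice_tree_def)
  moreover have "(\<lambda>k. ennreal (real_weight p \<omega> (ks @ [k]))) sums (\<Sum>k. ennreal (real_weight p \<omega> (ks @ [k])))"
    by (rule summable_sums) (rule summableI)
  ultimately have "(\<lambda>k. ennreal (real_weight p \<omega> (ks @ [k]))) sums ennreal (real_weight p \<omega> ks)" by simp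
  then show "(\<lambda>k. real_weight p \<omega> (ks @ [k])) sums real_weight p \<omega> ks"
    by (subst (asm) sums_ennreal) (auto simp: real_weight_def)
qed

definition random_enum :: "(nat list \<Rightarrow> 'a \<Rightarrow> ennreal) \<Rightarrow> ('a \<Rightarrow> nat \<Rightarrow> real) \<Rightarrow> 'a \<times> real \<Rightarrow> nat \<Rightarrow> real" where
  "random_enum p Y z i = Y (fst z) (nth_index (real_weight p (fst z)) (snd z) i)"

lemma measurable_index_path:
  assumes t: "choice_tree M p"
  shows "(\<lambda>z. index_path (real_weight p (fst z)) (snd z) n) \<in> M \<Otimes>\<^sub>M unif01 \<rightarrow>\<^sub>M count_space UNIV"
proof (induction n)
  case (Suc n)
  have rwm: "(\<lambda>z. real_weight p (fst z) ks) \<in> borel_measurable (M \<Otimes>\<^sub>M unif01)" for ks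
  proof -
    have [measurable]: "p ks \<in> borel_measurable M" using t by (simp add: choice_tree_def)
    show ?thesis unfolding real_weight_def by measurable
  qed
  have lom: "(\<lambda>z. left_end (real_weight p (fst z)) ks) \<in> borel_measurable (M \<Otimes>\<^sub>M unif01)" for ks
    unfolding left_end_def by (intro borel_measurable_sum rwm)
  have um: "(\<lambda>z. snd z) \<in> borel_measurable (M \<Otimes>\<^sub>M unif01)"
    by (rule measurable_compose[OF measurable_snd measurable_ident_sets]) simp
  have pr: "Measurable.pred (M \<Otimes>\<^sub>M unif01) (\<lambda>z. snd z < left_end (real_weight p (fst z)) (ks @ [k]) + real_weight p (fst z) (ks @ [k]))" for ks k
  proof -
    note [measurable] = um lom rwm
    show ?thesis by measurable
  qed
  have "(\<lambda>z. ks @ [LEAST k. snd z < left_end (real_weight p (fst z)) (ks @ [k]) + real_weight p (fst z) (ks @ [k])]) \<in> M \<Otimes>\<^sub>M unif01 \<rightarrow>\<^sub>M count_space UNIV" for ks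
    by (rule measurable_compose[OF measurable_Least[OF pr], of "\<lambda>k. ks @ [k]"]) simp
  from measurable_compose_countable[OF this Suc] show ?case unfolding index_path.simps .
qed simp

lemma emeasure_unif01_interval:
  assumes "0 \<le> a" "0 \<le> c" "a + c \<le> 1"
  shows "emeasure unif01 {u. 0 < u \<and> u < 1 \<and> a \<le> u \<and> u < a + c} = ennreal c"
proof -
  have "{u. 0 < u \<and> u < 1 \<and> a \<le> u \<and> u < a + c} = {u\<in>space borel. 0 < u \<and> u < 1 \<and> a \<le> u \<and> u < a + c}" by simp
  also have "\<dots> \<in> sets borel" by measurable
  finally have m: "{u. 0 < u \<and> u < 1 \<and> a \<le> u \<and> u < a + c} \<in> sets borel" .
  have "emeasure unif01 {u. 0 < u \<and> u < 1 \<and> a \<le> u \<and> u < a + c} = emeasure lborel ({u. 0 < u \<and> u < 1 \<and> a \<le> u \<and> u < a + c} \<inter> {0<..<1})"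
    by (rule emeasure_unif01[OF m])
  also have "\<dots> = emeasure lborel {a..<a + c}"
  proof (rule emeasure_eq_AE)
    have "AE u in lborel. u \<noteq> (0::real)" by (rule AE_lborel_singleton)
    then show "AE u in lborel. (u \<in> {u. 0 < u \<and> u < 1 \<and> a \<le> u \<and> u < a + c} \<inter> {0<..<1}) = (u \<in> {a..<a + c})"
      by eventually_elim (use assms in auto)
  qed (use m in auto)
  also have "\<dots> = ennreal c" using assms by simp
  finally show ?thesis .
qed

lemma emeasure_index_path_eq:
  assumes t: "choice_tree M p" and ks: "length ks = n" and \<omega>: "\<omega> \<in> space M"
  shows "emeasure unif01 {u. index_path (real_weight p \<omega>) u n = ks} = p ks \<omega>"
proof -
  let ?w = "real_weight p \<omega>"
  note w = splitting_real_weight[OF t, of \<omega>]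
  have m: "{u. index_path ?w u n = ks} \<in> sets unif01"
  proof -
    have "(\<lambda>u. index_path ?w u n) \<in> unif01 \<rightarrow>\<^sub>M count_space UNIV"
      using measurable_compose[OF measurable_Pair1'[OF \<omega>] measurable_index_path[OF t, of n]] by simp
    from measurable_sets[OF this, of "{ks}"] show ?thesis by (simp add: vimage_def)
  qed
  have "emeasure unif01 {u. index_path ?w u n = ks} = emeasure unif01 {u. 0 < u \<and> u < 1 \<and> left_end ?w ks \<le> u \<and> u < left_end ?w ks + ?w ks}"
  proof (rule emeasure_eq_AE)
    show "AE u in unif01. (u \<in> {u. index_path ?w u n = ks}) = (u \<in> {u. 0 < u \<and> u < 1 \<and> left_end ?w ks \<le> u \<and> u < left_end ?w ks + ?w ks})"
      using AE_unif01
    proof eventually_elim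
      case (elim u)
      then show ?case using index_path_eq_iff[OF w, of u ks] ks by auto
    qed
    have "{u. 0 < u \<and> u < 1 \<and> left_end ?w ks \<le> u \<and> u < left_end ?w ks + ?w ks} = {u\<in>space borel. 0 < u \<and> u < 1 \<and> left_end ?w ks \<le> u \<and> u < left_end ?w ks + ?w ks}" by simp
    also have "\<dots> \<in> sets borel" by measurable
    finally show "{u. 0 < u \<and> u < 1 \<and> left_end ?w ks \<le> u \<and> u < left_end ?w ks + ?w ks} \<in> sets unif01" by simp
  qed (rule m)
  also have "\<dots> = ennreal (?w ks)"
    by (rule emeasure_unif01_interval) (use left_end_bounds[OF w, of ks] w in \<open>auto simp: splitting_def\<close>)
  finally show ?thesis by (simp add: ennreal_real_weight[OF t])
qed

lemma measurable_random_enum: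
  assumes t: "choice_tree M p" and Y: "Y \<in> M \<rightarrow>\<^sub>M seqs"
  shows "random_enum p Y \<in> M \<Otimes>\<^sub>M unif01 \<rightarrow>\<^sub>M seqs"
proof (rule measurable_PiM_single')
  fix i
  have s: "(\<lambda>z. nth_index (real_weight p (fst z)) (snd z) i) \<in> M \<Otimes>\<^sub>M unif01 \<rightarrow>\<^sub>M count_space UNIV"
    unfolding nth_index_def by (rule measurable_compose[OF measurable_index_path[OF t, of "Suc i"]]) simp
  have "(\<lambda>z. Y (fst z) k) \<in> borel_measurable (M \<Otimes>\<^sub>M unif01)" for k
    by (rule measurable_compose[OF measurable_fst measurable_compose[OF Y measurable_component_singleton]]) simp
  from measurable_compose_countable[OF this s]
  show "(\<lambda>z. random_enum p Y z i) \<in> borel_measurable (M \<Otimes>\<^sub>M unif01)" by (simp add: random_enum_def)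
qed (auto simp: space_PiM)

text \<open>
  One uniform variable realises all finite-dimensional laws at once.
\<close>

lemma emeasure_random_enum_prefix:
  assumes M: "prob_space M" and t: "choice_tree M p" and Y: "Y \<in> M \<rightarrow>\<^sub>M seqs" and A: "A \<in> sets seqs"
  shows "emeasure (M \<Otimes>\<^sub>M unif01) {z \<in> space (M \<Otimes>\<^sub>M unif01). (\<lambda>i. if i < n then random_enum p Y z i else 0) \<in> A} = emeasure (prefix_law M Y p n) A"
proof -
  interpret M: prob_space M by fact
  interpret U: prob_space unif01 by (rule prob_space_unif01)
  let ?index_path = "\<lambda>z. index_path (real_weight p (fst z)) (snd z) n"
  define E where "E ks = {z \<in> space (M \<Otimes>\<^sub>M unif01). ?index_path z = ks \<and> prefix_seq (Y (fst z)) ks \<in> A}" for ks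
  have vm: "(\<lambda>z. prefix_seq (Y (fst z)) ks) \<in> M \<Otimes>\<^sub>M unif01 \<rightarrow>\<^sub>M seqs" for ks
    by (rule measurable_compose[OF measurable_fst measurable_compose[OF Y measurable_prefix_seq]])
  have E: "E ks \<in> sets (M \<Otimes>\<^sub>M unif01)" for ks
  proof -
    have "E ks = (?index_path -` {ks} \<inter> space (M \<Otimes>\<^sub>M unif01)) \<inter> ((\<lambda>z. prefix_seq (Y (fst z)) ks) -` A \<inter> space (M \<Otimes>\<^sub>M unif01))"
      by (auto simp: E_def)
    also have "\<dots> \<in> sets (M \<Otimes>\<^sub>M unif01)"
      by (intro sets.Int measurable_sets[OF measurable_index_path[OF t]] measurable_sets[OF vm A]) simp
    finally show ?thesis .
  qed
  have "{z \<in> space (M \<Otimes>\<^sub>M unif01). (\<lambda>i. if i < n then random_enum p Y z i else 0) \<in> A} = (\<Union>ks\<in>{ks. length ks = n}. E ks)"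
  proof -
    have "(\<lambda>i. if i < n then random_enum p Y z i else 0) = prefix_seq (Y (fst z)) (?index_path z)" for z
      by (auto simp: prefix_seq_def random_enum_def index_path_nth fun_eq_iff)
    then show ?thesis by (auto simp: E_def)
  qed
  then have "emeasure (M \<Otimes>\<^sub>M unif01) {z \<in> space (M \<Otimes>\<^sub>M unif01). (\<lambda>i. if i < n then random_enum p Y z i else 0) \<in> A}
    = emeasure (M \<Otimes>\<^sub>M unif01) (\<Union>ks\<in>{ks. length ks = n}. E ks)" by simp
  also have "\<dots> = (\<integral>\<^sup>+ks. emeasure (M \<Otimes>\<^sub>M unif01) (E ks) \<partial>lvl n)"
    by (rule emeasure_UN_countable) (use E in \<open>auto simp: disjoint_family_on_def E_def\<close>)
  also have "\<dots> = (\<integral>\<^sup>+ks. \<integral>\<^sup>+\<omega>. p ks \<omega> * indicator A (prefix_seq (Y \<omega>) ks) \<partial>M \<partial>lvl n)"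
  proof (rule nn_integral_cong)
    fix ks assume "ks \<in> space (lvl n)"
    then have ks: "length ks = n" by simp
    have "emeasure (M \<Otimes>\<^sub>M unif01) (E ks) = (\<integral>\<^sup>+\<omega>. emeasure unif01 (Pair \<omega> -` E ks) \<partial>M)"
      by (rule U.emeasure_pair_measure_alt[OF E])
    also have "\<dots> = (\<integral>\<^sup>+\<omega>. p ks \<omega> * indicator A (prefix_seq (Y \<omega>) ks) \<partial>M)"
    proof (rule nn_integral_cong)
      fix \<omega> assume \<omega>: "\<omega> \<in> space M"
      have "Pair \<omega> -` E ks = (if prefix_seq (Y \<omega>) ks \<in> A then {u. index_path (real_weight p \<omega>) u n = ks} else {})"
        using \<omega> by (auto simp: E_def space_pair_measure)
      then show "emeasure unif01 (Pair \<omega> -` E ks) = p ks \<omega> * indicator A (prefix_seq (Y \<omega>) ks)"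
        using emeasure_index_path_eq[OF t ks \<omega>] by (simp add: indicator_def)
    qed
    finally show "emeasure (M \<Otimes>\<^sub>M unif01) (E ks) = (\<integral>\<^sup>+\<omega>. p ks \<omega> * indicator A (prefix_seq (Y \<omega>) ks) \<partial>M)" .
  qed
  also have "\<dots> = emeasure (prefix_law M Y p n) A"
    by (rule emeasure_prefix_law[OF M _ Y A, symmetric]) (use t in \<open>simp add: choice_tree_def\<close>)
  finally show ?thesis .
qed

text \<open>
  Equality of the laws is a statement on finitely many coordinates, hence on prefixes.
\<close>

lemma common_law:
  fixes M :: "'a measure" and M' :: "'b measure"
  assumes M: "prob_space M" "prob_space M'" and gen: "generic M Y" "generic M' Y'"
  shows "\<exists>W W'. W \<in> M \<Otimes>\<^sub>M unif01 \<rightarrow>\<^sub>M seqs \<and> W' \<in> M' \<Otimes>\<^sub>M unif01 \<rightarrow>\<^sub>M seqs \<and>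
    distr (M \<Otimes>\<^sub>M unif01) seqs W = distr (M' \<Otimes>\<^sub>M unif01) seqs W' \<and>
    (AE z in M \<Otimes>\<^sub>M unif01. range (W z) = range (Y (fst z))) \<and>
    (AE z in M' \<Otimes>\<^sub>M unif01. range (W' z) = range (Y' (fst z)))"
proof -
  have Y: "Y \<in> M \<rightarrow>\<^sub>M seqs" and Y': "Y' \<in> M' \<rightarrow>\<^sub>M seqs" using genericD(1)[OF gen(1)] genericD(1)[OF gen(2)] .
  from back_and_forth[OF M gen] obtain p where "\<exists>p'. choice_tree M p \<and> choice_tree M' p' \<and> (\<forall>n. prefix_law M Y p n = prefix_law M' Y' p' n) \<and>
    (\<forall>ks k \<omega>. even (length ks) \<longrightarrow> k \<noteq> fresh ks \<longrightarrow> p (ks @ [k]) \<omega> = 0) \<and>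
    (\<forall>ks k \<omega>. odd (length ks) \<longrightarrow> k \<noteq> fresh ks \<longrightarrow> p' (ks @ [k]) \<omega> = 0)" ..
  then obtain p' where pp: "choice_tree M p \<and> choice_tree M' p' \<and> (\<forall>n. prefix_law M Y p n = prefix_law M' Y' p' n) \<and>
    (\<forall>ks k \<omega>. even (length ks) \<longrightarrow> k \<noteq> fresh ks \<longrightarrow> p (ks @ [k]) \<omega> = 0) \<and>
    (\<forall>ks k \<omega>. odd (length ks) \<longrightarrow> k \<noteq> fresh ks \<longrightarrow> p' (ks @ [k]) \<omega> = 0)" ..
  have t: "choice_tree M p" "choice_tree M' p'" using pp by simp_all
  have law: "prefix_law M Y p n = prefix_law M' Y' p' n" for n using pp by simp
  have z: "p (ks @ [k]) \<omega> = 0" if "even (length ks)" "k \<noteq> fresh ks" for ks k \<omega> using pp that by simp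
  have z': "p' (ks @ [k]) \<omega> = 0" if "odd (length ks)" "k \<noteq> fresh ks" for ks k \<omega> using pp that by simp
  let ?Q = "M \<Otimes>\<^sub>M unif01" and ?Q' = "M' \<Otimes>\<^sub>M unif01"
  have Q: "prob_space ?Q" "prob_space ?Q'"
    using M by (auto intro: prob_space_pair prob_space_unif01)
  note Wm = measurable_random_enum[OF t(1) Y] and Wm' = measurable_random_enum[OF t(2) Y']
  have "distr ?Q seqs (random_enum p Y) = distr ?Q' seqs (random_enum p' Y')"
  proof (rule measure_eqI_PiM_infinite)
    show "finite_measure (distr ?Q seqs (random_enum p Y))"
      by (rule prob_space.finite_measure[OF prob_space.prob_space_distr[OF Q(1) Wm]])
    fix A :: "nat \<Rightarrow> real set" and J :: "nat set" assume J: "finite J" and A: "\<And>i. i \<in> J \<Longrightarrow> A i \<in> sets borel"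
    obtain n where n: "J \<subseteq> {..<n}" using finite_nat_bounded[OF J] by blast
    let ?A = "prod_emb UNIV (\<lambda>i. borel) J (Pi\<^sub>E J A)"
    have Am: "?A \<in> sets seqs" using J A by (intro sets_PiM_I) auto
    have trunc: "(\<lambda>i. if i < n then w i else 0) \<in> ?A \<longleftrightarrow> w \<in> ?A" for w :: "nat \<Rightarrow> real"
    proof -
      have "v \<in> ?A \<longleftrightarrow> (\<forall>i\<in>J. v i \<in> A i)" for v :: "nat \<Rightarrow> real"
        by (simp add: prod_emb_def PiE_iff)
      then show ?thesis using n by auto
    qed
    have e: "emeasure (distr (N \<Otimes>\<^sub>M unif01) seqs (random_enum q Z)) ?A = emeasure (prefix_law N Z q n) ?A"
      if N: "prob_space N" "choice_tree N q" "Z \<in> N \<rightarrow>\<^sub>M seqs" for N :: "'c measure" and q Z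
    proof -
      have "emeasure (distr (N \<Otimes>\<^sub>M unif01) seqs (random_enum q Z)) ?A = emeasure (N \<Otimes>\<^sub>M unif01) (random_enum q Z -` ?A \<inter> space (N \<Otimes>\<^sub>M unif01))"
        by (rule emeasure_distr[OF measurable_random_enum[OF N(2,3)] Am])
      also have "random_enum q Z -` ?A \<inter> space (N \<Otimes>\<^sub>M unif01) = {z \<in> space (N \<Otimes>\<^sub>M unif01). (\<lambda>i. if i < n then random_enum q Z z i else 0) \<in> ?A}"
        unfolding trunc by auto
      finally show ?thesis by (simp only: emeasure_random_enum_prefix[OF N Am])
    qed
    show "emeasure (distr ?Q seqs (random_enum p Y)) ?A = emeasure (distr ?Q' seqs (random_enum p' Y')) ?A"
      unfolding e[OF M(1) t(1) Y] e[OF M(2) t(2) Y'] by (simp only: law)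
  qed (simp_all)
  moreover have r: "range (random_enum p Y (\<omega>, u)) = range (Y \<omega>)" if "0 < u" "u < 1" for \<omega> u
  proof -
    have "range (nth_index (real_weight p \<omega>) u) = UNIV"
      by (rule nth_index_surj[OF splitting_real_weight[OF t(1)], where b = True]) (use that z in \<open>auto simp: real_weight_def\<close>)
    moreover have "range (random_enum p Y (\<omega>, u)) = Y \<omega> ` range (nth_index (real_weight p \<omega>) u)"
      by (auto simp: random_enum_def)
    ultimately show ?thesis by simp
  qed
  moreover have r': "range (random_enum p' Y' (\<omega>, u)) = range (Y' \<omega>)" if "0 < u" "u < 1" for \<omega> u
  proof -
    have "range (nth_index (real_weight p' \<omega>) u) = UNIV"
      by (rule nth_index_surj[OF splitting_real_weight[OF t(2)], where b = False]) (use that z' in \<open>auto simp: real_weight_def\<close>)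
    moreover have "range (random_enum p' Y' (\<omega>, u)) = Y' \<omega> ` range (nth_index (real_weight p' \<omega>) u)"
      by (auto simp: random_enum_def)
    ultimately show ?thesis by simp
  qed
  moreover have "AE z in ?Q. range (random_enum p Y z) = range (Y (fst z))"
    using AE_pair_unif01[OF M(1)] by eventually_elim (simp add: r[of "snd z" "fst z" for z, simplified])
  moreover have "AE z in ?Q'. range (random_enum p' Y' z) = range (Y' (fst z))"
    using AE_pair_unif01[OF M(2)] by eventually_elim (simp add: r'[of "snd z" "fst z" for z, simplified])
  ultimately show ?thesis using Wm Wm'
    by (intro exI[of _ "random_enum p Y"] exI[of _ "random_enum p' Y'"] conjI) assumption+
qed

section \<open>Outsourcing the conditional law to an independent uniform variable\<close>

text \<open>
  Otherwise the difference would have positive integral over the set where the inequality fails.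
\<close>

lemma AE_le_of_set_integrals:
  fixes f h :: "'a \<Rightarrow> real"
  assumes [measurable]: "f \<in> borel_measurable \<nu>" "h \<in> borel_measurable \<nu>"
    and h0: "\<And>x. 0 \<le> h x"
    and fin: "(\<integral>\<^sup>+x. ennreal (h x) \<partial>\<nu>) < \<infinity>"
    and le: "\<And>A. A \<in> sets \<nu> \<Longrightarrow> (\<integral>\<^sup>+x. ennreal (f x) * indicator A x \<partial>\<nu>) \<le> (\<integral>\<^sup>+x. ennreal (h x) * indicator A x \<partial>\<nu>)"
  shows "AE x in \<nu>. f x \<le> h x"
proof -
  define A where "A = {x \<in> space \<nu>. h x < f x}"
  have A[measurable]: "A \<in> sets \<nu>" unfolding A_def by measurable
  have "(\<integral>\<^sup>+x. ennreal (h x) * indicator A x \<partial>\<nu>) + (\<integral>\<^sup>+x. ennreal (f x - h x) * indicator A x \<partial>\<nu>) =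
    (\<integral>\<^sup>+x. ennreal (h x) * indicator A x + ennreal (f x - h x) * indicator A x \<partial>\<nu>)"
    by (rule nn_integral_add[symmetric]) measurable
  also have "\<dots> = (\<integral>\<^sup>+x. ennreal (f x) * indicator A x \<partial>\<nu>)"
  proof (rule nn_integral_cong)
    fix x
    show "ennreal (h x) * indicator A x + ennreal (f x - h x) * indicator A x = ennreal (f x) * indicator A x"
    proof (cases "x \<in> A")
      case True
      then have "h x < f x" by (simp add: A_def)
      then have "ennreal (h x) + ennreal (f x - h x) = ennreal (f x)"
        using h0[of x] by (subst ennreal_plus[symmetric]) simp_all
      then show ?thesis using True by simp
    qed simp
  qed
  also have "\<dots> \<le> (\<integral>\<^sup>+x. ennreal (h x) * indicator A x \<partial>\<nu>) + 0"
    unfolding add_0_right by (rule le[OF A])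
  finally have "(\<integral>\<^sup>+x. ennreal (h x) * indicator A x \<partial>\<nu>) + (\<integral>\<^sup>+x. ennreal (f x - h x) * indicator A x \<partial>\<nu>) \<le> (\<integral>\<^sup>+x. ennreal (h x) * indicator A x \<partial>\<nu>) + 0" .
  moreover have "(\<integral>\<^sup>+x. ennreal (h x) * indicator A x \<partial>\<nu>) \<noteq> \<infinity>"
  proof -
    have "(\<integral>\<^sup>+x. ennreal (h x) * indicator A x \<partial>\<nu>) \<le> (\<integral>\<^sup>+x. ennreal (h x) \<partial>\<nu>)"
      by (intro nn_integral_mono) (simp add: indicator_def)
    then show ?thesis using fin by (metis infinity_ennreal_def neq_top_trans order_less_imp_not_eq)
  qed
  ultimately have "(\<integral>\<^sup>+x. ennreal (f x - h x) * indicator A x \<partial>\<nu>) = 0"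
    unfolding ennreal_add_left_cancel_le by simp
  then have "AE x in \<nu>. ennreal (f x - h x) * indicator A x = 0"
    by (subst (asm) nn_integral_0_iff_AE) measurable
  then show ?thesis using AE_space
  proof eventually_elim
    case (elim x)
    show ?case
    proof (rule ccontr)
      assume "\<not> f x \<le> h x"
      then have "x \<in> A" "0 < ennreal (f x - h x)" using elim(2) by (simp_all add: A_def)
      then show False using elim(1) by simp
    qed
  qed
qed

lemma pred_Bex_countable:
  assumes "countable X" "\<And>i. i \<in> X \<Longrightarrow> Measurable.pred M (P i)"
  shows "Measurable.pred M (\<lambda>x. \<exists>i\<in>X. P i x)"
proof -
  have "{x \<in> space M. \<exists>i\<in>X. P i x} = (\<Union>i\<in>X. {x \<in> space M. P i x})" by auto
  also have "\<dots> \<in> sets M" by (rule sets.countable_UN'[OF assms(1)]) (use assms(2) in \<open>auto simp: pred_def\<close>)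
  finally show ?thesis by (simp add: pred_def)
qed

lemma pred_Ball_countable:
  assumes "countable X" "\<And>i. i \<in> X \<Longrightarrow> Measurable.pred M (P i)"
  shows "Measurable.pred M (\<lambda>x. \<forall>i\<in>X. P i x)"
proof -
  have "Measurable.pred M (\<lambda>x. \<not> (\<exists>i\<in>X. \<not> P i x))"
    by (intro pred_intros_logic pred_Bex_countable assms)
  then show ?thesis by simp
qed

text \<open>
  Versions of the conditional distribution function of \<open>g\<close> given \<open>W\<close>, as Radon--Nikodym densities.
  Only rational arguments are used, so that monotonicity, which holds almost surely for each pair
  of arguments, can be enforced everywhere by redefining all of them on one null set.
\<close>

lemma conditional_cdf:
  fixes g :: "'a \<Rightarrow> real"
  assumes Q: "prob_space Q" and W[measurable]: "W \<in> Q \<rightarrow>\<^sub>M N" and g[measurable]: "g \<in> borel_measurable Q"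
    and bd: "\<And>\<omega>. \<omega> \<in> space Q \<Longrightarrow> lo \<le> g \<omega> \<and> g \<omega> \<le> hi"
  shows "\<exists>F :: real \<Rightarrow> 'w \<Rightarrow> real. (\<forall>q\<in>\<rat>. F q \<in> borel_measurable N \<and>
      (\<forall>w. 0 \<le> F q w \<and> F q w \<le> 1) \<and> (q < lo \<longrightarrow> (\<forall>w. F q w = 0)) \<and> (hi \<le> q \<longrightarrow> (\<forall>w. F q w = 1)) \<and>
      (\<forall>q'\<in>\<rat>. q \<le> q' \<longrightarrow> (\<forall>w. F q w \<le> F q' w)) \<and>
      (\<forall>A\<in>sets N. (\<integral>\<^sup>+w. ennreal (F q w) * indicator A w \<partial>distr Q N W) = emeasure Q {\<omega>\<in>space Q. W \<omega> \<in> A \<and> g \<omega> \<le> q}))"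
proof -
  interpret Q: prob_space Q by fact
  define \<nu> where "\<nu> = distr Q N W"
  have \<nu>: "prob_space \<nu>" unfolding \<nu>_def by (rule Q.prob_space_distr[OF W])
  have s\<nu>[measurable_cong]: "sets \<nu> = sets N" by (simp add: \<nu>_def)
  have sf\<nu>: "sigma_finite_measure \<nu>" by (rule prob_space_imp_sigma_finite[OF \<nu>])
  let ?e = "\<lambda>q A. emeasure Q {\<omega>\<in>space Q. W \<omega> \<in> A \<and> g \<omega> \<le> q}"
  have ex: "\<exists>f. f \<in> borel_measurable N \<and> (\<forall>w. 0 \<le> f w) \<and> (q < lo \<longrightarrow> (\<forall>w. f w = 0)) \<and> (hi \<le> q \<longrightarrow> (\<forall>w. f w = 1)) \<and>
    (\<forall>A\<in>sets N. (\<integral>\<^sup>+w. ennreal (f w) * indicator A w \<partial>\<nu>) = ?e q A)" for q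
  proof -
    have pre: "?e q A = 0" if "q < lo" for A
    proof -
      have "{\<omega>\<in>space Q. W \<omega> \<in> A \<and> g \<omega> \<le> q} = {}" using bd that by fastforce
      then show ?thesis by (simp only: emeasure_empty)
    qed
    have post: "?e q A = emeasure \<nu> A" if "hi \<le> q" "A \<in> sets N" for A
    proof -
      have "{\<omega>\<in>space Q. W \<omega> \<in> A \<and> g \<omega> \<le> q} = W -` A \<inter> space Q" using bd that(1) by fastforce
      then show ?thesis unfolding \<nu>_def emeasure_distr[OF W that(2)] by simp
    qed
    have mid: "\<exists>f. f \<in> borel_measurable N \<and> (\<forall>w. 0 \<le> f w) \<and> (\<forall>A\<in>sets N. (\<integral>\<^sup>+w. ennreal (f w) * indicator A w \<partial>\<nu>) = ?e q A)"
    proof -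
      define \<mu> where "\<mu> = distr (density Q (indicator {\<omega>\<in>space Q. g \<omega> \<le> q})) N W"
      have [measurable]: "{\<omega>\<in>space Q. g \<omega> \<le> q} \<in> sets Q" by measurable
      have \<mu>e: "emeasure \<mu> A = ?e q A" if [measurable]: "A \<in> sets N" for A
      proof -
        have "emeasure \<mu> A = emeasure (density Q (indicator {\<omega>\<in>space Q. g \<omega> \<le> q})) (W -` A \<inter> space Q)"
          unfolding \<mu>_def by (subst emeasure_distr) simp_all
        also have "\<dots> = (\<integral>\<^sup>+\<omega>. indicator {\<omega>\<in>space Q. g \<omega> \<le> q} \<omega> * indicator (W -` A \<inter> space Q) \<omega> \<partial>Q)"
          by (rule emeasure_density) measurable
        also have "\<dots> = (\<integral>\<^sup>+\<omega>. indicator {\<omega>\<in>space Q. W \<omega> \<in> A \<and> g \<omega> \<le> q} \<omega> \<partial>Q)"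
          by (intro nn_integral_cong) (auto split: split_indicator)
        also have "\<dots> = ?e q A" by (rule nn_integral_indicator) measurable
        finally show ?thesis .
      qed
      have s\<mu>: "sets \<mu> = sets \<nu>" by (simp add: \<mu>_def \<nu>_def)
      have "absolutely_continuous \<nu> \<mu>"
        unfolding absolutely_continuous_def
      proof
        fix A assume A: "A \<in> null_sets \<nu>"
        then have AN: "A \<in> sets N" using s\<nu> by auto
        have "emeasure \<mu> A \<le> emeasure Q (W -` A \<inter> space Q)"
          unfolding \<mu>e[OF AN] by (rule emeasure_mono) (use AN in auto)
        also have "\<dots> = emeasure \<nu> A" unfolding \<nu>_def by (rule emeasure_distr[OF W AN, symmetric])
        also have "\<dots> = 0" using A by auto
        finally show "A \<in> null_sets \<mu>" using AN by (intro null_setsI) (simp_all add: \<mu>_def)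
      qed
      moreover have "finite_measure \<mu>"
      proof (rule finite_measureI)
        have "space \<mu> = space N" by (simp add: \<mu>_def)
        then show "emeasure \<mu> (space \<mu>) \<noteq> \<infinity>" by (simp add: \<mu>e)
      qed
      ultimately have "\<exists>f\<in>borel_measurable \<nu>. (\<forall>x. 0 \<le> f x) \<and> \<mu> = density \<nu> (\<lambda>x. ennreal (f x))"
        by (intro real_density_exists[OF sf\<nu>] s\<mu>)
      then obtain f where f: "f \<in> borel_measurable \<nu>" "\<forall>x. 0 \<le> f x" "\<mu> = density \<nu> (\<lambda>x. ennreal (f x))" by (elim bexE conjE)
      have fN[measurable]: "f \<in> borel_measurable N" using f(1) unfolding measurable_cong_sets[OF s\<nu> refl] .
      have "(\<integral>\<^sup>+w. ennreal (f w) * indicator A w \<partial>\<nu>) = ?e q A" if A: "A \<in> sets N" for A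
        unfolding \<mu>e[OF A, symmetric] f(3) by (rule emeasure_density[symmetric]) (use A s\<nu> in simp_all)
      then show ?thesis using fN f(2) by (intro exI[of _ f] conjI ballI)
    qed
    consider "q < lo" "q < hi" | "hi \<le> q" "lo \<le> q" | "hi \<le> q" "q < lo" | "\<not> q < lo" "\<not> hi \<le> q" by linarith
    then show ?thesis
    proof cases
      case 1 then show ?thesis by (intro exI[of _ "\<lambda>_. 0"]) (simp add: pre)
    next
      case 2
      then show ?thesis using s\<nu> by (intro exI[of _ "\<lambda>_. 1"]) (simp add: post)
    next
      case 3
      obtain \<omega> where "\<omega> \<in> space Q" using Q.not_empty by blast
      then show ?thesis using bd[of \<omega>] 3 by linarith
    next
      case 4 then show ?thesis using mid by simp
    qed
  qed
  from choice[OF allI[OF ex]] obtain f where f: "\<forall>q. f q \<in> borel_measurable N \<and> (\<forall>w. 0 \<le> f q w) \<and> (q < lo \<longrightarrow> (\<forall>w. f q w = 0)) \<and> (hi \<le> q \<longrightarrow> (\<forall>w. f q w = 1)) \<and>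
    (\<forall>A\<in>sets N. (\<integral>\<^sup>+w. ennreal (f q w) * indicator A w \<partial>\<nu>) = ?e q A)" ..
  have fm[measurable]: "f q \<in> borel_measurable N" and f0: "0 \<le> f q w" and flo: "q < lo \<Longrightarrow> f q w = 0" and fhi: "hi \<le> q \<Longrightarrow> f q w = 1" for q w
    using f by simp_all
  have fint: "(\<integral>\<^sup>+w. ennreal (f q w) * indicator A w \<partial>\<nu>) = ?e q A" if "A \<in> sets N" for q A
    using f that by simp
  have "AE w in \<nu>. f q w \<le> f q' w" if "q \<le> q'" for q q'
  proof (rule AE_le_of_set_integrals[OF _ _ f0])
    show "f q \<in> borel_measurable \<nu>" "f q' \<in> borel_measurable \<nu>" by measurable
    have "(\<integral>\<^sup>+w. ennreal (f q' w) \<partial>\<nu>) = (\<integral>\<^sup>+w. ennreal (f q' w) * indicator (space N) w \<partial>\<nu>)"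
      by (intro nn_integral_cong) (simp add: \<nu>_def)
    also have "\<dots> = ?e q' (space N)" by (rule fint) simp
    also have "\<dots> < \<infinity>" by (simp add: less_top[symmetric])
    finally show "(\<integral>\<^sup>+w. ennreal (f q' w) \<partial>\<nu>) < \<infinity>" .
    fix A assume "A \<in> sets \<nu>"
    then have A[measurable]: "A \<in> sets N" by (simp only: s\<nu>)
    show "(\<integral>\<^sup>+w. ennreal (f q w) * indicator A w \<partial>\<nu>) \<le> (\<integral>\<^sup>+w. ennreal (f q' w) * indicator A w \<partial>\<nu>)"
      unfolding fint[OF A] by (rule emeasure_mono) (use that in auto)
  qed
  then have mono: "AE w in \<nu>. \<forall>q\<in>\<rat>. \<forall>q'\<in>\<rat>. q \<le> q' \<longrightarrow> f q w \<le> f q' w"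
    by (intro AE_ball_countable'[OF _ countable_rat]) (simp add: AE_impI)
  define good where "good w \<longleftrightarrow> (\<forall>q\<in>\<rat>. \<forall>q'\<in>\<rat>. q \<le> q' \<longrightarrow> f q w \<le> f q' w)" for w
  have "Measurable.pred N good"
  proof -
    have "good = (\<lambda>w. \<forall>q\<in>\<rat>. \<forall>q'\<in>\<rat>. q \<le> q' \<longrightarrow> f q w \<le> f q' w)" by (simp add: good_def[abs_def])
    moreover have "Measurable.pred N (\<lambda>w. \<forall>q\<in>\<rat>. \<forall>q'\<in>\<rat>. q \<le> q' \<longrightarrow> f q w \<le> f q' w)"
      by (intro pred_Ball_countable countable_rat) measurable
    ultimately show ?thesis by simp
  qed
  note [measurable] = this
  \<comment> \<open>On the null set of bad arguments any distribution function concentrated on \<open>hi\<close> will do.\<close>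
  define F where "F q w = (if good w then f q w else if hi \<le> q then 1 else 0)" for q w
  have Fm: "F q \<in> borel_measurable N" for q unfolding F_def[abs_def] by measurable
  have Fint: "(\<integral>\<^sup>+w. ennreal (F q w) * indicator A w \<partial>\<nu>) = ?e q A" if A: "A \<in> sets N" for q A
  proof -
    have "(\<integral>\<^sup>+w. ennreal (F q w) * indicator A w \<partial>\<nu>) = (\<integral>\<^sup>+w. ennreal (f q w) * indicator A w \<partial>\<nu>)"
      using mono by (intro nn_integral_cong_AE) (rule eventually_mono, auto simp: F_def good_def)
    then show ?thesis by (simp only: fint[OF A])
  qed
  have Fmono: "F q w \<le> F q' w" if "q \<in> \<rat>" "q' \<in> \<rat>" "q \<le> q'" for q q' w
    using that by (auto simp: F_def good_def)
  obtain r where r: "r \<in> \<rat>" "hi < r" using Rats_dense_in_real[of hi "hi + 1"] by auto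
  have "lo \<le> hi"
  proof -
    obtain \<omega> where "\<omega> \<in> space Q" using Q.not_empty by blast
    then show ?thesis using bd[of \<omega>] by linarith
  qed
  show ?thesis
  proof (intro exI[of _ F] ballI conjI allI impI)
    fix q w assume q: "q \<in> (\<rat> :: real set)"
    show "0 \<le> F q w" using f0 by (simp add: F_def)
    show "F q w = 0" if "q < lo" using that flo \<open>lo \<le> hi\<close> by (simp add: F_def)
    show hi1: "F q w = 1" if "hi \<le> q" using that fhi by (simp add: F_def)
    show "F q w \<le> 1"
    proof (cases "hi \<le> q")
      case False
      have "F q w \<le> F r w" by (rule Fmono) (use q r False in auto)
      also have "F r w = 1" using r fhi by (simp add: F_def)
      finally show ?thesis .
    qed (simp add: hi1)
  qed (use Fm Fmono Fint in \<open>simp_all add: \<nu>_def\<close>)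
qed

lemma rational_sequence_to:
  fixes r :: real
  shows "\<exists>q :: nat \<Rightarrow> real. incseq q \<and> (\<forall>n. q n \<in> \<rat> \<and> q n < r) \<and> (\<forall>x<r. \<exists>n. x < q n)"
proof -
  have "\<exists>q. \<forall>n. (q n \<in> \<rat> \<and> r - 1 / real (Suc n) < q n \<and> q n < r) \<and> q n \<le> q (Suc n)"
  proof (rule dependent_nat_choice)
    show "\<exists>x. x \<in> \<rat> \<and> r - 1 / real (Suc 0) < x \<and> x < r" using Rats_dense_in_real[of "r - 1" r] by auto
    fix x n assume "x \<in> \<rat> \<and> r - 1 / real (Suc n) < x \<and> x < r"
    then have "max x (r - 1 / real (Suc (Suc n))) < r" by simp
    from Rats_dense_in_real[OF this] show "\<exists>y. (y \<in> \<rat> \<and> r - 1 / real (Suc (Suc n)) < y \<and> y < r) \<and> x \<le> y"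
      by (auto intro: less_imp_le)
  qed
  then obtain q where q: "\<forall>n. (q n \<in> \<rat> \<and> r - 1 / real (Suc n) < q n \<and> q n < r) \<and> q n \<le> q (Suc n)" ..
  have "\<exists>n. x < q n" if "x < r" for x
  proof -
    have "0 < r - x" using that by simp
    from reals_Archimedean[OF this] obtain n where "inverse (real (Suc n)) < r - x" ..
    moreover have "r - 1 / real (Suc n) < q n" using q by blast
    ultimately have "x < q n" by (simp add: inverse_eq_divide)
    then show ?thesis ..
  qed
  then show ?thesis using q by (intro exI[of _ q]) (auto simp: incseq_Suc_iff)
qed

text \<open>
  The function \<open>T\<close> is the conditional quantile function of \<open>g\<close> given \<open>W\<close>: the infimum of the rationals at which
  the conditional distribution function reaches the level \<open>u\<close>.
\<close>

lemma noise_outsourcing: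
  fixes g :: "'a \<Rightarrow> real" and N :: "'w measure"
  assumes Q: "prob_space Q" and W[measurable]: "W \<in> Q \<rightarrow>\<^sub>M N" and g[measurable]: "g \<in> borel_measurable Q"
    and bd: "\<And>\<omega>. \<omega> \<in> space Q \<Longrightarrow> lo \<le> g \<omega> \<and> g \<omega> \<le> hi"
  shows "\<exists>T \<in> borel_measurable (N \<Otimes>\<^sub>M unif01).
    distr (distr Q N W \<Otimes>\<^sub>M unif01) (N \<Otimes>\<^sub>M borel) (\<lambda>z. (fst z, T z)) = distr Q (N \<Otimes>\<^sub>M borel) (\<lambda>\<omega>. (W \<omega>, g \<omega>))"
proof -
  interpret Q: prob_space Q by fact
  interpret U: prob_space unif01 by (rule prob_space_unif01)
  define \<nu> where "\<nu> = distr Q N W"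
  have \<nu>: "prob_space \<nu>" unfolding \<nu>_def by (rule Q.prob_space_distr[OF W])
  have s\<nu>[measurable_cong]: "sets \<nu> = sets N" by (simp add: \<nu>_def)
  have sp: "space \<nu> = space N" by (simp add: \<nu>_def)
  have s\<nu>U: "sets (\<nu> \<Otimes>\<^sub>M unif01) = sets (N \<Otimes>\<^sub>M unif01)" by (rule sets_pair_measure_cong[OF s\<nu> refl])
  have sp\<nu>U: "space (\<nu> \<Otimes>\<^sub>M unif01) = space (N \<Otimes>\<^sub>M unif01)" by (rule sets_eq_imp_space_eq[OF s\<nu>U])
  from conditional_cdf[OF Q W g bd] obtain F :: "real \<Rightarrow> 'w \<Rightarrow> real" where F: "\<forall>q\<in>\<rat>. F q \<in> borel_measurable N \<and>
      (\<forall>w. 0 \<le> F q w \<and> F q w \<le> 1) \<and> (q < lo \<longrightarrow> (\<forall>w. F q w = 0)) \<and> (hi \<le> q \<longrightarrow> (\<forall>w. F q w = 1)) \<and>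
      (\<forall>q'\<in>\<rat>. q \<le> q' \<longrightarrow> (\<forall>w. F q w \<le> F q' w)) \<and>
      (\<forall>A\<in>sets N. (\<integral>\<^sup>+w. ennreal (F q w) * indicator A w \<partial>distr Q N W) = emeasure Q {\<omega>\<in>space Q. W \<omega> \<in> A \<and> g \<omega> \<le> q})" ..
  have Fm: "q \<in> \<rat> \<Longrightarrow> F q \<in> borel_measurable N" and F01: "q \<in> \<rat> \<Longrightarrow> 0 \<le> F q w \<and> F q w \<le> 1"
    and Flo: "q \<in> \<rat> \<Longrightarrow> q < lo \<Longrightarrow> F q w = 0" and Fhi: "q \<in> \<rat> \<Longrightarrow> hi \<le> q \<Longrightarrow> F q w = 1"
    and Fmono: "q \<in> \<rat> \<Longrightarrow> q' \<in> \<rat> \<Longrightarrow> q \<le> q' \<Longrightarrow> F q w \<le> F q' w"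
    and Fint: "q \<in> \<rat> \<Longrightarrow> A \<in> sets N \<Longrightarrow> (\<integral>\<^sup>+w. ennreal (F q w) * indicator A w \<partial>\<nu>) = emeasure Q {\<omega>\<in>space Q. W \<omega> \<in> A \<and> g \<omega> \<le> q}"
    for q q' w A
    using F unfolding \<nu>_def by simp_all
  define S where "S w u = {q\<in>\<rat>. u \<le> F q w}" for w u
  have S_ne: "S w u \<noteq> {}" if "u < 1" for w u
  proof -
    obtain r where r: "r \<in> \<rat>" "hi < r" using Rats_dense_in_real[of hi "hi + 1"] by auto
    then have "r \<in> S w u" using that Fhi[of r w] by (simp add: S_def)
    then show ?thesis by blast
  qed
  have S_bdd: "bdd_below (S w u)" if "0 < u" for w u
  proof (rule bdd_belowI)
    fix q assume "q \<in> S w u"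
    then have "q \<in> \<rat>" "u \<le> F q w" by (simp_all add: S_def)
    then show "lo \<le> q" using Flo[of q w] that by (cases "q < lo") auto
  qed
  define T where "T z = (if 0 < snd z \<and> snd z < 1 then Inf (S (fst z) (snd z)) else 0)" for z
  have T_less: "T z < r \<longleftrightarrow> (\<exists>q\<in>\<rat>. q < r \<and> snd z \<le> F q (fst z))" if "0 < snd z" "snd z < 1" for z r
  proof -
    have "T z < r \<longleftrightarrow> (\<exists>q\<in>S (fst z) (snd z). q < r)"
      unfolding T_def using that by (simp add: cInf_less_iff[OF S_ne S_bdd])
    then show ?thesis by (auto simp: S_def)
  qed
  have sndm[measurable]: "(\<lambda>z. snd z) \<in> borel_measurable (N \<Otimes>\<^sub>M unif01)"
    by (rule measurable_compose[OF measurable_snd measurable_ident_sets]) simp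
  have FmU: "(\<lambda>z. F q (fst z)) \<in> borel_measurable (N \<Otimes>\<^sub>M unif01)" if "q \<in> \<rat>" for q
    by (rule measurable_compose[OF measurable_fst Fm[OF that]])
  have Fpred: "Measurable.pred (N \<Otimes>\<^sub>M unif01) (\<lambda>z. snd z \<le> F q (fst z))" if "q \<in> \<rat>" for q
  proof -
    note [measurable] = FmU[OF that]
    show ?thesis by measurable
  qed
  have Tm: "T \<in> borel_measurable (N \<Otimes>\<^sub>M unif01)"
  proof (rule borel_measurableI_less)
    fix r
    have p: "Measurable.pred (N \<Otimes>\<^sub>M unif01) (\<lambda>z. \<exists>q\<in>\<rat>. q < r \<and> snd z \<le> F q (fst z))"
    proof (rule pred_Bex_countable[OF countable_rat])
      fix q :: real assume q: "q \<in> \<rat>"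
      show "Measurable.pred (N \<Otimes>\<^sub>M unif01) (\<lambda>z. q < r \<and> snd z \<le> F q (fst z))"
        using Fpred[OF q] by measurable
    qed
    have "{z \<in> space (N \<Otimes>\<^sub>M unif01). T z < r} = {z \<in> space (N \<Otimes>\<^sub>M unif01). if 0 < snd z \<and> snd z < 1 then \<exists>q\<in>\<rat>. q < r \<and> snd z \<le> F q (fst z) else 0 < r}"
      using T_less by (auto simp: T_def)
    also have "\<dots> \<in> sets (N \<Otimes>\<^sub>M unif01)" using p by measurable
    finally show "{z \<in> space (N \<Otimes>\<^sub>M unif01). T z < r} \<in> sets (N \<Otimes>\<^sub>M unif01)" .
  qed
  have TmN: "(\<lambda>z. (fst z, T z)) \<in> \<nu> \<Otimes>\<^sub>M unif01 \<rightarrow>\<^sub>M N \<Otimes>\<^sub>M borel"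
    unfolding measurable_cong_sets[OF s\<nu>U refl] by (intro measurable_Pair measurable_fst Tm)
  have Wg: "(\<lambda>\<omega>. (W \<omega>, g \<omega>)) \<in> Q \<rightarrow>\<^sub>M N \<Otimes>\<^sub>M borel" by (intro measurable_Pair W g)
  have main: "emeasure (\<nu> \<Otimes>\<^sub>M unif01) {z \<in> space (\<nu> \<Otimes>\<^sub>M unif01). fst z \<in> A \<and> T z < r} = emeasure Q {\<omega>\<in>space Q. W \<omega> \<in> A \<and> g \<omega> < r}"
    if A: "A \<in> sets N" for A r
  proof -
    obtain q :: "nat \<Rightarrow> real" where q: "incseq q" "\<forall>n. q n \<in> \<rat> \<and> q n < r" "\<forall>x<r. \<exists>n. x < q n"
      using rational_sequence_to[of r] by (elim exE conjE)
    have qR: "q n \<in> \<rat>" and qr: "q n < r" for n using q(2) by simp_all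
    define E where "E n = {z \<in> space (\<nu> \<Otimes>\<^sub>M unif01). fst z \<in> A \<and> (0 < snd z \<and> snd z < 1 \<and> snd z \<le> F (q n) (fst z))}" for n
    have E: "E n \<in> sets (\<nu> \<Otimes>\<^sub>M unif01)" for n
      unfolding E_def s\<nu>U sp\<nu>U using Fpred[OF qR[of n]] A by measurable
    have E_inc: "incseq E"
    proof (rule incseq_SucI)
      fix n
      have "F (q n) w \<le> F (q (Suc n)) w" for w
        by (rule Fmono[OF qR qR]) (use q(1) in \<open>simp add: incseq_SucD\<close>)
      then show "E n \<le> E (Suc n)" unfolding E_def by (auto intro: order_trans)
    qed
    have E_em: "emeasure (\<nu> \<Otimes>\<^sub>M unif01) (E n) = emeasure Q {\<omega>\<in>space Q. W \<omega> \<in> A \<and> g \<omega> \<le> q n}" for n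
    proof -
      have "emeasure (\<nu> \<Otimes>\<^sub>M unif01) (E n) = (\<integral>\<^sup>+w. emeasure unif01 (Pair w -` E n) \<partial>\<nu>)"
        by (rule U.emeasure_pair_measure_alt[OF E])
      also have "\<dots> = (\<integral>\<^sup>+w. ennreal (F (q n) w) * indicator A w \<partial>\<nu>)"
      proof (rule nn_integral_cong)
        fix w assume w: "w \<in> space \<nu>"
        have eq: "Pair w -` E n = (if w \<in> A then {u. 0 < u \<and> u < 1 \<and> u \<le> F (q n) w} else {})"
          using w by (auto simp: E_def space_pair_measure)
        have "emeasure unif01 {u. 0 < u \<and> u < 1 \<and> u \<le> F (q n) w} = ennreal (F (q n) w)"
        proof -
          let ?B = "{u. 0 < u \<and> u < 1 \<and> u \<le> F (q n) w}"
          have "?B = {u\<in>space borel. 0 < u \<and> u < 1 \<and> u \<le> F (q n) w}" by simp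
          also have "\<dots> \<in> sets borel" by measurable
          finally have B: "?B \<in> sets borel" .
          have "emeasure unif01 ?B = emeasure lborel (?B \<inter> {0<..<1})" by (rule emeasure_unif01[OF B])
          also have "\<dots> = emeasure lborel {0..F (q n) w}"
          proof (rule emeasure_eq_AE)
            have "AE u in lborel. u \<noteq> (0::real)" "AE u in lborel. u \<noteq> (1::real)" by (rule AE_lborel_singleton)+
            then show "AE u in lborel. (u \<in> ?B \<inter> {0<..<1}) = (u \<in> {0..F (q n) w})"
              by eventually_elim (use F01[OF qR[of n], of w] in auto)
          qed (use B in auto)
          also have "\<dots> = ennreal (F (q n) w)" using F01[OF qR[of n], of w] by simp
          finally show ?thesis .
        qed
        then show "emeasure unif01 (Pair w -` E n) = ennreal (F (q n) w) * indicator A w"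
          unfolding eq by (simp add: indicator_def)
      qed
      also have "\<dots> = emeasure Q {\<omega>\<in>space Q. W \<omega> \<in> A \<and> g \<omega> \<le> q n}" by (rule Fint[OF qR A])
      finally show ?thesis .
    qed
    have "emeasure (\<nu> \<Otimes>\<^sub>M unif01) {z \<in> space (\<nu> \<Otimes>\<^sub>M unif01). fst z \<in> A \<and> T z < r} = emeasure (\<nu> \<Otimes>\<^sub>M unif01) (\<Union>n. E n)"
    proof (rule emeasure_eq_AE)
      from AE_pair_unif01[OF \<nu>]
      show "AE z in \<nu> \<Otimes>\<^sub>M unif01. (z \<in> {z \<in> space (\<nu> \<Otimes>\<^sub>M unif01). fst z \<in> A \<and> T z < r}) = (z \<in> (\<Union>n. E n))"
        using AE_space
      proof eventually_elim
        case (elim z)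
        have "(\<exists>x\<in>\<rat>. x < r \<and> snd z \<le> F x (fst z)) \<longleftrightarrow> (\<exists>n. snd z \<le> F (q n) (fst z))"
        proof
          assume "\<exists>x\<in>\<rat>. x < r \<and> snd z \<le> F x (fst z)"
          then obtain x where x: "x \<in> \<rat>" "x < r" "snd z \<le> F x (fst z)" by (elim bexE conjE)
          obtain n where "x < q n" using q(3) x(2) by blast
          then have "F x (fst z) \<le> F (q n) (fst z)" by (intro Fmono x(1) qR) simp
          then show "\<exists>n. snd z \<le> F (q n) (fst z)" using x(3) by (intro exI[of _ n]) linarith
        next
          assume "\<exists>n. snd z \<le> F (q n) (fst z)"
          then show "\<exists>x\<in>\<rat>. x < r \<and> snd z \<le> F x (fst z)" using qR qr by blast
        qed
        then show ?case using elim T_less[of z r] by (simp add: E_def)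
      qed
      have "{z \<in> space (\<nu> \<Otimes>\<^sub>M unif01). fst z \<in> A \<and> T z < r} = (\<lambda>z. (fst z, T z)) -` (A \<times> {..<r}) \<inter> space (\<nu> \<Otimes>\<^sub>M unif01)"
        by auto
      also have "\<dots> \<in> sets (\<nu> \<Otimes>\<^sub>M unif01)" by (rule measurable_sets[OF TmN]) (use A in auto)
      finally show "{z \<in> space (\<nu> \<Otimes>\<^sub>M unif01). fst z \<in> A \<and> T z < r} \<in> sets (\<nu> \<Otimes>\<^sub>M unif01)" .
      show "(\<Union>n. E n) \<in> sets (\<nu> \<Otimes>\<^sub>M unif01)" using E by blast
    qed
    also have "\<dots> = (SUP n. emeasure (\<nu> \<Otimes>\<^sub>M unif01) (E n))"
      by (rule SUP_emeasure_incseq[symmetric]) (use E E_inc in auto)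
    also have "\<dots> = (SUP n. emeasure Q {\<omega>\<in>space Q. W \<omega> \<in> A \<and> g \<omega> \<le> q n})" by (simp only: E_em)
    also have "\<dots> = emeasure Q (\<Union>n. {\<omega>\<in>space Q. W \<omega> \<in> A \<and> g \<omega> \<le> q n})"
    proof (rule SUP_emeasure_incseq)
      show "range (\<lambda>n. {\<omega>\<in>space Q. W \<omega> \<in> A \<and> g \<omega> \<le> q n}) \<subseteq> sets Q" using A by auto
      show "incseq (\<lambda>n. {\<omega>\<in>space Q. W \<omega> \<in> A \<and> g \<omega> \<le> q n})"
        by (rule incseq_SucI) (use incseq_SucD[OF q(1)] in \<open>auto intro: order_trans\<close>)
    qed
    also have "(\<Union>n. {\<omega>\<in>space Q. W \<omega> \<in> A \<and> g \<omega> \<le> q n}) = {\<omega>\<in>space Q. W \<omega> \<in> A \<and> g \<omega> < r}"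
    proof -
      have "(\<exists>n. g \<omega> \<le> q n) \<longleftrightarrow> g \<omega> < r" for \<omega>
        using q(3) qr by (meson le_less_trans less_imp_le)
      then show ?thesis by blast
    qed
    finally show ?thesis .
  qed
  let ?E = "{A \<times> {..<r} | A (r :: real). A \<in> sets N}"
  have gen: "sets (N \<Otimes>\<^sub>M (borel :: real measure)) = sigma_sets (space N \<times> UNIV) ?E"
  proof -
    have "sets (N \<Otimes>\<^sub>M (borel :: real measure)) = sets (sigma (space N \<times> space (borel :: real measure)) {a \<times> b | a b. a \<in> sets N \<and> b \<in> range lessThan})"
    proof (rule sets_pair_eq[where Ca = "{space N}" and Cb = "range (\<lambda>n::nat. {..<real n})"])
      show "sets (borel :: real measure) = sigma_sets (space borel) (range lessThan)"
        by (subst borel_Iio) (simp add: sets_measure_of)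
      show "\<Union> (range (\<lambda>n. {..<real n})) = space borel" using reals_Archimedean2 by auto
    qed (auto simp: sets.sigma_sets_eq sets.space_closed)
    also have "{a \<times> b | a b. a \<in> sets N \<and> b \<in> range lessThan} = ?E" by auto
    finally show ?thesis
      using sets.sets_into_space[of _ N] by (subst (asm) sets_measure_of) fastforce+
  qed
  have "distr (\<nu> \<Otimes>\<^sub>M unif01) (N \<Otimes>\<^sub>M borel) (\<lambda>z. (fst z, T z)) = distr Q (N \<Otimes>\<^sub>M borel) (\<lambda>\<omega>. (W \<omega>, g \<omega>))"
  proof (rule measure_eqI_generator_eq[where E = ?E and \<Omega> = "space N \<times> UNIV" and A = "\<lambda>n. space N \<times> {..<real n}"])
    show "Int_stable ?E"
    proof (rule Int_stableI)
      fix a b assume "a \<in> ?E" "b \<in> ?E"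
      then obtain A r A' r' where "a = A \<times> {..<r}" "b = A' \<times> {..<r'}" "A \<in> sets N" "A' \<in> sets N" by blast
      then have "a \<inter> b = (A \<inter> A') \<times> {..<min r r'}" "A \<inter> A' \<in> sets N" by auto
      then show "a \<inter> b \<in> ?E" by blast
    qed
    show "?E \<subseteq> Pow (space N \<times> UNIV)" using sets.sets_into_space by fastforce
    show "sets (distr (\<nu> \<Otimes>\<^sub>M unif01) (N \<Otimes>\<^sub>M borel) (\<lambda>z. (fst z, T z))) = sigma_sets (space N \<times> UNIV) ?E"
      "sets (distr Q (N \<Otimes>\<^sub>M borel) (\<lambda>\<omega>. (W \<omega>, g \<omega>))) = sigma_sets (space N \<times> UNIV) ?E"
      by (simp_all only: sets_distr gen)
    fix X assume "X \<in> ?E"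
    then obtain A r where X: "X = A \<times> {..<r}" and A: "A \<in> sets N" by blast
    have Xm: "X \<in> sets (N \<Otimes>\<^sub>M borel)" unfolding X using A by simp
    have "emeasure (distr (\<nu> \<Otimes>\<^sub>M unif01) (N \<Otimes>\<^sub>M borel) (\<lambda>z. (fst z, T z))) X = emeasure (\<nu> \<Otimes>\<^sub>M unif01) {z \<in> space (\<nu> \<Otimes>\<^sub>M unif01). fst z \<in> A \<and> T z < r}"
      unfolding emeasure_distr[OF TmN Xm] by (rule arg_cong[where f = "emeasure _"]) (auto simp: X)
    also have "\<dots> = emeasure Q {\<omega>\<in>space Q. W \<omega> \<in> A \<and> g \<omega> < r}" by (rule main[OF A])
    also have "\<dots> = emeasure (distr Q (N \<Otimes>\<^sub>M borel) (\<lambda>\<omega>. (W \<omega>, g \<omega>))) X"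
      unfolding emeasure_distr[OF Wg Xm] by (rule arg_cong[where f = "emeasure _"]) (auto simp: X)
    finally show "emeasure (distr (\<nu> \<Otimes>\<^sub>M unif01) (N \<Otimes>\<^sub>M borel) (\<lambda>z. (fst z, T z))) X = emeasure (distr Q (N \<Otimes>\<^sub>M borel) (\<lambda>\<omega>. (W \<omega>, g \<omega>))) X" .
  next
    show "range (\<lambda>n. space N \<times> {..<real n}) \<subseteq> ?E" by blast
    show "(\<Union>n. space N \<times> {..<real n}) = space N \<times> UNIV" using reals_Archimedean2 by auto
    fix n
    have "prob_space (distr (\<nu> \<Otimes>\<^sub>M unif01) (N \<Otimes>\<^sub>M borel) (\<lambda>z. (fst z, T z)))"
      by (rule prob_space.prob_space_distr[OF prob_space_pair[OF \<nu> prob_space_unif01] TmN])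
    then show "emeasure (distr (\<nu> \<Otimes>\<^sub>M unif01) (N \<Otimes>\<^sub>M borel) (\<lambda>z. (fst z, T z))) (space N \<times> {..<real n}) \<noteq> \<infinity>"
      by (simp add: finite_measure.emeasure_finite prob_space.finite_measure)
  qed
  then show ?thesis using Tm unfolding \<nu>_def by (intro bexI[of _ T])
qed

section \<open>Real coordinates on Lebesgue--Rokhlin spaces\<close>

text \<open>
  The atoms are encoded by negative numbers; on the rest the isomorphism with an interval is the
  coordinate. The inverse \<open>h\<close> is only Lebesgue measurable, but Lebesgue null sets are, apart from the codes of
  atoms, also null for the law of the coordinate, so that \<open>h\<close> is measurable for the completion of this law.
\<close>

lemma standard_prob_space_coordinate:
  fixes M :: "'a measure"
  assumes "standard_prob_space M"
  shows "\<exists>(g :: 'a \<Rightarrow> real) h lo hi. g \<in> borel_measurable M \<and> (\<forall>\<omega>\<in>space M. lo \<le> g \<omega> \<and> g \<omega> \<le> hi) \<and>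
    h \<in> completion (distr M borel g) \<rightarrow>\<^sub>M M \<and> (AE \<omega> in M. h (g \<omega>) = \<omega>)"
proof -
  have M: "prob_space M" using assms by (simp add: standard_prob_space_def)
  interpret M: prob_space M by fact
  from assms obtain C l where C: "countable C" "C \<subseteq> space M" "\<And>c. c \<in> C \<Longrightarrow> {c} \<in> sets M"
    and l: "0 \<le> l" and iso: "isomorphic_mod0 (restrict_space M (space M - C)) (lebesgue_on {0..<l::real})"
    unfolding standard_prob_space_def by (elim conjE exE) (rule that, simp_all)
  have CM: "C \<in> sets M" by (rule sets.countable[OF C(3,1)])
  define R where "R = restrict_space M (space M - C)"
  have spR: "space R = space M - C" unfolding R_def space_restrict_space by blast
  from iso obtain A0 B0 f where A0: "A0 \<in> null_sets R" and B0: "B0 \<in> null_sets (lebesgue_on {0..<l})"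
    and f: "let M' = restrict_space R (space R - A0); N' = restrict_space (lebesgue_on {0..<l}) (space (lebesgue_on {0..<l}) - B0) in
          bij_betw f (space M') (space N') \<and> f \<in> M' \<rightarrow>\<^sub>M N' \<and>
          the_inv_into (space M') f \<in> N' \<rightarrow>\<^sub>M M' \<and> distr M' N' f = N'"
    unfolding isomorphic_mod0_def R_def[symmetric] by (elim bexE exE) (rule that)
  define G where "G = space M - C - A0"
  define H where "H = {0..<l} - B0"
  have A0s: "A0 \<subseteq> space M - C" and A0n: "A0 \<in> null_sets M"
    using A0 CM unfolding R_def by (auto simp: null_sets_restrict_space)
  have A0M: "A0 \<in> sets M" using A0n by auto
  have GM: "G \<in> sets M" unfolding G_def using CM A0M by auto
  have B0n: "B0 \<in> sets lebesgue"
    using B0 by (subst (asm) null_sets_restrict_space) auto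
  have HL: "H \<in> sets lebesgue" unfolding H_def using B0n by auto
  define M' where "M' = restrict_space M G"
  define N' where "N' = lebesgue_on H"
  have M'eq: "restrict_space R (space R - A0) = M'"
  proof -
    have "restrict_space R (space R - A0) = restrict_space M ((space M - C) \<inter> (space R - A0))"
      unfolding R_def by (rule restrict_restrict_space) (use CM A0M in \<open>auto simp: space_restrict_space\<close>)
    also have "(space M - C) \<inter> (space R - A0) = G" by (auto simp: spR G_def)
    finally show ?thesis by (simp only: M'_def)
  qed
  have N'eq: "restrict_space (lebesgue_on {0..<l}) (space (lebesgue_on {0..<l}) - B0) = N'"
  proof -
    have "restrict_space (lebesgue_on {0..<l}) (space (lebesgue_on {0..<l}) - B0) = lebesgue_on ({0..<l} \<inter> (space (lebesgue_on {0..<l}) - B0))"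
      by (rule restrict_restrict_space) (use B0n in \<open>auto simp: space_restrict_space\<close>)
    also have "{0..<l} \<inter> (space (lebesgue_on {0..<l}) - B0) = H" by (auto simp: H_def space_restrict_space)
    finally show ?thesis by (simp only: N'_def)
  qed
  have spM': "space M' = G" using sets.sets_into_space[OF GM] by (auto simp: M'_def space_restrict_space)
  have spN': "space N' = H" by (simp add: N'_def space_restrict_space)
  define k where "k = the_inv_into G f"
  have fbij: "bij_betw f G H" and fm: "f \<in> M' \<rightarrow>\<^sub>M N'" and km: "k \<in> N' \<rightarrow>\<^sub>M M'" and fd: "distr M' N' f = N'"
    using f unfolding M'eq N'eq Let_def spM' spN' k_def by simp_all
  have sM': "A \<in> sets M' \<longleftrightarrow> A \<subseteq> G \<and> A \<in> sets M" for A
    unfolding M'_def by (rule sets_restrict_space_iff) (use GM in auto)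
  have sN': "A \<in> sets N' \<longleftrightarrow> A \<subseteq> H \<and> A \<in> sets lebesgue" for A
    unfolding N'_def by (rule sets_restrict_space_iff) (use HL in auto)
  have fH: "f \<omega> \<in> H" if "\<omega> \<in> G" for \<omega> using fbij that by (rule bij_betw_apply)
  have kf: "k (f \<omega>) = \<omega>" if "\<omega> \<in> G" for \<omega>
    unfolding k_def by (rule the_inv_into_f_f) (use fbij that in \<open>auto simp: bij_betw_def\<close>)
  \<comment> \<open>Negative codes keep the atoms apart from the interval and the coordinate bounded.\<close>
  define code where "code c = - inverse (1 + real (to_nat_on C c))" for c
  have code_b: "-1 \<le> code c" "code c < 0" for c by (auto simp: code_def inverse_eq_divide divide_simps)
  have code_inj: "inj_on code C"
  proof (rule inj_onI)
    fix c d assume cd: "c \<in> C" "d \<in> C" "code c = code d"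
    then have "to_nat_on C c = to_nat_on C d" by (simp add: code_def)
    then show "c = d" using cd C(1) by (simp add: inj_on_eq_iff[OF inj_on_to_nat_on])
  qed
  define g where "g \<omega> = (if \<omega> \<in> C then code \<omega> else if \<omega> \<in> G then f \<omega> else 0)" for \<omega>
  have GC: "G \<inter> C = {}" by (auto simp: G_def)
  have cover: "space M = C \<union> G \<union> A0" using C(2) A0s by (auto simp: G_def)
  have codeC: "countable (code ` C)" using C(1) by simp
  have countC: "D \<in> sets M" if "D \<subseteq> C" for D
    by (rule sets.countable[OF C(3)]) (use that countable_subset[OF that C(1)] in auto)
  have gm: "g \<in> borel_measurable M"
  proof (rule measurableI)
    fix S :: "real set" assume S: "S \<in> sets borel"
    have "f -` S \<inter> G \<in> sets M"
    proof -
      have "S \<inter> H \<in> sets N'" unfolding sN' using S HL by auto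
      from measurable_sets[OF fm this] have "f -` (S \<inter> H) \<inter> G \<in> sets M" unfolding spM' sM' by simp
      also have "f -` (S \<inter> H) \<inter> G = f -` S \<inter> G" using fH by auto
      finally show ?thesis .
    qed
    moreover have "{c\<in>C. code c \<in> S} \<in> sets M" by (rule countC) auto
    moreover have "g -` S \<inter> space M = {c\<in>C. code c \<in> S} \<union> (f -` S \<inter> G) \<union> (if 0 \<in> S then A0 else {})"
      unfolding cover using GC A0s by (auto simp: g_def G_def split: if_splits)
    ultimately show "g -` S \<inter> space M \<in> sets M" using A0M by simp
  qed simp
  have gb: "-1 \<le> g \<omega> \<and> g \<omega> \<le> l" for \<omega>
  proof -
    have "f \<omega> \<in> {0..<l}" if "\<omega> \<in> G" using fH[OF that] by (simp add: H_def)
    then show ?thesis using code_b[of \<omega>] l by (auto simp: g_def)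
  qed
  obtain \<omega>0 where \<omega>0: "\<omega>0 \<in> space M" using M.not_empty by blast
  define h where "h x = (if x \<in> code ` C then the_inv_into C code x else if x \<in> H then k x else \<omega>0)" for x
  have hg: "h (g \<omega>) = \<omega>" if "\<omega> \<in> C \<union> G" for \<omega>
  proof (cases "\<omega> \<in> C")
    case True
    then show ?thesis by (simp add: h_def g_def the_inv_into_f_f[OF code_inj])
  next
    case False
    then have \<omega>: "\<omega> \<in> G" using that by blast
    have "0 \<le> f \<omega>" using fH[OF \<omega>] by (simp add: H_def)
    have "f \<omega> \<notin> code ` C"
    proof
      assume "f \<omega> \<in> code ` C"
      then obtain c where "f \<omega> = code c" by blast
      then show False using \<open>0 \<le> f \<omega>\<close> code_b(2)[of c] by simp
    qed
    then show ?thesis using False \<omega> fH[OF \<omega>] kf[OF \<omega>] by (simp add: h_def g_def)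
  qed
  define \<gamma> where "\<gamma> = distr M borel g"
  have \<gamma>_null: "N - code ` C \<in> null_sets \<gamma>" if N: "N \<in> null_sets lborel" for N
  proof -
    have Nb: "N \<in> sets borel" using N by auto
    have Cb: "code ` C \<in> sets borel" by (rule sets.countable[OF _ codeC]) simp
    have NH: "N \<inter> H \<in> sets N'" unfolding sN' using Nb HL by auto
    have "emeasure M (f -` (N \<inter> H) \<inter> G) = emeasure M' (f -` (N \<inter> H) \<inter> space M')"
      unfolding spM' unfolding M'_def by (rule emeasure_restrict_space[symmetric]) (use GM in auto)
    also have "\<dots> = emeasure (distr M' N' f) (N \<inter> H)" by (rule emeasure_distr[OF fm NH, symmetric])
    also have "\<dots> = emeasure N' (N \<inter> H)" by (simp only: fd)
    also have "\<dots> = emeasure lebesgue (N \<inter> H)"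
      unfolding N'_def by (rule emeasure_restrict_space) (use HL in auto)
    also have "\<dots> \<le> emeasure lebesgue N" by (rule emeasure_mono) (use Nb in auto)
    also have "\<dots> = 0" by (rule null_setsD1[OF null_sets_completionI[OF N]])
    finally have z: "emeasure M (f -` (N \<inter> H) \<inter> G) = 0" by simp
    have fM: "f -` (N \<inter> H) \<inter> G \<in> sets M" using measurable_sets[OF fm NH] unfolding spM' sM' by simp
    have nn: "f -` (N \<inter> H) \<inter> G \<in> null_sets M" using z fM by (rule null_setsI)
    have sub: "g -` (N - code ` C) \<inter> space M \<subseteq> (f -` (N \<inter> H) \<inter> G) \<union> A0"
      unfolding cover using fH by (auto simp: g_def split: if_splits)
    have "g -` (N - code ` C) \<inter> space M \<in> null_sets M"
      by (rule null_sets_subset[OF null_sets.Un[OF nn A0n] _ sub]) (use measurable_sets[OF gm] Nb Cb in auto)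
    then show ?thesis unfolding \<gamma>_def by (subst null_sets_distr_iff[OF gm]) (use Nb Cb in auto)
  qed
  have leb\<gamma>: "L \<in> sets (completion \<gamma>)" if "L \<in> sets lebesgue" for L
  proof -
    from that obtain S N1 N where L: "L = S \<union> N1" "N1 \<subseteq> N" "N \<in> null_sets lborel" "S \<in> sets lborel" by (rule sets_completionE)
    have "N1 \<inter> code ` C \<in> sets borel" by (rule sets.countable) (auto intro: countable_subset[OF _ codeC])
    then have "S \<union> (N1 \<inter> code ` C) \<in> sets \<gamma>" using L(4) by (auto simp: \<gamma>_def)
    moreover have "L = (S \<union> (N1 \<inter> code ` C)) \<union> (N1 - code ` C)" using L(1) by blast
    moreover have "N1 - code ` C \<subseteq> N - code ` C" using L(2) by blast
    ultimately show ?thesis using \<gamma>_null[OF L(3)] by (intro sets_completionI)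
  qed
  have hm: "h \<in> completion \<gamma> \<rightarrow>\<^sub>M M"
  proof (rule measurableI)
    fix x
    show "h x \<in> space M"
    proof -
      have "the_inv_into C code x \<in> C" if "x \<in> code ` C" using the_inv_into_into[OF code_inj that] by simp
      moreover have "k x \<in> G" if "x \<in> H" using measurable_space[OF km] that unfolding spM' spN' by simp
      ultimately show ?thesis using \<omega>0 C(2) sets.sets_into_space[OF GM] by (auto simp: h_def)
    qed
  next
    fix S assume S: "S \<in> sets M"
    have "{x\<in>code ` C. h x \<in> S} \<in> sets borel"
      by (rule sets.countable) (auto intro: countable_subset[OF _ codeC])
    then have 1: "{x\<in>code ` C. h x \<in> S} \<in> sets lebesgue" by simp
    have "S \<inter> G \<in> sets M'" unfolding sM' using S GM by auto
    from measurable_sets[OF km this] have "k -` (S \<inter> G) \<inter> H \<in> sets lebesgue" unfolding spN' sN' by simp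
    moreover have "k x \<in> G" if "x \<in> H" for x using measurable_space[OF km] that unfolding spM' spN' by simp
    then have "k -` (S \<inter> G) \<inter> H = k -` S \<inter> H" by auto
    ultimately have 2: "k -` S \<inter> H \<in> sets lebesgue" by simp
    have Cb: "code ` C \<in> sets lebesgue" using sets.countable[OF _ codeC, of borel] by simp
    have "h -` S = {x\<in>code ` C. h x \<in> S} \<union> (k -` S \<inter> H - code ` C) \<union> (if \<omega>0 \<in> S then - (code ` C) - H else {})"
      by (auto simp: h_def split: if_splits)
    moreover have "- (code ` C) - H \<in> sets lebesgue"
      using Cb HL by (intro sets.Diff Compl_in_sets_lebesgue[THEN iffD2])
    ultimately have "h -` S \<in> sets lebesgue" using 1 2 Cb by auto
    then show "h -` S \<inter> space (completion \<gamma>) \<in> sets (completion \<gamma>)" using leb\<gamma> by (simp add: \<gamma>_def)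
  qed
  have "AE \<omega> in M. \<omega> \<notin> A0" by (rule AE_not_in[OF A0n])
  then have "AE \<omega> in M. h (g \<omega>) = \<omega>"
    using AE_space
  proof eventually_elim
    case (elim \<omega>)
    then show ?case using cover by (intro hg) blast
  qed
  then show ?thesis using gm gb hm unfolding \<gamma>_def
    by (intro exI[of _ g] exI[of _ h] exI[of _ "-1"] exI[of _ l] conjI ballI) simp_all
qed

section \<open>Gluing along the common enumeration\<close>

text \<open>
  Two sequences have the same range iff each term of either one occurs in the other, which involves
  only countably many coordinate conditions.
\<close>

lemma sets_range_eq:
  "{z \<in> space (seqs \<Otimes>\<^sub>M seqs). range (fst z) = range (snd z)} \<in> sets (seqs \<Otimes>\<^sub>M seqs)"
proof -
  have "{z \<in> space (seqs \<Otimes>\<^sub>M seqs). range (fst z) = range (snd z)} =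
    {z \<in> space (seqs \<Otimes>\<^sub>M seqs). (\<forall>i. \<exists>j. fst z i = snd z j) \<and> (\<forall>j. \<exists>i. snd z j = fst z i)}"
    by (auto simp: set_eq_iff image_iff)
  also have "\<dots> \<in> sets (seqs \<Otimes>\<^sub>M seqs)"
  proof -
    have [measurable]: "(\<lambda>z. fst z i) \<in> borel_measurable (seqs \<Otimes>\<^sub>M seqs)" "(\<lambda>z. snd z i) \<in> borel_measurable (seqs \<Otimes>\<^sub>M seqs)" for i
      by (rule measurable_compose[OF measurable_fst measurable_component_singleton], simp)
        (rule measurable_compose[OF measurable_snd measurable_component_singleton], simp)
    have [measurable]: "Measurable.pred (seqs \<Otimes>\<^sub>M seqs) (\<lambda>z. fst z i = snd z j)" "Measurable.pred (seqs \<Otimes>\<^sub>M seqs) (\<lambda>z. snd z j = fst z i)" for i j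
      by measurable
    show ?thesis by measurable
  qed
  finally show ?thesis .
qed

lemma AE_pair_fst:
  assumes "prob_space N" "AE x in M. P x"
  shows "AE z in M \<Otimes>\<^sub>M N. P (fst z)"
proof (rule AE_distrD[OF measurable_fst])
  show "AE x in distr (M \<Otimes>\<^sub>M N) M fst. P x" unfolding prob_space.distr_pair_fst[OF assms(1)] by (rule assms(2))
qed

text \<open>
  Start from the first space with its auxiliary uniform variable, which determine the common sequence. An
  independent second uniform variable then produces a real number \<open>t\<close> whose joint law with the
  sequence is that of the coordinate \<open>g\<close> on the second space. Decoding \<open>t\<close> yields a point of the second space.
  Completions enter because \<open>h\<close> is not Borel measurable.
\<close>

lemma glue_along_sequences:
  fixes M1 :: "'a measure" and M2 :: "'b measure" and g :: "'b \<Rightarrow> real"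
  assumes M1: "prob_space M1" and M2: "prob_space M2"
    and g: "g \<in> borel_measurable M2" and gb: "\<And>\<omega>. \<omega> \<in> space M2 \<Longrightarrow> lo \<le> g \<omega> \<and> g \<omega> \<le> hi"
    and h: "h \<in> completion (distr M2 borel g) \<rightarrow>\<^sub>M M2" and hg: "AE \<omega> in M2. h (g \<omega>) = \<omega>"
    and Y1: "Y1 \<in> M1 \<rightarrow>\<^sub>M seqs" and Y2: "Y2 \<in> M2 \<rightarrow>\<^sub>M seqs"
    and W1: "W1 \<in> M1 \<Otimes>\<^sub>M unif01 \<rightarrow>\<^sub>M seqs" and W2: "W2 \<in> M2 \<Otimes>\<^sub>M unif01 \<rightarrow>\<^sub>M seqs"
    and law: "distr (M1 \<Otimes>\<^sub>M unif01) seqs W1 = distr (M2 \<Otimes>\<^sub>M unif01) seqs W2"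
    and r1: "AE z in M1 \<Otimes>\<^sub>M unif01. range (W1 z) = range (Y1 (fst z))"
    and r2: "AE z in M2 \<Otimes>\<^sub>M unif01. range (W2 z) = range (Y2 (fst z))"
  shows "\<exists>J. joining M1 M2 J \<and> (AE p in J. range (Y1 (fst p)) = range (Y2 (snd p)))"
proof -
  have U: "prob_space unif01" by (rule prob_space_unif01)
  define Q1 where "Q1 = M1 \<Otimes>\<^sub>M unif01"
  define Q2 where "Q2 = M2 \<Otimes>\<^sub>M unif01"
  have Q1: "prob_space Q1" and Q2: "prob_space Q2" unfolding Q1_def Q2_def by (intro prob_space_pair M1 M2 U)+
  define Q where "Q = Q1 \<Otimes>\<^sub>M unif01"
  have Q: "prob_space Q" unfolding Q_def by (intro prob_space_pair Q1 U)
  have f1: "fst \<in> Q1 \<rightarrow>\<^sub>M M1" and f2: "fst \<in> Q2 \<rightarrow>\<^sub>M M2" and fQ: "fst \<in> Q \<rightarrow>\<^sub>M Q1" and sQ: "snd \<in> Q \<rightarrow>\<^sub>M unif01"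
    unfolding Q1_def Q2_def Q_def by simp_all
  have W1': "W1 \<in> Q1 \<rightarrow>\<^sub>M seqs" and W2': "W2 \<in> Q2 \<rightarrow>\<^sub>M seqs" using W1 W2 unfolding Q1_def Q2_def .
  have gf: "(\<lambda>z. g (fst z)) \<in> borel_measurable Q2" by (rule measurable_compose[OF f2 g])
  have gfb: "lo \<le> g (fst z) \<and> g (fst z) \<le> hi" if "z \<in> space Q2" for z
    by (rule gb[OF measurable_space[OF f2 that]])
  from noise_outsourcing[OF Q2 W2' gf gfb] obtain T where T: "T \<in> borel_measurable (seqs \<Otimes>\<^sub>M unif01)"
    and Tlaw: "distr (distr Q2 seqs W2 \<Otimes>\<^sub>M unif01) (seqs \<Otimes>\<^sub>M borel) (\<lambda>z. (fst z, T z)) =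
      distr Q2 (seqs \<Otimes>\<^sub>M borel) (\<lambda>z. (W2 z, g (fst z)))" ..
  define \<gamma> where "\<gamma> = distr M2 borel g"
  define t where "t z = T (W1 (fst z), snd z)" for z
  have WQ: "(\<lambda>z. W1 (fst z)) \<in> Q \<rightarrow>\<^sub>M seqs" by (rule measurable_compose[OF fQ W1'])
  have WU: "(\<lambda>z. (W1 (fst z), snd z)) \<in> Q \<rightarrow>\<^sub>M seqs \<Otimes>\<^sub>M unif01" by (rule measurable_Pair[OF WQ sQ])
  have tm: "t \<in> borel_measurable Q" unfolding t_def[abs_def] by (rule measurable_compose[OF WU T])
  have fT: "(\<lambda>z. (fst z, T z)) \<in> seqs \<Otimes>\<^sub>M unif01 \<rightarrow>\<^sub>M seqs \<Otimes>\<^sub>M borel" by (intro measurable_Pair measurable_fst T)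
  have Wt: "(\<lambda>z. (W1 (fst z), t z)) \<in> Q \<rightarrow>\<^sub>M seqs \<Otimes>\<^sub>M borel" by (rule measurable_Pair[OF WQ tm])
  have Wg: "(\<lambda>z. (W2 z, g (fst z))) \<in> Q2 \<rightarrow>\<^sub>M seqs \<Otimes>\<^sub>M borel" by (rule measurable_Pair[OF W2' gf])
  have joint: "distr Q (seqs \<Otimes>\<^sub>M borel) (\<lambda>z. (W1 (fst z), t z)) = distr Q2 (seqs \<Otimes>\<^sub>M borel) (\<lambda>z. (W2 z, g (fst z)))"
  proof -
    have id: "(\<lambda>u. u) \<in> unif01 \<rightarrow>\<^sub>M unif01" by simp
    have "distr Q1 seqs W1 \<Otimes>\<^sub>M distr unif01 unif01 (\<lambda>u. u) = distr (Q1 \<Otimes>\<^sub>M unif01) (seqs \<Otimes>\<^sub>M unif01) (\<lambda>(x, y). (W1 x, y))"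
      by (rule pair_measure_distr[OF W1' id]) (simp add: distr_id prob_space_imp_sigma_finite[OF U])
    also have "\<dots> = distr Q (seqs \<Otimes>\<^sub>M unif01) (\<lambda>z. (W1 (fst z), snd z))"
      unfolding Q_def by (rule distr_cong) (simp_all add: case_prod_beta)
    finally have pr: "distr Q1 seqs W1 \<Otimes>\<^sub>M unif01 = distr Q (seqs \<Otimes>\<^sub>M unif01) (\<lambda>z. (W1 (fst z), snd z))"
      unfolding distr_id .
    have "distr Q (seqs \<Otimes>\<^sub>M borel) (\<lambda>z. (W1 (fst z), t z)) =
      distr (distr Q (seqs \<Otimes>\<^sub>M unif01) (\<lambda>z. (W1 (fst z), snd z))) (seqs \<Otimes>\<^sub>M borel) (\<lambda>z. (fst z, T z))"
      unfolding distr_distr[OF fT WU] by (simp add: comp_def t_def)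
    also have "\<dots> = distr (distr Q2 seqs W2 \<Otimes>\<^sub>M unif01) (seqs \<Otimes>\<^sub>M borel) (\<lambda>z. (fst z, T z))"
      unfolding pr[symmetric] Q1_def law Q2_def[symmetric] ..
    finally show ?thesis unfolding Tlaw .
  qed
  have dfQ2: "distr Q2 M2 fst = M2" unfolding Q2_def by (rule prob_space.distr_pair_fst[OF U])
  have t\<gamma>: "distr Q borel t = \<gamma>"
  proof -
    have "distr Q borel t = distr (distr Q (seqs \<Otimes>\<^sub>M borel) (\<lambda>z. (W1 (fst z), t z))) borel snd"
      unfolding distr_distr[OF measurable_snd Wt] by (simp add: comp_def)
    also have "\<dots> = distr Q2 borel (\<lambda>z. g (fst z))"
      unfolding joint distr_distr[OF measurable_snd Wg] by (simp add: comp_def)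
    also have "\<dots> = distr (distr Q2 M2 fst) borel g"
      unfolding distr_distr[OF g f2] by (simp add: comp_def)
    finally show ?thesis unfolding dfQ2 \<gamma>_def .
  qed
  have s\<gamma>: "sets \<gamma> = sets borel" by (simp add: \<gamma>_def)
  have hm: "h \<in> completion \<gamma> \<rightarrow>\<^sub>M M2" using h unfolding \<gamma>_def .
  \<comment> \<open>As \<open>h\<close> is defined on the completion of \<open>\<gamma>\<close>, maps with law \<open>\<gamma>\<close> have to be read as maps into this completion.\<close>
  have lift: "X \<in> completion N \<rightarrow>\<^sub>M completion \<gamma> \<and> distr (completion N) (completion \<gamma>) X = completion \<gamma>"
    if X: "X \<in> borel_measurable N" and d: "distr N borel X = \<gamma>" for X and N :: "'c measure"
  proof -
    have X\<gamma>: "X \<in> completion N \<rightarrow>\<^sub>M \<gamma>"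
      using measurable_completion[OF X] unfolding measurable_cong_sets[OF refl s\<gamma>] .
    have X\<gamma>': "X \<in> N \<rightarrow>\<^sub>M \<gamma>" using X unfolding measurable_cong_sets[OF refl s\<gamma>] .
    have "distr (completion N) \<gamma> X = distr N \<gamma> X" by (rule distr_completion[OF X\<gamma>'])
    also have "\<dots> = distr N borel X" by (rule distr_cong) (simp_all add: s\<gamma>)
    finally have dd: "distr (completion N) \<gamma> X = \<gamma>" unfolding d .
    have "X \<in> completion N \<rightarrow>\<^sub>M completion \<gamma>"
      by (rule complete_measure.measurable_completion2[OF completion.complete_measure_axioms X\<gamma>]) (simp add: dd)
    moreover have "completion (distr (completion N) \<gamma> X) = distr (completion N) (completion \<gamma>) X"
      by (rule complete_measure.completion_distr_eq[OF completion.complete_measure_axioms X\<gamma>]) (simp add: dd)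
    ultimately show ?thesis unfolding dd by simp
  qed
  have tc: "t \<in> completion Q \<rightarrow>\<^sub>M completion \<gamma>" and td: "distr (completion Q) (completion \<gamma>) t = completion \<gamma>"
    using lift[OF tm t\<gamma>] by simp_all
  have gd: "g \<in> completion M2 \<rightarrow>\<^sub>M completion \<gamma>" "distr (completion M2) (completion \<gamma>) g = completion \<gamma>"
    using lift[OF g \<gamma>_def[symmetric]] by simp_all
  have ht: "(\<lambda>z. h (t z)) \<in> completion Q \<rightarrow>\<^sub>M M2" by (rule measurable_compose[OF tc hm])
  have hd: "distr (completion \<gamma>) M2 h = M2"
  proof (rule measure_eqI)
    fix A assume "A \<in> sets (distr (completion \<gamma>) M2 h)"
    then have A: "A \<in> sets M2" by simp
    have hA: "h -` A \<inter> space (completion \<gamma>) \<in> sets (completion \<gamma>)" by (rule measurable_sets[OF hm A])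
    have "emeasure (distr (completion \<gamma>) M2 h) A = emeasure (completion \<gamma>) (h -` A \<inter> space (completion \<gamma>))"
      by (rule emeasure_distr[OF hm A])
    also have "\<dots> = emeasure (distr (completion M2) (completion \<gamma>) g) (h -` A \<inter> space (completion \<gamma>))" by (simp only: gd(2))
    also have "\<dots> = emeasure (completion M2) (g -` (h -` A \<inter> space (completion \<gamma>)) \<inter> space (completion M2))"
      by (rule emeasure_distr[OF gd(1) hA])
    also have "\<dots> = emeasure (completion M2) A"
    proof (rule emeasure_eq_AE)
      have "AE \<omega> in completion M2. h (g \<omega>) = \<omega>" by (rule AE_completion[OF hg])
      then show "AE \<omega> in completion M2. (\<omega> \<in> g -` (h -` A \<inter> space (completion \<gamma>)) \<inter> space (completion M2)) = (\<omega> \<in> A)"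
        using AE_space
      proof eventually_elim
        case (elim \<omega>)
        then show ?case using measurable_space[OF gd(1) elim(2)] by simp
      qed
      show "g -` (h -` A \<inter> space (completion \<gamma>)) \<inter> space (completion M2) \<in> sets (completion M2)"
        by (rule measurable_sets[OF gd(1) hA])
      show "A \<in> sets (completion M2)" using A by simp
    qed
    also have "\<dots> = emeasure M2 A" using A by (simp add: emeasure_completion)
    finally show "emeasure (distr (completion \<gamma>) M2 h) A = emeasure M2 A" .
  qed simp
  define J where "J = distr (completion Q) (M1 \<Otimes>\<^sub>M M2) (\<lambda>z. (fst (fst z), h (t z)))"
  have ff: "(\<lambda>z. fst (fst z)) \<in> Q \<rightarrow>\<^sub>M M1" by (rule measurable_compose[OF fQ f1])
  have ffc: "(\<lambda>z. fst (fst z)) \<in> completion Q \<rightarrow>\<^sub>M M1" by (rule measurable_completion[OF ff])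
  have Jm: "(\<lambda>z. (fst (fst z), h (t z))) \<in> completion Q \<rightarrow>\<^sub>M M1 \<Otimes>\<^sub>M M2" by (rule measurable_Pair[OF ffc ht])
  have Qc: "prob_space (completion Q)" by (rule prob_space.prob_space_completion[OF Q])
  have J1: "distr J M1 fst = M1"
  proof -
    have "distr J M1 fst = distr (completion Q) M1 (\<lambda>z. fst (fst z))"
      unfolding J_def distr_distr[OF measurable_fst Jm] by (simp add: comp_def)
    also have "\<dots> = distr Q M1 (\<lambda>z. fst (fst z))" by (rule distr_completion[OF ff])
    also have "\<dots> = distr (distr Q Q1 fst) M1 fst"
      unfolding distr_distr[OF f1 fQ] by (simp add: comp_def)
    also have "distr Q Q1 fst = Q1" unfolding Q_def by (rule prob_space.distr_pair_fst[OF U])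
    also have "distr Q1 M1 fst = M1" unfolding Q1_def by (rule prob_space.distr_pair_fst[OF U])
    finally show ?thesis .
  qed
  have J2: "distr J M2 snd = M2"
  proof -
    have "distr J M2 snd = distr (completion Q) M2 (\<lambda>z. h (t z))"
      unfolding J_def distr_distr[OF measurable_snd Jm] by (simp add: comp_def)
    also have "\<dots> = distr (distr (completion Q) (completion \<gamma>) t) M2 h"
      unfolding distr_distr[OF hm tc] by (simp add: comp_def)
    finally show ?thesis unfolding td hd .
  qed
  have joining: "joining M1 M2 J"
    unfolding joining_def using J1 J2 prob_space.prob_space_distr[OF Qc Jm] by (simp add: J_def)
  have Y2i: "(\<lambda>\<omega>. Y2 \<omega> i) \<in> borel_measurable M2" for i
    using measurable_compose[OF Y2 measurable_component_singleton[of i]] by simp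
  \<comment> \<open>With a Borel version of \<open>Y2\<close> in terms of the coordinate, equality of the ranges becomes a Borel condition on sequence and coordinate, which only depends on their joint law.\<close>
  have "\<exists>y. y \<in> borel_measurable \<gamma> \<and> (AE x in \<gamma>. Y2 (h x) i = y x)" for i
    using completion_ex_borel_measurable_real[OF measurable_compose[OF hm Y2i[of i]]] by (elim bexE) (intro exI conjI)
  from choice[OF allI[OF this]] obtain y where y: "\<forall>i. y i \<in> borel_measurable \<gamma> \<and> (AE x in \<gamma>. Y2 (h x) i = y i x)" ..
  have ym: "y i \<in> borel_measurable borel" for i using y unfolding measurable_cong_sets[OF s\<gamma> refl] by simp
  have yAE: "AE x in \<gamma>. \<forall>i. Y2 (h x) i = y i x" using y by (simp add: AE_all_countable)
  have yseq: "(\<lambda>x i. y i x) \<in> borel \<rightarrow>\<^sub>M seqs" by (rule measurable_PiM_single') (use ym in \<open>auto simp: space_PiM\<close>)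
  have "AE \<omega> in M2. \<forall>i. Y2 (h (g \<omega>)) i = y i (g \<omega>)"
    by (rule AE_distrD[OF g]) (use yAE in \<open>simp only: \<gamma>_def\<close>)
  with hg have y2: "AE \<omega> in M2. Y2 \<omega> = (\<lambda>i. y i (g \<omega>))"
    by eventually_elim (simp add: fun_eq_iff)
  define E where "E = {z \<in> space (seqs \<Otimes>\<^sub>M seqs). range (fst z) = range (snd z)}"
  have E: "E \<in> sets (seqs \<Otimes>\<^sub>M seqs)" unfolding E_def by (rule sets_range_eq)
  have spS: "z \<in> space (seqs \<Otimes>\<^sub>M seqs)" for z :: "(nat \<Rightarrow> real) \<times> (nat \<Rightarrow> real)" by (simp add: space_pair_measure space_PiM)
  have Em: "{z \<in> space (seqs \<Otimes>\<^sub>M borel). range (fst z) = range (\<lambda>i. y i (snd z))} \<in> sets (seqs \<Otimes>\<^sub>M borel)"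
  proof -
    have m: "(\<lambda>z. (fst z, \<lambda>i. y i (snd z))) \<in> seqs \<Otimes>\<^sub>M borel \<rightarrow>\<^sub>M seqs \<Otimes>\<^sub>M seqs"
      by (intro measurable_Pair measurable_fst measurable_compose[OF measurable_snd yseq])
    have "{z \<in> space (seqs \<Otimes>\<^sub>M borel). range (fst z) = range (\<lambda>i. y i (snd z))} = (\<lambda>z. (fst z, \<lambda>i. y i (snd z))) -` E \<inter> space (seqs \<Otimes>\<^sub>M borel)"
      unfolding E_def using spS by auto
    then show ?thesis using measurable_sets[OF m E] by simp
  qed
  have "AE z in Q2. range (W2 z) = range (\<lambda>i. y i (g (fst z)))"
    using r2 AE_pair_fst[OF U y2] unfolding Q2_def by eventually_elim simp
  then have "AE z in distr Q2 (seqs \<Otimes>\<^sub>M borel) (\<lambda>z. (W2 z, g (fst z))). range (fst z) = range (\<lambda>i. y i (snd z))"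
    by (subst AE_distr_iff[OF Wg Em]) simp
  then have "AE z in Q. range (fst (W1 (fst z), t z)) = range (\<lambda>i. y i (snd (W1 (fst z), t z)))"
    by (intro AE_distrD[OF Wt]) (simp only: joint)
  then have a1: "AE z in Q. range (W1 (fst z)) = range (\<lambda>i. y i (t z))" by simp
  have a2: "AE z in Q. range (W1 (fst z)) = range (Y1 (fst (fst z)))"
    unfolding Q_def by (rule AE_pair_fst[OF U]) (use r1 in \<open>simp only: Q1_def\<close>)
  have a3: "AE z in Q. \<forall>i. Y2 (h (t z)) i = y i (t z)"
    by (rule AE_distrD[OF tm]) (use yAE in \<open>simp only: t\<gamma>\<close>)
  from a1 a2 a3 have "AE z in Q. range (Y1 (fst (fst z))) = range (Y2 (h (t z)))"
    by eventually_elim simp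
  then have c: "AE z in completion Q. range (Y1 (fst (fst z))) = range (Y2 (h (t z)))" by (rule AE_completion)
  have "AE p in J. range (Y1 (fst p)) = range (Y2 (snd p))"
    unfolding J_def
  proof (subst AE_distr_iff[OF Jm])
    have m: "(\<lambda>p. (Y1 (fst p), Y2 (snd p))) \<in> M1 \<Otimes>\<^sub>M M2 \<rightarrow>\<^sub>M seqs \<Otimes>\<^sub>M seqs"
      by (intro measurable_Pair measurable_compose[OF measurable_fst Y1] measurable_compose[OF measurable_snd Y2])
    have "{p \<in> space (M1 \<Otimes>\<^sub>M M2). range (Y1 (fst p)) = range (Y2 (snd p))} = (\<lambda>p. (Y1 (fst p), Y2 (snd p))) -` E \<inter> space (M1 \<Otimes>\<^sub>M M2)"
      unfolding E_def using spS by auto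
    then show "{p \<in> space (M1 \<Otimes>\<^sub>M M2). range (Y1 (fst p)) = range (Y2 (snd p))} \<in> sets (M1 \<Otimes>\<^sub>M M2)"
      using measurable_sets[OF m E] by simp
  qed (use c in simp)
  then show ?thesis using joining by (intro exI[of _ J] conjI)
qed

theorem theorem1p11:
  fixes M1 :: "'a measure" and M2 :: "'b measure"
    and X1 :: "'a \<Rightarrow> real set" and X2 :: "'b \<Rightarrow> real set"
  assumes "standard_prob_space M1" and "standard_prob_space M2"
    and "random_dcs M1 0 1 X1" and "random_dcs M2 0 1 X2"
    and "stationary M1 X1" and "independence_condition M1 X1"
    and "stationary M2 X2" and "independence_condition M2 X2"
  shows "identically_distributed M1 X1 M2 X2"
proof -
  have M1: "prob_space M1" and M2: "prob_space M2"
    using assms(1,2) by (simp_all add: standard_prob_space_def)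
  from assms(3) obtain Y1 where Y1: "measurable_lifting M1 0 1 X1 Y1" unfolding random_dcs_def by (elim conjE exE)
  from assms(4) obtain Y2 where Y2: "measurable_lifting M2 0 1 X2 Y2" unfolding random_dcs_def by (elim conjE exE)
  note gen1 = generic_enumeration[OF M1 assms(3,5,6) Y1] and gen2 = generic_enumeration[OF M2 assms(4,7,8) Y2]
  from common_law[OF M1 M2 gen1 gen2] obtain W1 W2 where
    W: "W1 \<in> M1 \<Otimes>\<^sub>M unif01 \<rightarrow>\<^sub>M seqs" "W2 \<in> M2 \<Otimes>\<^sub>M unif01 \<rightarrow>\<^sub>M seqs"
      "distr (M1 \<Otimes>\<^sub>M unif01) seqs W1 = distr (M2 \<Otimes>\<^sub>M unif01) seqs W2"
    and r1: "AE z in M1 \<Otimes>\<^sub>M unif01. range (W1 z) = range (Y1 (fst z))"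
    and r2: "AE z in M2 \<Otimes>\<^sub>M unif01. range (W2 z) = range (Y2 (fst z))"
    by (elim exE conjE) (rule that)
  from standard_prob_space_coordinate[OF assms(2)] obtain g :: "'b \<Rightarrow> real" and h lo hi where
    g: "g \<in> borel_measurable M2" "\<forall>\<omega>\<in>space M2. lo \<le> g \<omega> \<and> g \<omega> \<le> hi"
    and h: "h \<in> completion (distr M2 borel g) \<rightarrow>\<^sub>M M2" "AE \<omega> in M2. h (g \<omega>) = \<omega>"
    by (elim exE conjE) (rule that)
  have "\<exists>J. joining M1 M2 J \<and> (AE p in J. range (Y1 (fst p)) = range (Y2 (snd p)))"
    by (rule glue_along_sequences[OF M1 M2 g(1) _ h genericD(1)[OF gen1] genericD(1)[OF gen2] W r1 r2])
      (rule bspec[OF g(2)])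
  then obtain J where J: "joining M1 M2 J" and JY: "AE p in J. range (Y1 (fst p)) = range (Y2 (snd p))" by (elim exE conjE)
  have sJ: "sets J = sets (M1 \<Otimes>\<^sub>M M2)" and d: "distr J M1 fst = M1" "distr J M2 snd = M2"
    using J by (simp_all add: joining_def)
  have fs: "fst \<in> J \<rightarrow>\<^sub>M M1" "snd \<in> J \<rightarrow>\<^sub>M M2" unfolding measurable_cong_sets[OF sJ refl] by simp_all
  have "AE p in J. X1 (fst p) = range (Y1 (fst p))"
    by (rule AE_distrD[OF fs(1)]) (unfold d, rule measurable_liftingD(2)[OF Y1])
  moreover have "AE p in J. X2 (snd p) = range (Y2 (snd p))"
    by (rule AE_distrD[OF fs(2)]) (unfold d, rule measurable_liftingD(2)[OF Y2])
  ultimately have "AE p in J. X1 (fst p) = X2 (snd p)"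
    using JY by eventually_elim simp
  then show ?thesis unfolding identically_distributed_def using J by (intro exI[of _ J] conjI)
qed

end
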